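(* Let $\gamma>3/4$ and let $v:[0,\infty)\to\mathbb{R}$ be measurable with $|v(t)|\lesssim\langle t\rangle^{-\gamma}$. Let $x(t,k)=(x_n(t,k))_{n\ge0}$, $k\in\mathbb{R}$, be the $\ell^2$-valued solution of $$x_n'=ikn^2x_n+iv(t)(x_{n-1}+x_{n+1})\ (n\ge1),\qquad x_0'=iv(t)x_1,\qquad x_n(0,k)=\delta_{n,0}.$$ Then the function $$k\mapsto\sup_{t>0}\sum_{n=1}^\infty n^2|x_n(t,k)|^2$$ belongs to $L^1_{\rm loc}(\mathbb{R})$.
   Context: $\langle t\rangle=(1+t^2)^{1/2}$. The system is the evolution $x_t=ik\Lambda x+iQ(t)x$, $x(0,k)=\delta_0$ in $\ell^2(\mathbb{Z}_{\ge 0})$, with $\Lambda$ diagonal with eigenvalues $n^2$, $n=0,1,\dots$, and $Q_{mn}(t)=v(t)$ if $|m-n|=1$ and $0$ otherwise; solutions are understood in the weak (Duhamel) sense: $x(t,k)=e^{ikt\Lambda}\delta_0+i\int_0^te^{ik(t-\tau)\Lambda}Q(\tau)x(\tau,k)d\tau$. *)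

theory Defs
  imports "HOL-Analysis.Analysis"
begin

definition japanese_bracket :: "real \<Rightarrow> real" where
  "japanese_bracket t = (1 + t\<^sup>2) powr (1/2)"

definition ell2 :: "(nat \<Rightarrow> complex) set" where
  "ell2 = {a. summable (\<lambda>n. (cmod (a n))\<^sup>2)}"

text \<open>Only meaningful on \<^const>\<open>ell2\<close>, as \<^const>\<open>suminf\<close> is
  unspecified for divergent series.\<close>

definition ell2_norm :: "(nat \<Rightarrow> complex) \<Rightarrow> real" where
  "ell2_norm a = sqrt (\<Sum>n. (cmod (a n))\<^sup>2)"

definition ell2_continuous_on :: "real set \<Rightarrow> (real \<Rightarrow> nat \<Rightarrow> complex) \<Rightarrow> bool" where
  "ell2_continuous_on S y \<longleftrightarrow>
     (\<forall>t\<in>S. y t \<in> ell2) \<and>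
     (\<forall>t\<in>S. ((\<lambda>s. ell2_norm (\<lambda>n. y s n - y t n)) \<longlongrightarrow> 0) (at t within S))"

text \<open>The \<open>n\<close>-th coordinate of \<open>Q(t) a\<close>, where \<open>Q(t)\<close> has the entries \<open>v(t)\<close> at
  the positions with \<open>|m - n| = 1\<close> and \<open>0\<close> elsewhere.\<close>

definition Q_apply :: "(real \<Rightarrow> real) \<Rightarrow> real \<Rightarrow> (nat \<Rightarrow> complex) \<Rightarrow> nat \<Rightarrow> complex" where
  "Q_apply v t a n =
     complex_of_real (v t) * (case n of 0 \<Rightarrow> a 1 | Suc m \<Rightarrow> a m + a (Suc n))"

text \<open>Weak solution of \<open>y' = i k \<Lambda> y + i Q(t) y\<close>, \<open>y(0) = \<delta>\<^sub>0\<close>, on \<open>[0,\<infinity>)\<close>: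
  the Duhamel identity in \<open>\<ell>\<^sup>2\<close>, written coordinatewise (\<open>\<Lambda>\<close> is diagonal with
  entries \<open>n\<^sup>2\<close>). For bounded measurable \<open>v\<close> and \<open>y\<close> satisfying this identity, continuity in \<open>\<ell>\<^sup>2\<close> is equivalent to
  Bochner integrability of the Duhamel integrand on each \<open>[0,t]\<close>, and it makes every
  coordinate integral below converge absolutely.\<close>

definition weak_solution ::
    "(real \<Rightarrow> real) \<Rightarrow> real \<Rightarrow> (real \<Rightarrow> nat \<Rightarrow> complex) \<Rightarrow> bool" where
  "weak_solution v k y \<longleftrightarrow>
     ell2_continuous_on {0..} y \<and>
     (\<forall>t\<ge>0. \<forall>n.
        y t n = exp (\<i> * complex_of_real (k * t * (real n)\<^sup>2)) * (if n = 0 then 1 else 0)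
              + \<i> * (LINT \<tau>:{0..t}|lebesgue.
                       exp (\<i> * complex_of_real (k * (t - \<tau>) * (real n)\<^sup>2)) * Q_apply v \<tau> (y \<tau>) n))"

text \<open>Local integrability of an extended nonnegative function: the suprema considered
  may a priori be infinite at some points.\<close>

definition L1_loc :: "(real \<Rightarrow> ennreal) \<Rightarrow> bool" where
  "L1_loc f \<longleftrightarrow>
     f \<in> borel_measurable lebesgue \<and>
     (\<forall>K. compact K \<longrightarrow> (\<integral>\<^sup>+k\<in>K. f k \<partial>lebesgue) < \<infinity>)"

end

theory Submission
  imports Defs "HOL-Probability.Characteristic_Functions"
begin

text \<open>
In the interaction picture \<open>a\<^sub>n = e\<^bsup>-ikn\<^sup>2t\<^esup> x\<^sub>n\<close> the system becomes
\<open>a\<^sub>n' = i v (e\<^bsub>n-1\<^esub> a\<^bsub>n-1\<^esub> + cnj e\<^sub>n a\<^bsub>n+1\<^esub>)\<close> with phases \<open>e\<^sub>n(t) = e\<^bsup>-ik(2n+1)t\<^esup>\<close>. The mass, the sum of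
all \<open>|a\<^sub>n|\<^sup>2\<close>, stays at most \<open>1\<close>, and the energy \<open>E\<close>, the sum of all \<open>n\<^sup>2 |a\<^sub>n|\<^sup>2\<close>, changes at the
rate \<open>-2 v\<close> times the sum of \<open>(2n+1) Im (e\<^sub>n q\<^sub>n)\<close>, where \<open>q\<^sub>n = cnj a\<^bsub>n+1\<^esub> a\<^sub>n\<close>.

Up to the time \<open>1/|k|\<close> the phases do not help, and absolute values are taken. Afterwards \<open>v e\<^sub>n\<close>
is integrated by parts: it is minus the derivative of the tail \<open>W\<^sub>n(t)\<close>, the integral of \<open>v e\<^sub>n\<close>
over \<open>[t,T]\<close>, while the derivative of \<open>q\<^sub>n\<close> contains another factor \<open>v\<close>. By Cauchy--Schwarz and
the bound for the mass, the weight \<open>2n + 1\<close> costs only the square root of the energy, so that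
all terms are linear in \<open>H\<close>, where \<open>H\<^sup>2\<close> is the maximum of \<open>1 + E\<close>. This gives (\<open>energy_bound\<close>)
\<open>H \<le> 1 + 6 V + 12 \<surd>(2A) + 24 A\<close>, where \<open>V\<close> is the integral of \<open>|v|\<close> up to \<open>1/|k|\<close> and \<open>A\<close> that
of \<open>|v| G\<close> beyond it, \<open>G\<close> being the \<open>\<ell>\<^sup>2\<close> norm of the tails in \<open>n\<close>. The boundary terms are
covered as well, because \<open>|W\<^sub>n|\<^sup>2 \<le> 2 A\<close> (\<open>tail_power2_le\<close>).

It remains to integrate \<open>V\<^sup>2\<close> and \<open>A\<^sup>2\<close> over bounded sets of \<open>k\<close>. The first is of order \<open>|k|\<^bsup>-1/2\<^esup>\<close>.
For the second, let \<open>\<gamma> = 3/4 + \<epsilon>\<close>. Plancherel's inequality and the substitution \<open>\<xi> = (2n+1) k\<close>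
bound the integral of \<open>|k|\<^sup>\<epsilon> G\<^sup>2\<close> in \<open>k\<close> by the integral of \<open>v\<^sup>2\<close> over \<open>[t,\<infinity>)\<close>, which is of order
\<open>t\<^bsup>1-2\<gamma>\<^esup>\<close> (\<open>tail_size_weighted_integral_le\<close>); here \<open>|k|\<^sup>\<epsilon>\<close> makes the sum over \<open>n\<close> converge, and it
costs only \<open>t\<^sup>\<epsilon>\<close> because \<open>t \<ge> 1/|k|\<close>. Heuristically \<open>A\<close> is then at most the integral of
\<open>t\<^bsup>-\<gamma>\<^esup> t\<^bsup>1/2-\<gamma>+\<epsilon>/2\<^esup>\<close>, which converges for \<open>\<gamma> > 3/4\<close>; the rigorous version is a weighted
Cauchy--Schwarz inequality in \<open>t\<close> (\<open>far_integral_power2_le\<close>, \<open>far_mass_integral_le\<close>).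

All estimates are made for an energy truncated in \<open>n\<close> and for times up to a finite horizon, with
constants independent of both; monotone convergence removes the truncation. Measurability of the
supremum holds because \<open>x(t,k)\<close> depends continuously on \<open>k\<close>, which is another energy estimate
(\<open>unit_flow_difference\<close>).
\<close>

section \<open>Indefinite integrals of locally bounded functions\<close>

definition locally_bounded :: "(real \<Rightarrow> 'a::euclidean_space) \<Rightarrow> bool" where
  "locally_bounded f \<longleftrightarrow> f \<in> borel_measurable borel \<and> (\<forall>T. \<exists>B. \<forall>t\<in>{0..T}. norm (f t) \<le> B)"

text \<open>Since \<open>v\<close> is only measurable, the coordinates of a solution are differentiable almost
everywhere at best, and the calculus below is phrased with indefinite integrals. The interval
\<open>{0..t}\<close> is empty for \<open>t < 0\<close>, so that a primitive is constant there; this makes it continuous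
on the whole line, and no domain has to be carried along.\<close>

definition primitive :: "(real \<Rightarrow> 'a::euclidean_space) \<Rightarrow> (real \<Rightarrow> 'a) \<Rightarrow> bool" where
  "primitive F f \<longleftrightarrow> locally_bounded f \<and> (\<forall>t. F t = F 0 + integral {0..t} f)"

lemma locally_bounded_measurable: "locally_bounded f \<Longrightarrow> f \<in> borel_measurable borel"
  by (simp add: locally_bounded_def)

lemma locally_bounded_bound:
  assumes "locally_bounded f" obtains B where "B \<ge> 0" "\<And>t. 0 \<le> t \<Longrightarrow> t \<le> T \<Longrightarrow> norm (f t) \<le> B"
proof -
  obtain B where "\<forall>t\<in>{0..T}. norm (f t) \<le> B" using assms unfolding locally_bounded_def by blast
  then have "max B 0 \<ge> 0" "\<And>t. 0 \<le> t \<Longrightarrow> t \<le> T \<Longrightarrow> norm (f t) \<le> max B 0" by (auto simp: le_max_iff_disj)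
  then show thesis using that by blast
qed

lemma locally_bounded_continuous:
  assumes "continuous_on UNIV f" shows "locally_bounded f"
proof -
  have "\<exists>B. \<forall>t\<in>{0..T}. norm (f t) \<le> B" for T
  proof -
    have "compact (f ` {0..T})"
      using assms by (intro compact_continuous_image) (auto intro: continuous_on_subset)
    then have "bounded (f ` {0..T})" by (rule compact_imp_bounded)
    then show ?thesis unfolding bounded_iff by auto
  qed
  then show ?thesis using borel_measurable_continuous_onI[OF assms] by (simp add: locally_bounded_def)
qed

lemma locally_bounded_const: "locally_bounded (\<lambda>_. c)"
  by (auto simp: locally_bounded_def)

lemma locally_bounded_bilinear:
  assumes "bounded_bilinear h" "locally_bounded f" "locally_bounded g"
  shows "locally_bounded (\<lambda>t. h (f t) (g t))"
proof -
  interpret bounded_bilinear h by fact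
  obtain K where K: "0 < K" "\<And>a b. norm (h a b) \<le> norm a * norm b * K" using pos_bounded by blast
  have "\<exists>B. \<forall>t\<in>{0..T}. norm (h (f t) (g t)) \<le> B" for T
  proof -
    obtain B where B: "0 \<le> B" "\<And>t. 0 \<le> t \<Longrightarrow> t \<le> T \<Longrightarrow> norm (f t) \<le> B"
      using locally_bounded_bound[OF assms(2)] by metis
    obtain B' where B': "0 \<le> B'" "\<And>t. 0 \<le> t \<Longrightarrow> t \<le> T \<Longrightarrow> norm (g t) \<le> B'"
      using locally_bounded_bound[OF assms(3)] by metis
    have "norm (h (f t) (g t)) \<le> B * B' * K" if "t \<in> {0..T}" for t
      using that B B' K by (intro order.trans[OF K(2)] mult_right_mono mult_mono) auto
    then show ?thesis by blast
  qed
  moreover have "(\<lambda>t. h (f t) (g t)) \<in> borel_measurable borel"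
  proof -
    have "continuous_on UNIV (\<lambda>p. h (fst p) (snd p))"
      by (intro continuous_on continuous_intros)
    then have 1: "(\<lambda>p. h (fst p) (snd p)) \<in> borel_measurable borel" by (rule borel_measurable_continuous_onI)
    have 2: "(\<lambda>t. (f t, g t)) \<in> borel \<rightarrow>\<^sub>M borel"
      using assms(2,3)[THEN locally_bounded_measurable] by (rule borel_measurable_Pair)
    show ?thesis using measurable_compose[OF 2 1] by simp
  qed
  ultimately show ?thesis by (simp add: locally_bounded_def)
qed

lemma locally_bounded_mult:
  fixes f g :: "real \<Rightarrow> 'a::{real_normed_algebra,euclidean_space}"
  shows "locally_bounded f \<Longrightarrow> locally_bounded g \<Longrightarrow> locally_bounded (\<lambda>t. f t * g t)"
  by (rule locally_bounded_bilinear[OF bounded_bilinear_mult])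

lemma locally_bounded_linear:
  assumes "bounded_linear h" "locally_bounded f" shows "locally_bounded (\<lambda>t. h (f t))"
proof -
  interpret bounded_linear h by fact
  obtain K where K: "0 < K" "\<And>a. norm (h a) \<le> norm a * K" using pos_bounded by blast
  have "\<exists>B. \<forall>t\<in>{0..T}. norm (h (f t)) \<le> B" for T
  proof -
    obtain B where B: "0 \<le> B" "\<And>t. 0 \<le> t \<Longrightarrow> t \<le> T \<Longrightarrow> norm (f t) \<le> B"
      using locally_bounded_bound[OF assms(2)] by metis
    have "norm (h (f t)) \<le> B * K" if "t \<in> {0..T}" for t
      using that B K by (intro order.trans[OF K(2)] mult_right_mono) auto
    then show ?thesis by blast
  qed
  moreover have "h \<in> borel_measurable borel"
    using assms(1) by (intro borel_measurable_continuous_onI linear_continuous_on)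
  then have "(\<lambda>t. h (f t)) \<in> borel_measurable borel"
    using locally_bounded_measurable[OF assms(2)] measurable_compose by blast
  ultimately show ?thesis by (simp add: locally_bounded_def)
qed

lemma locally_bounded_add:
  assumes "locally_bounded f" "locally_bounded g" shows "locally_bounded (\<lambda>t. f t + g t)"
proof -
  have "\<exists>B. \<forall>t\<in>{0..T}. norm (f t + g t) \<le> B" for T
  proof -
    obtain B where B: "\<And>t. 0 \<le> t \<Longrightarrow> t \<le> T \<Longrightarrow> norm (f t) \<le> B"
      using locally_bounded_bound[OF assms(1)] by metis
    obtain B' where B': "\<And>t. 0 \<le> t \<Longrightarrow> t \<le> T \<Longrightarrow> norm (g t) \<le> B'"
      using locally_bounded_bound[OF assms(2)] by metis
    have "norm (f t + g t) \<le> B + B'" if "t \<in> {0..T}" for t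
      using that B B' by (intro order.trans[OF norm_triangle_ineq] add_mono) auto
    then show ?thesis by blast
  qed
  moreover have "(\<lambda>t. f t + g t) \<in> borel_measurable borel"
    using assms[THEN locally_bounded_measurable] by (rule borel_measurable_add)
  ultimately show ?thesis by (simp add: locally_bounded_def)
qed

lemma locally_bounded_minus: "locally_bounded f \<Longrightarrow> locally_bounded (\<lambda>t. - f t)"
  by (rule locally_bounded_linear[OF bounded_linear_minus[OF bounded_linear_ident]])

lemma locally_bounded_of_real: "locally_bounded f \<Longrightarrow> locally_bounded (\<lambda>t. complex_of_real (f t))"
  by (rule locally_bounded_linear[OF bounded_linear_of_real])

lemma locally_bounded_norm: "locally_bounded f \<Longrightarrow> locally_bounded (\<lambda>t. norm (f t))"
  by (auto simp: locally_bounded_def intro: borel_measurable_norm)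

lemma locally_bounded_integrable:
  assumes "locally_bounded f" "0 \<le> s"
  shows "f absolutely_integrable_on {s..t}"
proof -
  obtain B where B: "\<And>r. 0 \<le> r \<Longrightarrow> r \<le> t \<Longrightarrow> norm (f r) \<le> B" using locally_bounded_bound[OF assms(1)] by metis
  show ?thesis
  proof (rule measurable_bounded_by_integrable_imp_absolutely_integrable)
    show "f \<in> borel_measurable (lebesgue_on {s..t})"
      using locally_bounded_measurable[OF assms(1)]
      by (simp add: borel_measurable_if_D measurable_completion measurable_restrict_space1)
    show "(\<lambda>_. B) integrable_on {s..t}" by (rule integrable_const_ivl)
  qed (use B assms in auto)
qed

lemma locally_bounded_integrable_on: "locally_bounded f \<Longrightarrow> 0 \<le> s \<Longrightarrow> f integrable_on {s..t}"
  using locally_bounded_integrable absolutely_integrable_on_def by blast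

lemma locally_bounded_set_integrable:
  assumes "locally_bounded f" "0 \<le> s" shows "set_integrable lborel {s..t} f"
proof -
  have "(\<lambda>x. indicator {s..t} x *\<^sub>R f x) \<in> borel_measurable lborel"
    using locally_bounded_measurable[OF assms(1)] by measurable
  with locally_bounded_integrable[OF assms, of t] show ?thesis
    unfolding set_integrable_def by (simp only: integrable_completion)
qed

lemma primitive_locally_bounded: "primitive F f \<Longrightarrow> locally_bounded f"
  by (simp add: primitive_def)

lemma primitive_integral: "locally_bounded f \<Longrightarrow> primitive (\<lambda>t. c + integral {0..t} f) f"
  by (simp add: primitive_def)

lemma primitive_diff:
  assumes "primitive F f" "0 \<le> s" "s \<le> t"
  shows "F t - F s = integral {s..t} f"
proof -
  have "F t = F 0 + integral {0..t} f" "F s = F 0 + integral {0..s} f"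
    using assms(1) unfolding primitive_def by blast+
  moreover have "integral {0..s} f + integral {s..t} f = integral {0..t} f"
    using assms by (intro Henstock_Kurzweil_Integration.integral_combine locally_bounded_integrable_on primitive_locally_bounded) auto
  ultimately show ?thesis by (metis add_diff_cancel_left add_diff_cancel_left')
qed

lemma primitive_neg: "primitive F f \<Longrightarrow> t \<le> 0 \<Longrightarrow> F t = F 0"
proof -
  assume "primitive F f" "t \<le> 0"
  then have "F t = F 0 + integral {0..t} f" unfolding primitive_def by blast
  moreover have "integral {0..t} f = 0" using \<open>t \<le> 0\<close> by (cases "t = 0") auto
  ultimately show ?thesis by simp
qed

lemma primitive_diff_bound:
  assumes "primitive F f" "0 \<le> s" "s \<le> t" "\<And>r. s \<le> r \<Longrightarrow> r \<le> t \<Longrightarrow> norm (f r) \<le> B"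
  shows "norm (F t - F s) \<le> B * (t - s)"
proof -
  have "norm (integral {s..t} f) \<le> integral {s..t} (\<lambda>_. B)"
    using assms by (intro integral_norm_bound_integral locally_bounded_integrable_on[OF primitive_locally_bounded] integrable_const_ivl) auto
  then show ?thesis using assms primitive_diff[OF assms(1-3)] by (simp add: algebra_simps)
qed

lemma primitive_continuous:
  assumes "primitive F f" shows "continuous_on UNIV F"
proof -
  have "continuous_on {..<T} F" for T
  proof -
    obtain B where B: "B \<ge> 0" "\<And>t. 0 \<le> t \<Longrightarrow> t \<le> max 0 T \<Longrightarrow> norm (f t) \<le> B"
      using locally_bounded_bound[OF primitive_locally_bounded[OF assms]] by metis
    have Fm: "F t = F (max 0 t)" for t using primitive_neg[OF assms, of t] by (auto simp: max_def)
    have "dist (F s) (F t) \<le> B * dist s t" if "s \<le> t" "t < T" for s t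
    proof -
      have "norm (F (max 0 t) - F (max 0 s)) \<le> B * (max 0 t - max 0 s)"
        using that B by (intro primitive_diff_bound[OF assms]) (auto simp: max_def split: if_splits)
      also have "\<dots> \<le> B * (t - s)" using that B by (intro mult_left_mono) auto
      finally have "norm (F t - F s) \<le> B * (t - s)" by (simp add: Fm[symmetric])
      then show ?thesis using that by (simp add: dist_norm norm_minus_commute)
    qed
    then have "B-lipschitz_on {..<T} F"
      using B by (intro lipschitz_onI) (metis dist_commute lessThan_iff linorder_le_cases, assumption)
    then show ?thesis by (rule lipschitz_on_continuous_on)
  qed
  then have "isCont F x" for x
    by (meson continuous_on_eq_continuous_at lessThan_iff less_add_one open_lessThan)
  then show ?thesis by (simp add: continuous_at_imp_continuous_on)
qed

lemma primitive_const: "primitive (\<lambda>_. c) (\<lambda>_. 0)"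
  by (simp add: primitive_def locally_bounded_const)

lemma primitive_linear:
  assumes "bounded_linear h" "primitive F f" shows "primitive (\<lambda>t. h (F t)) (\<lambda>t. h (f t))"
  unfolding primitive_def
proof (intro conjI allI)
  interpret bounded_linear h by fact
  show "locally_bounded (\<lambda>t. h (f t))" by (rule locally_bounded_linear[OF assms(1) primitive_locally_bounded[OF assms(2)]])
  fix t
  have "F t = F 0 + integral {0..t} f" using assms(2) unfolding primitive_def by blast
  moreover have "integral {0..t} (h \<circ> f) = h (integral {0..t} f)"
    by (intro integral_linear locally_bounded_integrable_on[OF primitive_locally_bounded[OF assms(2)]] assms) auto
  ultimately show "h (F t) = h (F 0) + integral {0..t} (\<lambda>t. h (f t))" by (simp add: add o_def)
qed

lemma primitive_add:
  assumes "primitive F f" "primitive G g" shows "primitive (\<lambda>t. F t + G t) (\<lambda>t. f t + g t)"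
  unfolding primitive_def
proof (intro conjI allI)
  show "locally_bounded (\<lambda>t. f t + g t)" by (intro locally_bounded_add assms[THEN primitive_locally_bounded])
  fix t
  have "F t = F 0 + integral {0..t} f" "G t = G 0 + integral {0..t} g"
    using assms unfolding primitive_def by blast+
  moreover have "integral {0..t} (\<lambda>t. f t + g t) = integral {0..t} f + integral {0..t} g"
    by (intro Henstock_Kurzweil_Integration.integral_add locally_bounded_integrable_on assms[THEN primitive_locally_bounded]) auto
  ultimately show "F t + G t = F 0 + G 0 + integral {0..t} (\<lambda>t. f t + g t)" by simp
qed

lemma primitive_sum: "(\<And>i. i \<in> I \<Longrightarrow> primitive (F i) (f i)) \<Longrightarrow> primitive (\<lambda>t. \<Sum>i\<in>I. F i t) (\<lambda>t. \<Sum>i\<in>I. f i t)"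
  by (induction I rule: infinite_finite_induct) (simp_all add: primitive_add primitive_const)

text \<open>Product rule. With \<open>P\<close> the difference of \<open>F G\<close> and the integral of its expected
derivative, the increments of \<open>P\<close> over \<open>[s,t]\<close> are of order \<open>(t - s)\<^sup>2\<close>, because \<open>F\<close> and \<open>G\<close> are
Lipschitz. Hence \<open>P\<close> has derivative zero at every point, although \<open>F\<close> and \<open>G\<close> need not be
differentiable.\<close>

lemma primitive_mult:
  fixes F G :: "real \<Rightarrow> 'a::{real_normed_algebra,euclidean_space}"
  assumes F: "primitive F f" and G: "primitive G g"
  shows "primitive (\<lambda>t. F t * G t) (\<lambda>t. f t * G t + F t * g t)"
proof -
  let ?h = "\<lambda>t. f t * G t + F t * g t"
  note lF = locally_bounded_continuous[OF primitive_continuous[OF F]] and lG = locally_bounded_continuous[OF primitive_continuous[OF G]]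
  note lf = primitive_locally_bounded[OF F] and lg = primitive_locally_bounded[OF G]
  have h: "locally_bounded ?h" by (intro locally_bounded_add locally_bounded_mult lf lg lF lG)
  define P where "P t = F t * G t - integral {0..t} ?h" for t
  have PT: "P T = P 0" if "T \<ge> 0" for T
  proof -
    obtain B where B: "B \<ge> 0" "\<And>t. 0 \<le> t \<Longrightarrow> t \<le> T \<Longrightarrow> norm (f t) \<le> B" using locally_bounded_bound[OF lf] by metis
    obtain C where C: "C \<ge> 0" "\<And>t. 0 \<le> t \<Longrightarrow> t \<le> T \<Longrightarrow> norm (g t) \<le> C" using locally_bounded_bound[OF lg] by metis
    \<comment> \<open>Splitting the increment of \<open>F G\<close> leaves a product of two increments, which is quadratic in \<open>t - s\<close>.\<close>
    have quad: "norm (P t - P s) \<le> 2 * B * C * (t - s)\<^sup>2" if "0 \<le> s" "s \<le> t" "t \<le> T" for s t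
    proof -
      have int: "(f has_integral (F t - F s)) {s..t}" "(g has_integral (G t - G s)) {s..t}"
          "(?h has_integral integral {s..t} ?h) {s..t}"
        using that primitive_diff[OF F, of s t] primitive_diff[OF G, of s t]
        by (auto intro!: integrable_integral locally_bounded_integrable_on lf lg h)
      have e: "integral {0..t} ?h - integral {0..s} ?h = integral {s..t} ?h"
        using primitive_diff[OF primitive_integral[OF h, of 0] that(1,2)] by simp
      have swap: "p - q - (p' - q') = p - p' - (q - q')" for p q p' q' :: 'a by simp
      have "P t - P s = F t * G t - F s * G s - integral {s..t} ?h"
        unfolding P_def e[symmetric] by (rule swap)
      also have "F t * G t - F s * G s = (F t - F s) * G t + F s * (G t - G s)" by (simp add: algebra_simps)
      also have "norm (\<dots> - integral {s..t} ?h) \<le> 2 * B * C * (t - s) * measure lborel (cbox s t)"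
      proof (rule has_integral_bound)
        show "0 \<le> 2 * B * C * (t - s)" using B C that by simp
        have "((\<lambda>r. f r * G t + F s * g r - ?h r) has_integral
            ((F t - F s) * G t + F s * (G t - G s) - integral {s..t} ?h)) {s..t}"
          by (intro has_integral_diff has_integral_add has_integral_mult_left has_integral_mult_right int)
        then show "((\<lambda>r. f r * (G t - G r) - (F r - F s) * g r) has_integral
            ((F t - F s) * G t + F s * (G t - G s) - integral {s..t} ?h)) (cbox s t)"
          by (simp add: algebra_simps)
        fix r assume "r \<in> cbox s t" then have r: "r \<in> {s..t}" by simp
        have "norm (f r * (G t - G r)) \<le> B * (C * (t - s))"
        proof -
          have "norm (G t - G r) \<le> C * (t - r)"
            using r that C by (intro primitive_diff_bound[OF G]) auto
          also have "\<dots> \<le> C * (t - s)" using r C by (intro mult_left_mono) auto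
          finally show ?thesis using r that B by (intro order.trans[OF norm_mult_ineq] mult_mono) auto
        qed
        moreover have "norm ((F r - F s) * g r) \<le> (B * (t - s)) * C"
        proof -
          have "norm (F r - F s) \<le> B * (r - s)"
            using r that B by (intro primitive_diff_bound[OF F]) auto
          also have "\<dots> \<le> B * (t - s)" using r B by (intro mult_left_mono) auto
          finally show ?thesis using r that B C by (intro order.trans[OF norm_mult_ineq] mult_mono) auto
        qed
        ultimately show "norm (f r * (G t - G r) - (F r - F s) * g r) \<le> 2 * B * C * (t - s)"
          by (intro order.trans[OF norm_triangle_ineq4]) (simp add: algebra_simps)
      qed
      finally show ?thesis using that by (simp add: power2_eq_square mult.assoc)
    qed
    have "\<exists>c. \<forall>x\<in>{0..T}. P x = c"
    proof (rule has_derivative_zero_constant)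
      fix x assume x: "x \<in> {0..T}"
      show "(P has_derivative (\<lambda>h. 0)) (at x within {0..T})"
        unfolding has_derivative_within_alt
      proof (intro conjI allI impI)
        fix e :: real assume "e > 0"
        define d where "d = e / (2 * B * C + 1)"
        have "d > 0" using \<open>e > 0\<close> B C by (simp add: d_def add_nonneg_pos)
        moreover have "norm (P y - P x - 0) \<le> e * norm (y - x)" if y: "y \<in> {0..T}" "norm (y - x) < d" for y
        proof -
          have "norm (P y - P x) \<le> 2 * B * C * (y - x)\<^sup>2"
          proof (cases "x \<le> y")
            case True then show ?thesis using quad x y by auto
          next
            case False then have "norm (P x - P y) \<le> 2 * B * C * (x - y)\<^sup>2" using quad x y by auto
            then show ?thesis by (simp add: norm_minus_commute power2_commute)
          qed
          also have "\<dots> = (2 * B * C * \<bar>y - x\<bar>) * \<bar>y - x\<bar>" by (metis mult.assoc power2_abs power2_eq_square)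
          also have "\<dots> \<le> e * \<bar>y - x\<bar>"
          proof (intro mult_right_mono)
            have "2 * B * C * \<bar>y - x\<bar> \<le> (2 * B * C + 1) * d"
              using y B C \<open>d > 0\<close> by (intro mult_mono) auto
            also have "\<dots> = e" using B C by (simp add: d_def add_nonneg_pos less_imp_neq[symmetric])
            finally show "2 * B * C * \<bar>y - x\<bar> \<le> e" .
          qed auto
          finally show ?thesis by simp
        qed
        ultimately show "\<exists>d>0. \<forall>y\<in>{0..T}. norm (y - x) < d \<longrightarrow> norm (P y - P x - 0) \<le> e * norm (y - x)" by blast
      qed auto
    qed auto
    then show ?thesis using that by auto
  qed
  have "F t * G t = F 0 * G 0 + integral {0..t} ?h" if "t \<ge> 0" for t
  proof -
    have "F t * G t - integral {0..t} ?h = F 0 * G 0" using that PT[of t] by (simp add: P_def)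
    then show ?thesis by (metis diff_add_cancel)
  qed
  moreover have "F t * G t = F 0 * G 0 + integral {0..t} ?h" if "t < 0" for t
    using that primitive_neg[OF F, of t] primitive_neg[OF G, of t] by simp
  ultimately show ?thesis unfolding primitive_def using h by (meson not_le_imp_less)
qed

section \<open>The interaction picture\<close>

text \<open>Passing to \<open>a\<^sub>n = e\<^bsup>-ikn\<^sup>2t\<^esup> x\<^sub>n\<close> removes the diagonal part of the equation. The price is a
phase on the bond between \<open>n\<close> and \<open>n + 1\<close>, whose frequency is \<open>k ((n+1)\<^sup>2 - n\<^sup>2)\<close>.\<close>

definition link :: "real \<Rightarrow> nat \<Rightarrow> real \<Rightarrow> complex" where
  "link k n t = cis (- (k * (2 * real n + 1) * t))"

definition coupling :: "real \<Rightarrow> (nat \<Rightarrow> complex) \<Rightarrow> real \<Rightarrow> nat \<Rightarrow> complex" where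
  "coupling k a t n =
     (case n of 0 \<Rightarrow> 0 | Suc m \<Rightarrow> link k m t * a m) + cnj (link k n t) * a (Suc n)"

text \<open>The forcing \<open>g\<close> is zero for a solution. It is present because the difference of two
solutions with different parameters satisfies the same equation with a small forcing.\<close>

definition flow :: "(real \<Rightarrow> real) \<Rightarrow> real \<Rightarrow> (real \<Rightarrow> nat \<Rightarrow> complex) \<Rightarrow> (real \<Rightarrow> nat \<Rightarrow> complex) \<Rightarrow> bool" where
  "flow v k d g \<longleftrightarrow>
     (\<forall>n. primitive (\<lambda>t. d t n) (\<lambda>t. \<i> * complex_of_real (v t) * coupling k (d t) t n + g t n))"

text \<open>Up to the factor \<open>2 v(t)\<close>, this is the flux of \<open>|a\<^sub>n|\<^sup>2\<close> across the bond from \<open>n + 1\<close> to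
\<open>n\<close>.\<close>

definition current :: "real \<Rightarrow> (nat \<Rightarrow> complex) \<Rightarrow> real \<Rightarrow> nat \<Rightarrow> real" where
  "current k a t n = Im (link k n t * cnj (a (Suc n)) * a n)"

lemma norm_link [simp]: "cmod (link k n t) = 1"
  by (simp add: link_def)

lemma continuous_link: "continuous_on S (link k n)"
  unfolding link_def by (intro continuous_intros)

lemma abs_current_le: "\<bar>current k a t n\<bar> \<le> cmod (a (Suc n)) * cmod (a n)"
  unfolding current_def by (rule order.trans[OF abs_Im_le_cmod]) (simp add: norm_mult)

lemma flow_continuous: "flow v k d g \<Longrightarrow> continuous_on UNIV (\<lambda>t. d t n)"
  unfolding flow_def by (blast intro: primitive_continuous)

text \<open>The coupling is symmetric, so the fluxes through interior bonds cancel in pairs and only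
the one through the last bond survives.\<close>

lemma flow_mass_derivative:
  assumes "flow v k d g"
  shows "primitive (\<lambda>t. \<Sum>n\<le>M. (cmod (d t n))\<^sup>2)
           (\<lambda>t. 2 * v t * current k (d t) t M + (\<Sum>n\<le>M. 2 * Re (cnj (d t n) * g t n)))"
proof -
  define f where "f n t = \<i> * complex_of_real (v t) * coupling k (d t) t n + g t n" for n t
  have "primitive (\<lambda>t. d t n) (f n)" for n
    using assms unfolding flow_def f_def by blast
  then have "primitive (\<lambda>t. Re (d t n * cnj (d t n))) (\<lambda>t. Re (f n t * cnj (d t n) + d t n * cnj (f n t)))" for n
    by (intro primitive_linear[OF bounded_linear_Re] primitive_mult primitive_linear[OF bounded_linear_cnj]) auto
  moreover have "Re (z * cnj z) = (cmod z)\<^sup>2" for z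
    unfolding cmod_power2 by (simp add: power2_eq_square)
  moreover have "Re (w * cnj z + z * cnj w) = 2 * Re (cnj z * w)" for z w by simp
  ultimately have "primitive (\<lambda>t. (cmod (d t n))\<^sup>2) (\<lambda>t. 2 * Re (cnj (d t n) * f n t))" for n
    by (simp only:)
  then have "primitive (\<lambda>t. \<Sum>n\<le>M. (cmod (d t n))\<^sup>2) (\<lambda>t. \<Sum>n\<le>M. 2 * Re (cnj (d t n) * f n t))"
    by (intro primitive_sum)
  moreover have "(\<Sum>n\<le>M. 2 * Re (cnj (d t n) * f n t)) =
      2 * v t * current k (d t) t M + (\<Sum>n\<le>M. 2 * Re (cnj (d t n) * g t n))" for t
  proof (induction M)
    case 0
    show ?case by (simp add: f_def coupling_def current_def algebra_simps)
  next
    case (Suc M)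
    have "2 * Re (cnj (d t (Suc M)) * f (Suc M) t) =
      2 * v t * current k (d t) t (Suc M) - 2 * v t * current k (d t) t M
        + 2 * Re (cnj (d t (Suc M)) * g t (Suc M))"
      by (simp add: f_def coupling_def current_def algebra_simps)
    with Suc show ?case by simp
  qed
  ultimately show ?thesis by simp
qed

lemma sum_power2_norm_term_le:
  fixes d :: "nat \<Rightarrow> complex"
  assumes "\<And>M. (\<Sum>n\<le>M. (cmod (d n))\<^sup>2) \<le> B"
  shows "(cmod (d n))\<^sup>2 \<le> B" 
  using assms[of n] member_le_sum[of n "{..n}" "\<lambda>n. (cmod (d n))\<^sup>2"] by simp

lemma sum_power2_norm_tendsto_0:
  fixes d :: "nat \<Rightarrow> complex"
  assumes "\<And>M. (\<Sum>n\<le>M. (cmod (d n))\<^sup>2) \<le> B"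
  shows "(\<lambda>n. cmod (d n)) \<longlonglongrightarrow> 0"
proof -
  have "summable (\<lambda>n. (cmod (d n))\<^sup>2)"
    using assms by (intro bounded_imp_summable) auto
  then have "(\<lambda>n. sqrt ((cmod (d n))\<^sup>2)) \<longlonglongrightarrow> sqrt 0"
    by (intro tendsto_real_sqrt summable_LIMSEQ_zero)
  then show ?thesis by simp
qed

text \<open>The flux through the bond \<open>M\<close> is at most \<open>|a\<^sub>M a\<^bsub>M+1\<^esub>|\<close>, which tends to \<open>0\<close> as \<open>M \<rightarrow> \<infinity>\<close> for
square summable \<open>a\<close>; by dominated convergence no mass is exchanged with infinity.\<close>

lemma flow_mass_bound:
  assumes v: "locally_bounded v" and fl: "flow v k d g" and T: "0 \<le> T"
    and B: "\<And>t M. 0 \<le> t \<Longrightarrow> t \<le> T \<Longrightarrow> (\<Sum>n\<le>M. (cmod (d t n))\<^sup>2) \<le> B"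
    and \<Gamma>: "\<And>t M. 0 \<le> t \<Longrightarrow> t \<le> T \<Longrightarrow> (\<Sum>n\<le>M. 2 * Re (cnj (d t n) * g t n)) \<le> \<Gamma>"
    and D: "\<And>M. (\<Sum>n\<le>M. (cmod (d 0 n))\<^sup>2) \<le> D"
  shows "(\<Sum>n\<le>M. (cmod (d T n))\<^sup>2) \<le> D + \<Gamma> * T"
proof -
  let ?J = "\<lambda>m t. 2 * v t * current k (d t) t m"
  let ?R = "\<lambda>m t. \<Sum>n\<le>m. 2 * Re (cnj (d t n) * g t n)"
  have cont: "continuous_on UNIV (\<lambda>t. current k (d t) t m)" for m
    unfolding current_def by (intro continuous_intros continuous_link flow_continuous[OF fl])
  have J: "locally_bounded (?J m)" for m
    by (intro locally_bounded_mult v locally_bounded_const locally_bounded_continuous cont)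
  have R: "locally_bounded (?R m)" for m
  proof -
    have "locally_bounded (\<lambda>t. (?J m t + ?R m t) + - ?J m t)"
      by (intro locally_bounded_add[OF primitive_locally_bounded[OF flow_mass_derivative[OF fl]]] locally_bounded_minus J)
    then show ?thesis by simp
  qed
  obtain C where C: "C \<ge> 0" "\<And>t. 0 \<le> t \<Longrightarrow> t \<le> T \<Longrightarrow> norm (v t) \<le> C"
    using locally_bounded_bound[OF v] by metis
  have B0: "B \<ge> 0" using B[of 0 0] T by (smt (verit) sum_nonneg zero_le_power2)
  have Jb: "norm (?J m t) \<le> 2 * C * B" if "t \<in> {0..T}" for m t
  proof -
    have "cmod (d t n) \<le> sqrt B" for n
      using sum_power2_norm_term_le[OF B, of t n] that by (intro real_le_rsqrt) auto
    then have "\<bar>current k (d t) t m\<bar> \<le> sqrt B * sqrt B"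
      using B0 by (intro order.trans[OF abs_current_le] mult_mono) auto
    then have "\<bar>2 * v t\<bar> * \<bar>current k (d t) t m\<bar> \<le> (2 * C) * B"
      using C(2)[of t] that B0 C(1) by (intro mult_mono) auto
    then show ?thesis by (simp add: abs_mult)
  qed
  have lim: "(\<lambda>m. ?J m t) \<longlonglongrightarrow> 0" if "t \<in> {0..T}" for t
  proof -
    have "(\<lambda>n. cmod (d t n)) \<longlonglongrightarrow> 0"
      using that by (intro sum_power2_norm_tendsto_0[of _ B] B) auto
    then have "(\<lambda>n. cmod (d t (Suc n)) * cmod (d t n)) \<longlonglongrightarrow> 0"
      by (intro tendsto_mult_zero LIMSEQ_Suc)
    then have "(\<lambda>n. current k (d t) t n) \<longlonglongrightarrow> 0"
      by (rule Lim_null_comparison[rotated]) (simp add: abs_current_le)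
    then show ?thesis by (intro tendsto_mult_right_zero)
  qed
  have "(\<lambda>m. integral {0..T} (?J m)) \<longlonglongrightarrow> integral {0..T} (\<lambda>t. 0)"
    by (rule dominated_convergence(2)[where h = "\<lambda>_. 2 * C * B"])
       (auto intro!: locally_bounded_integrable_on J integrable_const_ivl lim Jb simp del: real_norm_def)
  then have "(\<lambda>m. D + integral {0..T} (?J m) + \<Gamma> * T) \<longlonglongrightarrow> D + 0 + \<Gamma> * T"
    by (intro tendsto_intros) simp
  moreover have "(\<Sum>n\<le>M. (cmod (d T n))\<^sup>2) \<le> D + integral {0..T} (?J m) + \<Gamma> * T" if "M \<le> m" for m
  proof -
    have "(\<Sum>n\<le>M. (cmod (d T n))\<^sup>2) \<le> (\<Sum>n\<le>m. (cmod (d T n))\<^sup>2)"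
      using that by (intro sum_mono2) auto
    also have "\<dots> = (\<Sum>n\<le>m. (cmod (d 0 n))\<^sup>2) + integral {0..T} (\<lambda>t. ?J m t + ?R m t)"
      using primitive_diff[OF flow_mass_derivative[OF fl, of m], of 0 T] T by simp
    also have "integral {0..T} (\<lambda>t. ?J m t + ?R m t) = integral {0..T} (?J m) + integral {0..T} (?R m)"
      by (intro Henstock_Kurzweil_Integration.integral_add locally_bounded_integrable_on J R) auto
    also have "integral {0..T} (?R m) \<le> integral {0..T} (\<lambda>_. \<Gamma>)"
      by (intro integral_le locally_bounded_integrable_on R locally_bounded_const) (use \<Gamma> in auto)
    finally show ?thesis using D[of m] T by (simp add: mult.commute)
  qed
  ultimately show ?thesis
    by (intro LIMSEQ_le_const[of _ "D + \<Gamma> * T"]) auto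
qed

lemma ell2_partial_sum_le:
  assumes "c \<in> ell2" shows "(\<Sum>n\<le>M. (cmod (c n))\<^sup>2) \<le> (ell2_norm c)\<^sup>2"
proof -
  have s: "summable (\<lambda>n. (cmod (c n))\<^sup>2)" using assms by (simp add: ell2_def)
  then have "(\<Sum>n\<le>M. (cmod (c n))\<^sup>2) \<le> (\<Sum>n. (cmod (c n))\<^sup>2)" by (intro sum_le_suminf) auto
  also have "\<dots> = (ell2_norm c)\<^sup>2" using s by (simp add: ell2_norm_def suminf_nonneg)
  finally show ?thesis .
qed

lemma power2_norm_add_le: "(cmod (a + b))\<^sup>2 \<le> 2 * (cmod a)\<^sup>2 + 2 * (cmod b)\<^sup>2"
proof -
  have "(cmod (a + b))\<^sup>2 \<le> (cmod a + cmod b)\<^sup>2" by (intro power_mono norm_triangle_ineq) auto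
  also have "\<dots> \<le> 2 * (cmod a)\<^sup>2 + 2 * (cmod b)\<^sup>2"
    using sum_squares_bound[of "cmod a" "cmod b"] by (simp add: power2_sum)
  finally show ?thesis .
qed

lemma ell2_diff:
  assumes "a \<in> ell2" "b \<in> ell2" shows "(\<lambda>n. a n - b n) \<in> ell2"
proof -
  have "summable (\<lambda>n. 2 * (cmod (a n))\<^sup>2 + 2 * (cmod (b n))\<^sup>2)"
    using assms by (intro summable_add summable_mult) (auto simp: ell2_def)
  then have "summable (\<lambda>n. (cmod (a n - b n))\<^sup>2)"
    by (rule summable_comparison_test'[where N = 0]) (use power2_norm_add_le[of "a _" "- b _"] in auto)
  then show ?thesis by (simp add: ell2_def)
qed

lemma ell2_continuous_coordinate:
  assumes "ell2_continuous_on {0..} y" shows "continuous_on {0..} (\<lambda>t. y t n)"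
  unfolding continuous_on_def
proof
  fix t :: real assume t: "t \<in> {0..}"
  have "((\<lambda>s. ell2_norm (\<lambda>n. y s n - y t n)) \<longlongrightarrow> 0) (at t within {0..})"
    using assms t unfolding ell2_continuous_on_def by blast
  moreover have "eventually (\<lambda>s. norm (y s n - y t n) \<le> ell2_norm (\<lambda>n. y s n - y t n)) (at t within {0..})"
  proof -
    have "norm (y s n - y t n) \<le> ell2_norm (\<lambda>n. y s n - y t n)" if "s \<in> {0..}" for s
    proof -
      have "(\<lambda>n. y s n - y t n) \<in> ell2"
        using assms t that unfolding ell2_continuous_on_def by (intro ell2_diff) auto
      then have "(norm (y s n - y t n))\<^sup>2 \<le> (ell2_norm (\<lambda>n. y s n - y t n))\<^sup>2"
        by (intro sum_power2_norm_term_le ell2_partial_sum_le)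
      moreover have "0 \<le> ell2_norm (\<lambda>n. y s n - y t n)"
        using \<open>(\<lambda>n. y s n - y t n) \<in> ell2\<close> by (simp add: ell2_norm_def ell2_def suminf_nonneg)
      ultimately show ?thesis by (rule power2_le_imp_le)
    qed
    then show ?thesis by (auto simp: eventually_at_filter)
  qed
  ultimately have "((\<lambda>s. y s n - y t n) \<longlongrightarrow> 0) (at t within {0..})"
    by (rule Lim_null_comparison[rotated])
  then show "((\<lambda>s. y s n) \<longlongrightarrow> y t n) (at t within {0..})" by (simp add: Lim_null[symmetric])
qed

text \<open>The dominating constant in \<open>flow_mass_bound\<close> comes from compactness of the time interval,
here in the form of a bisection argument.\<close>

lemma ell2_continuous_bounded:
  assumes "ell2_continuous_on {0..} y"
  shows "\<exists>B. \<forall>t\<in>{0..T}. \<forall>M. (\<Sum>n\<le>M. (cmod (y t n))\<^sup>2) \<le> B"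
proof (cases "0 \<le> T")
  case True
  let ?P = "\<lambda>a b. \<exists>B. \<forall>s. a \<le> s \<and> s \<le> b \<and> 0 \<le> s \<longrightarrow> (\<forall>M. (\<Sum>n\<le>M. (cmod (y s n))\<^sup>2) \<le> B)"
  have "?P 0 T" using True
  proof (rule Bolzano[where P = ?P])
    fix a b c assume ab: "?P a b" and bc: "?P b c"
    obtain B where B: "\<And>s. a \<le> s \<and> s \<le> b \<and> 0 \<le> s \<longrightarrow> (\<forall>M. (\<Sum>n\<le>M. (cmod (y s n))\<^sup>2) \<le> B)" using ab by blast
    obtain C where C: "\<And>s. b \<le> s \<and> s \<le> c \<and> 0 \<le> s \<longrightarrow> (\<forall>M. (\<Sum>n\<le>M. (cmod (y s n))\<^sup>2) \<le> C)" using bc by blast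
    have "\<forall>s. a \<le> s \<and> s \<le> c \<and> 0 \<le> s \<longrightarrow> (\<forall>M. (\<Sum>n\<le>M. (cmod (y s n))\<^sup>2) \<le> max B C)"
      using B C by (smt (verit))
    then show "?P a c" by blast
  next
    fix x assume x: "0 \<le> x" "x \<le> T"
    have "((\<lambda>s. ell2_norm (\<lambda>n. y s n - y x n)) \<longlongrightarrow> 0) (at x within {0..})"
      using assms x unfolding ell2_continuous_on_def by auto
    from tendstoD[OF this zero_less_one] obtain d where d: "d > 0"
      "\<forall>s\<in>{0..}. s \<noteq> x \<and> dist s x < d \<longrightarrow> dist (ell2_norm (\<lambda>n. y s n - y x n)) 0 < 1"
      unfolding eventually_at by blast
    have "(\<Sum>n\<le>M. (cmod (y s n))\<^sup>2) \<le> 2 + 2 * (ell2_norm (y x))\<^sup>2"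
      if ab: "a \<le> x \<and> x \<le> b \<and> b - a < d" "a \<le> s \<and> s \<le> b \<and> 0 \<le> s" for a b s M
    proof -
      have yx: "y x \<in> ell2" and ys: "y s \<in> ell2" using assms x ab unfolding ell2_continuous_on_def by auto
      have 1: "(\<Sum>n\<le>M. (cmod (y s n - y x n))\<^sup>2) \<le> 1"
      proof (cases "s = x")
        case False
        then have "\<bar>ell2_norm (\<lambda>n. y s n - y x n)\<bar> < 1" using d(2) ab by (auto simp: dist_real_def)
        then have "(ell2_norm (\<lambda>n. y s n - y x n))\<^sup>2 \<le> 1" by (simp add: abs_square_le_1)
        then show ?thesis using ell2_partial_sum_le[OF ell2_diff[OF ys yx], of M] by linarith
      qed simp
      have "(\<Sum>n\<le>M. (cmod (y s n))\<^sup>2) \<le> (\<Sum>n\<le>M. 2 * (cmod (y s n - y x n))\<^sup>2 + 2 * (cmod (y x n))\<^sup>2)"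
      proof (rule sum_mono)
        show "(cmod (y s n))\<^sup>2 \<le> 2 * (cmod (y s n - y x n))\<^sup>2 + 2 * (cmod (y x n))\<^sup>2" for n
          using power2_norm_add_le[of "y s n - y x n" "y x n"] by simp
      qed
      also have "\<dots> = 2 * (\<Sum>n\<le>M. (cmod (y s n - y x n))\<^sup>2) + 2 * (\<Sum>n\<le>M. (cmod (y x n))\<^sup>2)"
        by (simp add: sum.distrib sum_distrib_left)
      finally show ?thesis using 1 ell2_partial_sum_le[OF yx, of M] by linarith
    qed
    then show "\<exists>d>0. \<forall>a b. a \<le> x \<and> x \<le> b \<and> b - a < d \<longrightarrow> ?P a b"
      using d(1) by blast
  qed
  then obtain B where "\<And>s. 0 \<le> s \<and> s \<le> T \<and> 0 \<le> s \<longrightarrow> (\<forall>M. (\<Sum>n\<le>M. (cmod (y s n))\<^sup>2) \<le> B)" by blast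
  then show ?thesis by (intro exI[of _ B]) auto
qed auto

text \<open>Times \<open>t < 0\<close> are mapped to \<open>0\<close>, in accordance with the convention for primitives.\<close>

definition interaction :: "real \<Rightarrow> (real \<Rightarrow> nat \<Rightarrow> complex) \<Rightarrow> real \<Rightarrow> nat \<Rightarrow> complex" where
  "interaction k y t n = cis (- (k * (real n)\<^sup>2 * max 0 t)) * y (max 0 t) n"

lemma norm_interaction: "0 \<le> t \<Longrightarrow> cmod (interaction k y t n) = cmod (y t n)"
  by (simp add: interaction_def norm_mult)

text \<open>The Duhamel identity of coordinate \<open>n\<close>, multiplied by \<open>e\<^bsup>-ikn\<^sup>2t\<^esup>\<close>, says that \<open>a\<^sub>n\<close> is a
primitive of the coupling term. The potential may be changed on a null set of times.\<close>

lemma interaction_flow: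
  assumes v: "locally_bounded v'" and N: "negligible N" "\<And>t. 0 \<le> t \<Longrightarrow> t \<notin> N \<Longrightarrow> v' t = v t"
    and y: "weak_solution v k y"
  shows "flow v' k (interaction k y) (\<lambda>_ _. 0)"
    and "interaction k y 0 j = (if j = 0 then 1 else 0)"
proof -
  let ?a = "interaction k y"
  have "continuous_on {0..} (\<lambda>t. y t n)" for n
    using y unfolding weak_solution_def by (blast intro: ell2_continuous_coordinate)
  then have "continuous_on UNIV (\<lambda>t. y (max 0 t) n)" for n
    by (rule continuous_on_compose2) (auto intro!: continuous_intros)
  then have cont: "continuous_on UNIV (\<lambda>t. ?a t n)" for n
    unfolding interaction_def by (intro continuous_intros)
  define f where "f n t = \<i> * complex_of_real (v' t) * coupling k (?a t) t n" for n t
  have cc: "continuous_on UNIV (\<lambda>t. coupling k (?a t) t n)" for n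
    unfolding coupling_def by (cases n) (auto intro!: continuous_intros cont continuous_link)
  have f: "locally_bounded (f n)" for n
  proof -
    have "locally_bounded (\<lambda>t. \<i> * complex_of_real (v' t) * coupling k (?a t) t n)"
      by (intro locally_bounded_mult locally_bounded_const locally_bounded_of_real v) (rule locally_bounded_continuous[OF cc])
    moreover have "f n = (\<lambda>t. \<i> * complex_of_real (v' t) * coupling k (?a t) t n)"
      by (rule ext) (simp add: f_def)
    ultimately show ?thesis by simp
  qed
  have main: "?a t n = (if n = 0 then 1 else 0) + integral {0..t} (f n)" if t: "0 \<le> t" for t n
  proof -
    let ?c = "- \<i> * cis (k * (real n)\<^sup>2 * t)"
    let ?g = "\<lambda>\<tau>. exp (\<i> * complex_of_real (k * (t - \<tau>) * (real n)\<^sup>2)) * Q_apply v \<tau> (y \<tau>) n"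
    have eq: "?g \<tau> = ?c * f n \<tau>" if "\<tau> \<in> {0..t} - N" for \<tau>
    proof -
      have "f n \<tau> = \<i> * cis (- (k * (real n)\<^sup>2 * \<tau>)) * Q_apply v \<tau> (y \<tau>) n"
      proof (cases n)
        case 0
        then show ?thesis using that N(2)[of \<tau>]
          by (simp add: f_def coupling_def Q_apply_def interaction_def link_def cis_mult cis_cnj mult.assoc[symmetric])
      next
        case (Suc m)
        have cis3: "cis p * (cis q * z) = cis r * z" if "p + q = r" for p q r z
          by (simp add: that[symmetric] cis_mult[symmetric] mult.assoc)
        have mx: "max 0 \<tau> = \<tau>" using that by auto
        have "link k m \<tau> * ?a \<tau> m = cis (- (k * (real n)\<^sup>2 * \<tau>)) * y \<tau> m"
          unfolding link_def interaction_def mx by (rule cis3) (simp add: Suc power2_eq_square algebra_simps)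
        moreover have "cnj (link k n \<tau>) * ?a \<tau> (Suc n) = cis (- (k * (real n)\<^sup>2 * \<tau>)) * y \<tau> (Suc n)"
          unfolding link_def interaction_def mx cis_cnj
          by (rule cis3) (simp add: power2_eq_square algebra_simps)
        ultimately have "f n \<tau> = \<i> * complex_of_real (v \<tau>) * (cis (- (k * (real n)\<^sup>2 * \<tau>)) * y \<tau> m + cis (- (k * (real n)\<^sup>2 * \<tau>)) * y \<tau> (Suc n))"
          using that N(2)[of \<tau>] by (simp only: f_def coupling_def) (simp add: Suc)
        then show ?thesis using Suc by (simp add: Q_apply_def algebra_simps)
      qed
      moreover have "exp (\<i> * complex_of_real (k * (t - \<tau>) * (real n)\<^sup>2)) = cis (k * (real n)\<^sup>2 * t) * cis (- (k * (real n)\<^sup>2 * \<tau>))"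
        unfolding cis_conv_exp[symmetric] cis_mult by (simp add: algebra_simps)
      ultimately show ?thesis by (simp only:) (simp add: mult.assoc mult.left_commute)
    qed
    have "(\<lambda>\<tau>. ?c * f n \<tau>) absolutely_integrable_on {0..t}"
      by (intro locally_bounded_integrable locally_bounded_mult locally_bounded_const f) auto
    then have "?g absolutely_integrable_on {0..t}"
      by (rule absolutely_integrable_spike[OF _ N(1)]) (rule eq)
    then have "(LINT \<tau>:{0..t}|lebesgue. ?g \<tau>) = integral {0..t} ?g"
      by (rule set_lebesgue_integral_eq_integral)
    also have "\<dots> = integral {0..t} (\<lambda>\<tau>. ?c * f n \<tau>)"
      by (rule integral_spike[OF N(1)]) (rule eq[symmetric])
    also have "\<dots> = ?c * integral {0..t} (f n)" by simp
    finally have L: "(LINT \<tau>:{0..t}|lebesgue. ?g \<tau>) = ?c * integral {0..t} (f n)" .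
    have "y t n = exp (\<i> * complex_of_real (k * t * (real n)\<^sup>2)) * (if n = 0 then 1 else 0) + \<i> * (LINT \<tau>:{0..t}|lebesgue. ?g \<tau>)"
      using y t unfolding weak_solution_def by blast
    then have "y t n = cis (k * t * (real n)\<^sup>2) * (if n = 0 then 1 else 0) + cis (k * (real n)\<^sup>2 * t) * integral {0..t} (f n)"
      unfolding L by (simp add: cis_conv_exp[symmetric] mult.assoc[symmetric])
    then show ?thesis using t
      by (simp add: interaction_def distrib_left mult.assoc[symmetric] cis_mult)
  qed
  have init: "?a 0 n = (if n = 0 then 1 else 0)" for n using main[of 0 n] by simp
  then show "?a 0 j = (if j = 0 then 1 else 0)" .
  have "?a t n = ?a 0 n + integral {0..t} (f n)" for t n
  proof (cases "0 \<le> t")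
    case True then show ?thesis using main[of t n] init[of n] by simp
  qed (simp add: interaction_def)
  then have "primitive (\<lambda>t. ?a t n) (f n)" for n
    using f unfolding primitive_def by blast
  then show "flow v' k ?a (\<lambda>_ _. 0)" unfolding flow_def f_def by simp
qed

lemma interaction_mass_le_1:
  assumes v: "locally_bounded v'" and N: "negligible N" "\<And>t. 0 \<le> t \<Longrightarrow> t \<notin> N \<Longrightarrow> v' t = v t"
    and y: "weak_solution v k y" and t: "0 \<le> t"
  shows "(\<Sum>n\<le>M. (cmod (interaction k y t n))\<^sup>2) \<le> 1"
proof -
  obtain B where "\<forall>s\<in>{0..t}. \<forall>M. (\<Sum>n\<le>M. (cmod (y s n))\<^sup>2) \<le> B"
    using ell2_continuous_bounded y unfolding weak_solution_def by metis
  then have B: "(\<Sum>n\<le>M. (cmod (interaction k y s n))\<^sup>2) \<le> B" if "0 \<le> s" "s \<le> t" for s M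
    using that by (simp add: norm_interaction)
  have "(\<Sum>n\<le>M. (cmod (interaction k y t n))\<^sup>2) \<le> 1 + 0 * t"
    by (rule flow_mass_bound[OF v interaction_flow(1)[OF v N y] t B]) (auto simp: interaction_flow(2)[OF v N y] if_distrib if_distribR cong: if_cong)
  then show ?thesis by simp
qed

section \<open>The truncated energy\<close>

text \<open>For \<open>t \<le> T\<close> this is the integral of \<open>v(s) e\<^bsup>-i\<xi>s\<^esup>\<close> over \<open>[t,T]\<close>. Written as a difference of
two integrals from \<open>0\<close> it is a primitive on the whole line. The horizon \<open>T\<close> keeps the integral
absolutely convergent, as \<open>v\<close> need not be integrable on the half-line.\<close>

definition tail :: "(real \<Rightarrow> real) \<Rightarrow> real \<Rightarrow> real \<Rightarrow> real \<Rightarrow> complex" where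
  "tail v T \<xi> t = integral {0..T} (\<lambda>s. complex_of_real (v s) * cis (- (\<xi> * s)))
                - integral {0..t} (\<lambda>s. complex_of_real (v s) * cis (- (\<xi> * s)))"

text \<open>The frequencies are those of \<^const>\<open>link\<close>. The square sum over \<open>n\<close> bounds each tail and, unlike
the maximum over \<open>n\<close>, it can be integrated in \<open>k\<close> term by term.\<close>

definition tail_size :: "(real \<Rightarrow> real) \<Rightarrow> nat \<Rightarrow> real \<Rightarrow> real \<Rightarrow> real \<Rightarrow> real" where
  "tail_size v N T k t = sqrt (\<Sum>n<N. (cmod (tail v T (k * (2 * real n + 1)) t))\<^sup>2)"

lemma locally_bounded_wave:
  assumes "locally_bounded v" shows "locally_bounded (\<lambda>s. complex_of_real (v s) * cis (- (\<xi> * s)))"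
  by (intro locally_bounded_mult locally_bounded_of_real assms locally_bounded_continuous continuous_intros)

lemma primitive_tail:
  assumes "locally_bounded v" shows "primitive (tail v T \<xi>) (\<lambda>t. - (complex_of_real (v t) * cis (- (\<xi> * t))))"
proof -
  let ?c = "integral {0..T} (\<lambda>s. complex_of_real (v s) * cis (- (\<xi> * s)))"
  from primitive_add[OF primitive_const[of ?c] primitive_linear[OF bounded_linear_minus[OF bounded_linear_ident]
      primitive_integral[OF locally_bounded_wave[OF assms, of \<xi>], of 0]]]
  show ?thesis unfolding tail_def by simp
qed

lemma tail_at_end [simp]: "tail v T \<xi> T = 0"
  by (simp add: tail_def)

lemma continuous_tail: "locally_bounded v \<Longrightarrow> continuous_on UNIV (tail v T \<xi>)"
  by (rule primitive_continuous[OF primitive_tail])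

lemma locally_bounded_tail_size:
  assumes "locally_bounded v" shows "locally_bounded (tail_size v N T k)"
  unfolding tail_size_def[abs_def]
  by (intro locally_bounded_continuous continuous_on_real_sqrt continuous_on_sum continuous_on_power
      continuous_on_norm continuous_tail[OF assms])

lemma tail_size_nonneg [simp]: "0 \<le> tail_size v N T k t"
  by (simp add: tail_size_def sum_nonneg)

lemma tail_le_tail_size:
  assumes "n < N" shows "cmod (tail v T (k * (2 * real n + 1)) t) \<le> tail_size v N T k t"
  unfolding tail_size_def
  using assms by (intro real_le_rsqrt member_le_sum) auto

text \<open>The tail \<open>W\<close> vanishes at \<open>T\<close> and \<open>|W|\<^sup>2\<close> has derivative at most \<open>2 |v| |W|\<close> in absolute
value. Thus a bound for the weighted time integral of the tails also controls their supremum in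
time, and no maximal theorem for Fourier integrals is needed.\<close>

lemma tail_power2_le:
  assumes v: "locally_bounded v" and t: "0 \<le> s" "s \<le> t" "t \<le> T" and n: "n < N"
  shows "(cmod (tail v T (k * (2 * real n + 1)) t))\<^sup>2 \<le> 2 * integral {s..T} (\<lambda>r. \<bar>v r\<bar> * tail_size v N T k r)"
proof -
  define W where "W = tail v T (k * (2 * real n + 1))"
  define w where "w t = - (complex_of_real (v t) * cis (- (k * (2 * real n + 1) * t)))" for t
  have Ww: "primitive W w" unfolding W_def w_def by (rule primitive_tail[OF v])
  have "primitive (\<lambda>t. Re (W t * cnj (W t))) (\<lambda>t. Re (w t * cnj (W t) + W t * cnj (w t)))"
    by (intro primitive_linear[OF bounded_linear_Re] primitive_mult primitive_linear[OF bounded_linear_cnj] Ww)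
  moreover have "Re (z * cnj z) = (cmod z)\<^sup>2" for z
    unfolding cmod_power2 by (simp add: power2_eq_square)
  moreover have "Re (p * cnj z + z * cnj p) = 2 * Re (p * cnj z)" for z p by simp
  ultimately have P: "primitive (\<lambda>t. (cmod (W t))\<^sup>2) (\<lambda>t. 2 * Re (w t * cnj (W t)))"
    by (simp only:)
  have lb: "locally_bounded (\<lambda>r. 2 * (\<bar>v r\<bar> * tail_size v N T k r))"
    using locally_bounded_norm[OF v] by (intro locally_bounded_mult locally_bounded_const locally_bounded_tail_size v) simp
  have "(cmod (W t))\<^sup>2 = - integral {t..T} (\<lambda>t. 2 * Re (w t * cnj (W t)))"
    using primitive_diff[OF P, of t T] t by (simp add: W_def)
  also have "\<dots> \<le> norm (integral {t..T} (\<lambda>t. 2 * Re (w t * cnj (W t))))" by simp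
  also have "\<dots> \<le> integral {t..T} (\<lambda>r. 2 * (\<bar>v r\<bar> * tail_size v N T k r))"
  proof (rule integral_norm_bound_integral)
    show "(\<lambda>t. 2 * Re (w t * cnj (W t))) integrable_on {t..T}"
      using t by (intro locally_bounded_integrable_on[OF primitive_locally_bounded[OF P]]) auto
    show "(\<lambda>r. 2 * (\<bar>v r\<bar> * tail_size v N T k r)) integrable_on {t..T}"
      using t by (intro locally_bounded_integrable_on lb) auto
    fix r
    have "\<bar>Re (w r * cnj (W r))\<bar> \<le> \<bar>v r\<bar> * tail_size v N T k r"
      using tail_le_tail_size[OF n, of v T k r]
      by (intro order.trans[OF abs_Re_le_cmod]) (auto simp: norm_mult w_def W_def intro!: mult_left_mono)
    then show "norm (2 * Re (w r * cnj (W r))) \<le> 2 * (\<bar>v r\<bar> * tail_size v N T k r)" by simp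
  qed
  also have "\<dots> \<le> integral {s..T} (\<lambda>r. 2 * (\<bar>v r\<bar> * tail_size v N T k r))"
    using t by (intro integral_subset_le locally_bounded_integrable_on lb) auto
  finally show ?thesis by (simp add: W_def)
qed

text \<open>What the energy estimates use about a solution.\<close>

locale unit_flow =
  fixes v :: "real \<Rightarrow> real" and k :: real and a :: "real \<Rightarrow> nat \<Rightarrow> complex"
  assumes v: "locally_bounded v"
    and flow: "flow v k a (\<lambda>_ _. 0)"
    and init: "a 0 n = (if n = 0 then 1 else 0)"
    and mass: "0 \<le> t \<Longrightarrow> (\<Sum>n\<le>M. (cmod (a t n))\<^sup>2) \<le> 1"
begin

text \<open>If the mass is exactly \<open>1\<close>, this is the sum of \<open>min(n,N)\<^sup>2 |a\<^sub>n|\<^sup>2\<close>, since \<open>m\<^sup>2\<close> is the sum of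
the first \<open>m\<close> odd numbers. In the present form only finitely many coordinates occur, the time
derivative is immediate from \<open>flow_mass_derivative\<close>, and mass at most \<open>1\<close> suffices for an
inequality.\<close>

definition energy :: "nat \<Rightarrow> real \<Rightarrow> real" where
  "energy N t = (\<Sum>M<N. (2 * real M + 1) * (1 - (\<Sum>n\<le>M. (cmod (a t n))\<^sup>2)))"

lemma locally_bounded_abs_v: "locally_bounded (\<lambda>t. \<bar>v t\<bar>)"
  using locally_bounded_norm[OF v] by simp

lemma primitive_energy:
  "primitive (energy N) (\<lambda>t. - (\<Sum>M<N. (2 * real M + 1) * (2 * v t * current k (a t) t M)))"
proof -
  have "primitive (\<lambda>t. (2 * real M + 1) * (1 - (\<Sum>n\<le>M. (cmod (a t n))\<^sup>2)))
      (\<lambda>t. - ((2 * real M + 1) * (2 * v t * current k (a t) t M)))" for M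
  proof -
    have "primitive (\<lambda>t. \<Sum>n\<le>M. (cmod (a t n))\<^sup>2) (\<lambda>t. 2 * v t * current k (a t) t M)"
      using flow_mass_derivative[OF flow, of M] by simp
    from primitive_add[OF primitive_const[of "2 * real M + 1"] 
      primitive_linear[OF bounded_linear_minus[OF bounded_linear_mult_right[of "2 * real M + 1"]] this]]
    show ?thesis by (simp add: algebra_simps)
  qed
  then have "primitive (\<lambda>t. \<Sum>M<N. (2 * real M + 1) * (1 - (\<Sum>n\<le>M. (cmod (a t n))\<^sup>2)))
      (\<lambda>t. \<Sum>M<N. - ((2 * real M + 1) * (2 * v t * current k (a t) t M)))"
    by (rule primitive_sum)
  then show ?thesis by (simp add: energy_def[abs_def] sum_negf)
qed

lemma energy_0 [simp]: "energy N 0 = 0"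
  by (simp add: energy_def init if_distrib if_distribR cong: if_cong)

lemma sum_odd_below: "(\<Sum>M<N. if M < n then 2 * real M + 1 else 0) = (real (min n N))\<^sup>2"
proof (induction N)
  case (Suc N)
  then show ?case by (cases "N < n") (simp_all add: min_absorb1 min_absorb2 power2_eq_square algebra_simps)
qed simp

text \<open>Each factor \<open>1 - (\<Sum>n\<le>M. |a\<^sub>n|\<^sup>2)\<close> is at least the mass carried by any finite set of
coordinates beyond \<open>M\<close>; summing by parts collects the odd weights into squares.\<close>

lemma weighted_mass_le_energy:
  assumes t: "0 \<le> t"
  shows "(\<Sum>n<L. (real (min n N))\<^sup>2 * (cmod (a t n))\<^sup>2) \<le> energy N t"
proof -
  let ?b = "\<lambda>n. (cmod (a t n))\<^sup>2"
  have tail: "(\<Sum>n<L. if M < n then ?b n else 0) \<le> 1 - (\<Sum>n\<le>M. ?b n)" for M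
  proof -
    have "(\<Sum>n<L. if M < n then ?b n else 0) + (\<Sum>n\<le>M. ?b n) = (\<Sum>n\<in>{n. n < L \<and> M < n}. ?b n) + (\<Sum>n\<le>M. ?b n)"
      by (simp add: sum.inter_filter[symmetric])
    also have "\<dots> = (\<Sum>n\<in>{n. n < L \<and> M < n} \<union> {..M}. ?b n)"
      by (subst sum.union_disjoint) auto
    also have "\<dots> \<le> (\<Sum>n\<le>L + M. ?b n)" by (intro sum_mono2) auto
    also have "\<dots> \<le> 1" by (rule mass[OF t])
    finally show ?thesis by simp
  qed
  have "(\<Sum>n<L. (real (min n N))\<^sup>2 * ?b n) = (\<Sum>n<L. \<Sum>M<N. (2 * real M + 1) * (if M < n then ?b n else 0))"
    by (simp only: sum_odd_below[symmetric] sum_distrib_right) (intro sum.cong refl, simp)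
  also have "\<dots> = (\<Sum>M<N. (2 * real M + 1) * (\<Sum>n<L. if M < n then ?b n else 0))"
    by (subst sum.swap) (simp add: sum_distrib_left)
  also have "\<dots> \<le> energy N t"
    unfolding energy_def by (intro sum_mono mult_left_mono tail) auto
  finally show ?thesis .
qed

lemma energy_nonneg: "0 \<le> t \<Longrightarrow> 0 \<le> energy N t"
  using weighted_mass_le_energy[where L = 0] by simp

lemma mass_lessThan: "0 \<le> t \<Longrightarrow> (\<Sum>n<L. (cmod (a t n))\<^sup>2) \<le> 1"
  by (rule order.trans[OF sum_mono2[where B = "{..L}"] mass]) auto

lemma sum_shift_le:
  fixes f :: "nat \<Rightarrow> real"
  assumes "\<And>n. 0 \<le> f n" shows "(\<Sum>n<N. f (n + i)) \<le> (\<Sum>n<N + i. f n)"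
proof -
  have "(\<Sum>n<N. f (n + i)) = (\<Sum>n=i..<N + i. f n)"
    using sum.shift_bounds_nat_ivl[of f 0 i N] by (simp add: atLeast0LessThan)
  also have "\<dots> \<le> (\<Sum>n<N + i. f n)" by (intro sum_mono2 assms) auto
  finally show ?thesis .
qed

text \<open>The derivative of the energy carries the weight \<open>2n + 1 \<le> 2 (1 + min(n,N))\<close> only to the
first power. By Cauchy--Schwarz one of the two factors absorbs the weight and produces the
square root of the energy, while the other one has mass at most \<open>1\<close>. It is this gain of a square
root that replaces Gronwall's inequality, and with it an exponential that could not be
integrated in \<open>k\<close>. The summand \<open>1\<close> is needed because \<open>|a\<^sub>0|\<close> is not controlled by the energy.\<close>

lemma pairing_le:
  fixes \<beta> :: "nat \<Rightarrow> real"
  assumes t: "0 \<le> t" and \<beta>: "(\<Sum>n<N. (\<beta> n)\<^sup>2) \<le> 1" "\<And>n. 0 \<le> \<beta> n"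
  shows "(\<Sum>n<N. (2 * real n + 1) * (cmod (a t (n + i)) * \<beta> n)) \<le> 3 * sqrt (1 + energy N t)"
proof -
  let ?u = "\<lambda>n. (1 + real (min n N)) * cmod (a t n)"
  have u: "(\<Sum>n<L. (?u n)\<^sup>2) \<le> 2 * (1 + energy N t)" for L
  proof -
    have "(?u n)\<^sup>2 \<le> 2 * (cmod (a t n))\<^sup>2 + 2 * ((real (min n N))\<^sup>2 * (cmod (a t n))\<^sup>2)" for n
    proof -
      have "(1 + real (min n N))\<^sup>2 \<le> 2 + 2 * (real (min n N))\<^sup>2"
        using sum_squares_bound[of 1 "real (min n N)"] by (simp add: power2_sum)
      from mult_right_mono[OF this, of "(cmod (a t n))\<^sup>2"] show ?thesis
        by (simp only: power_mult_distrib) (simp add: algebra_simps)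
    qed
    then have "(\<Sum>n<L. (?u n)\<^sup>2) \<le> (\<Sum>n<L. 2 * (cmod (a t n))\<^sup>2 + 2 * ((real (min n N))\<^sup>2 * (cmod (a t n))\<^sup>2))"
      by (rule sum_mono)
    also have "\<dots> = 2 * (\<Sum>n<L. (cmod (a t n))\<^sup>2) + 2 * (\<Sum>n<L. (real (min n N))\<^sup>2 * (cmod (a t n))\<^sup>2)"
      by (simp only: sum.distrib sum_distrib_left)
    also have "\<dots> \<le> 2 * 1 + 2 * energy N t"
      by (intro add_mono mult_left_mono mass_lessThan[OF t] weighted_mass_le_energy[OF t]) auto
    finally show ?thesis by simp
  qed
  have E: "0 \<le> 1 + energy N t" using energy_nonneg[OF t, of N] by simp
  have "(\<Sum>n<N. ?u (n + i) * \<beta> n)\<^sup>2 \<le> (\<Sum>n<N. (?u (n + i))\<^sup>2) * (\<Sum>n<N. (\<beta> n)\<^sup>2)"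
    by (rule Cauchy_Schwarz_ineq_sum)
  also have "\<dots> \<le> (2 * (1 + energy N t)) * 1"
    using u[of "N + i"] sum_shift_le[where f = "\<lambda>n. (?u n)\<^sup>2" and N = N and i = i] \<beta> E
    by (intro mult_mono) (auto intro: sum_nonneg)
  also have "\<dots> \<le> (3 / 2 * sqrt (1 + energy N t))\<^sup>2"
    using E by (simp add: power_mult_distrib power2_eq_square)
  finally have CS: "(\<Sum>n<N. ?u (n + i) * \<beta> n) \<le> 3 / 2 * sqrt (1 + energy N t)"
    by (rule power2_le_imp_le) (use E in simp)
  have "(\<Sum>n<N. (2 * real n + 1) * (cmod (a t (n + i)) * \<beta> n)) \<le> (\<Sum>n<N. 2 * (?u (n + i) * \<beta> n))"
  proof (rule sum_mono)
    fix n assume "n \<in> {..<N}"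
    then have "2 * real n + 1 \<le> 2 * (1 + real (min (n + i) N))" by (auto simp: min_def)
    then have "(2 * real n + 1) * (cmod (a t (n + i)) * \<beta> n) \<le> 2 * (1 + real (min (n + i) N)) * (cmod (a t (n + i)) * \<beta> n)"
      using \<beta>(2)[of n] by (intro mult_right_mono) auto
    then show "(2 * real n + 1) * (cmod (a t (n + i)) * \<beta> n) \<le> 2 * (?u (n + i) * \<beta> n)"
      by (simp only: mult.assoc)
  qed
  also have "\<dots> = 2 * (\<Sum>n<N. ?u (n + i) * \<beta> n)" by (rule sum_distrib_left[symmetric])
  finally show ?thesis using CS by linarith
qed

lemma mass_shift: "0 \<le> t \<Longrightarrow> (\<Sum>n<N. (cmod (a t (n + i)))\<^sup>2) \<le> 1"
  using sum_shift_le[where f = "\<lambda>n. (cmod (a t n))\<^sup>2" and N = N and i = i] mass_lessThan[of t "N + i"] by simp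

definition predecessor :: "real \<Rightarrow> nat \<Rightarrow> complex" where
  "predecessor t n = (case n of 0 \<Rightarrow> 0 | Suc m \<Rightarrow> a t m)"

lemma mass_predecessor: "0 \<le> t \<Longrightarrow> (\<Sum>n<N. (cmod (predecessor t n))\<^sup>2) \<le> 1"
proof -
  assume t: "0 \<le> t"
  have "(\<Sum>n<N. (cmod (predecessor t n))\<^sup>2) \<le> (\<Sum>n<Suc N. (cmod (predecessor t n))\<^sup>2)" by simp
  also have "\<dots> = (\<Sum>n<N. (cmod (a t n))\<^sup>2)" by (simp add: sum.lessThan_Suc_shift predecessor_def del: sum.lessThan_Suc)
  finally show ?thesis using mass_lessThan[OF t, of N] by simp
qed

text \<open>The current without its oscillating factor. Its derivative contains a factor \<open>v\<close>, so an
integration by parts against the oscillation gains one power of \<open>v\<close>.\<close>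

definition pair :: "nat \<Rightarrow> real \<Rightarrow> complex" where
  "pair n t = cnj (a t (Suc n)) * a t n"

definition pair_deriv :: "nat \<Rightarrow> real \<Rightarrow> complex" where
  "pair_deriv n t = cnj (\<i> * complex_of_real (v t) * coupling k (a t) t (Suc n)) * a t n
     + cnj (a t (Suc n)) * (\<i> * complex_of_real (v t) * coupling k (a t) t n)"

lemma primitive_pair: "primitive (pair n) (pair_deriv n)"
proof -
  have f: "primitive (\<lambda>t. a t n) (\<lambda>t. \<i> * complex_of_real (v t) * coupling k (a t) t n)" for n
    using flow unfolding flow_def by simp
  show ?thesis unfolding pair_def[abs_def] pair_deriv_def[abs_def]
    by (intro primitive_mult primitive_linear[OF bounded_linear_cnj] f)
qed

lemma sum_pair_le:
  assumes "0 \<le> t"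
  shows "(\<Sum>n<N. (2 * real n + 1) * cmod (pair n t)) \<le> 3 * sqrt (1 + energy N t)"
  using pairing_le[OF assms mass_shift[OF assms, where N = N and i = 1], where i = 0] by (simp add: pair_def norm_mult mult.commute)

lemma norm_coupling_le: "cmod (coupling k (a t) t n) \<le> cmod (predecessor t n) + cmod (a t (n + 1))"
  unfolding coupling_def predecessor_def
  by (intro order.trans[OF norm_triangle_ineq] add_mono) (auto simp: norm_mult split: nat.split)

lemma sum_pair_deriv_le:
  assumes t: "0 \<le> t"
  shows "(\<Sum>n<N. (2 * real n + 1) * cmod (pair_deriv n t)) \<le> \<bar>v t\<bar> * (12 * sqrt (1 + energy N t))"
proof -
  let ?b = "\<lambda>n. cmod (a t n)" and ?p = "\<lambda>n. cmod (predecessor t n)"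
  have "cmod (pair_deriv n t) \<le> \<bar>v t\<bar> * (?b (n + 0) * ?b (n + 0) + ?b (n + 0) * ?b (n + 2) + ?b (n + 1) * ?p n + ?b (n + 1) * ?b (n + 1))" for n
  proof -
    have "cmod (pair_deriv n t) \<le> \<bar>v t\<bar> * (cmod (coupling k (a t) t (Suc n)) * ?b n) + \<bar>v t\<bar> * (?b (Suc n) * cmod (coupling k (a t) t n))"
      unfolding pair_deriv_def by (intro order.trans[OF norm_triangle_ineq]) (simp add: norm_mult)
    also have "\<dots> \<le> \<bar>v t\<bar> * ((?b n + ?b (n + 2)) * ?b n) + \<bar>v t\<bar> * (?b (Suc n) * (?p n + ?b (n + 1)))"
      using norm_coupling_le[of t n] norm_coupling_le[of t "Suc n"]
      by (intro add_mono mult_left_mono mult_right_mono) (auto simp: predecessor_def)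
    finally show ?thesis by (simp add: algebra_simps)
  qed
  then have "(\<Sum>n<N. (2 * real n + 1) * cmod (pair_deriv n t)) \<le> (\<Sum>n<N. (2 * real n + 1) *
     (\<bar>v t\<bar> * (?b (n + 0) * ?b (n + 0) + ?b (n + 0) * ?b (n + 2) + ?b (n + 1) * ?p n + ?b (n + 1) * ?b (n + 1))))"
    by (intro sum_mono mult_left_mono) auto
  also have "\<dots> = \<bar>v t\<bar> * ((\<Sum>n<N. (2 * real n + 1) * (?b (n + 0) * ?b (n + 0))) + (\<Sum>n<N. (2 * real n + 1) * (?b (n + 0) * ?b (n + 2)))
      + (\<Sum>n<N. (2 * real n + 1) * (?b (n + 1) * ?p n)) + (\<Sum>n<N. (2 * real n + 1) * (?b (n + 1) * ?b (n + 1))))"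
    by (simp only: sum_distrib_left sum.distrib[symmetric] distrib_left mult.left_commute)
  also have "\<dots> \<le> \<bar>v t\<bar> * (3 * sqrt (1 + energy N t) + 3 * sqrt (1 + energy N t) + 3 * sqrt (1 + energy N t) + 3 * sqrt (1 + energy N t))"
    by (intro mult_left_mono add_mono pairing_le t mass_shift mass_predecessor) auto
  finally show ?thesis by simp
qed

text \<open>Before the oscillation sets in, the growth of the energy is estimated by absolute values.\<close>

lemma energy_near:
  assumes t: "0 \<le> t" "t \<le> T" and H: "\<And>s. 0 \<le> s \<Longrightarrow> s \<le> t \<Longrightarrow> sqrt (1 + energy N s) \<le> H"
  shows "energy N t \<le> H * (6 * integral {0..T} (\<lambda>s. \<bar>v s\<bar>))"
proof -
  have H0: "0 \<le> H" using H[of 0] t by simp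
  let ?e = "\<lambda>t. - (\<Sum>M<N. (2 * real M + 1) * (2 * v t * current k (a t) t M))"
  have lb: "locally_bounded (\<lambda>s. 6 * H * \<bar>v s\<bar>)" by (intro locally_bounded_mult locally_bounded_const locally_bounded_abs_v)
  have "energy N t = integral {0..t} ?e" using primitive_diff[OF primitive_energy, of 0 t N] t by simp
  also have "\<dots> \<le> norm (integral {0..t} ?e)" by simp
  also have "\<dots> \<le> integral {0..t} (\<lambda>s. 6 * H * \<bar>v s\<bar>)"
  proof (rule integral_norm_bound_integral)
    show "?e integrable_on {0..t}" by (intro locally_bounded_integrable_on[OF primitive_locally_bounded[OF primitive_energy]]) auto
    show "(\<lambda>s. 6 * H * \<bar>v s\<bar>) integrable_on {0..t}" by (intro locally_bounded_integrable_on lb) auto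
    fix s assume s: "s \<in> {0..t}"
    have "\<bar>?e s\<bar> \<le> (\<Sum>M<N. \<bar>(2 * real M + 1) * (2 * v s * current k (a s) s M)\<bar>)"
      by (simp only: abs_minus_cancel sum_abs)
    also have "\<dots> \<le> (\<Sum>M<N. 2 * \<bar>v s\<bar> * ((2 * real M + 1) * cmod (pair M s)))"
    proof (rule sum_mono)
      fix M
      have "\<bar>current k (a s) s M\<bar> \<le> cmod (pair M s)"
        using abs_current_le[of k "a s" s M] by (simp add: pair_def norm_mult)
      then have "2 * \<bar>v s\<bar> * (2 * real M + 1) * \<bar>current k (a s) s M\<bar> \<le> 2 * \<bar>v s\<bar> * (2 * real M + 1) * cmod (pair M s)"
        by (intro mult_left_mono) auto
      moreover have "\<bar>(2 * real M + 1) * (2 * v s * current k (a s) s M)\<bar> = 2 * \<bar>v s\<bar> * (2 * real M + 1) * \<bar>current k (a s) s M\<bar>"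
        by (simp only: abs_mult) simp
      ultimately show "\<bar>(2 * real M + 1) * (2 * v s * current k (a s) s M)\<bar> \<le> 2 * \<bar>v s\<bar> * ((2 * real M + 1) * cmod (pair M s))"
        by (simp only: mult.assoc)
    qed
    also have "\<dots> = 2 * \<bar>v s\<bar> * (\<Sum>M<N. (2 * real M + 1) * cmod (pair M s))" by (rule sum_distrib_left[symmetric])
    also have "\<dots> \<le> 2 * \<bar>v s\<bar> * (3 * H)"
      using s sum_pair_le[of s N] H[of s] by (intro mult_left_mono) auto
    finally show "norm (?e s) \<le> 6 * H * \<bar>v s\<bar>" by (simp add: algebra_simps)
  qed
  also have "\<dots> \<le> integral {0..T} (\<lambda>s. 6 * H * \<bar>v s\<bar>)"
    using t H0 by (intro integral_subset_le locally_bounded_integrable_on lb) auto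
  finally show ?thesis by (simp add: mult.assoc mult.left_commute)
qed

text \<open>Integration by parts: \<open>v\<close> times the phase is minus the derivative of the tail \<open>W\<^sub>n\<close>. Both
the boundary terms and the remaining integral contain tails, and are controlled by the single
quantity \<open>A\<close>.\<close>

lemma energy_far:
  assumes T: "0 \<le> T0" "T0 \<le> t" "t \<le> T" and H: "\<And>s. T0 \<le> s \<Longrightarrow> s \<le> t \<Longrightarrow> sqrt (1 + energy N s) \<le> H"
    and A: "A = integral {T0..T} (\<lambda>s. \<bar>v s\<bar> * tail_size v N T k s)"
  shows "energy N t \<le> energy N T0 + H * (12 * sqrt (2 * A) + 24 * A)"
proof -
  have H0: "0 \<le> H" using H[of T0] T energy_nonneg[of T0 N] by (smt (verit) real_sqrt_ge_zero)
  define W where "W n = tail v T (k * (2 * real n + 1))" for n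
  let ?w = "\<lambda>n t. - (complex_of_real (v t) * link k n t)"
  have W: "primitive (W n) (?w n)" for n
    unfolding W_def link_def by (rule primitive_tail[OF v])
  \<comment> \<open>Adding the boundary terms \<open>?bd\<close> to the energy cancels the oscillating part of its derivative; \<open>?rem\<close> is what remains.\<close>
  let ?bd = "\<lambda>t. \<Sum>n<N. - 2 * (2 * real n + 1) * Im (W n t * pair n t)"
  let ?rem = "\<lambda>t. \<Sum>n<N. - 2 * (2 * real n + 1) * Im (W n t * pair_deriv n t)"
  have "primitive (\<lambda>t. energy N t + ?bd t)
     (\<lambda>t. - (\<Sum>M<N. (2 * real M + 1) * (2 * v t * current k (a t) t M))
        + (\<Sum>n<N. - 2 * (2 * real n + 1) * Im (?w n t * pair n t + W n t * pair_deriv n t)))"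
    by (intro primitive_add primitive_energy primitive_sum primitive_mult primitive_pair W
        primitive_linear[OF bounded_linear_mult_right] primitive_linear[OF bounded_linear_Im])
  moreover have "- (\<Sum>M<N. (2 * real M + 1) * (2 * v t * current k (a t) t M))
        + (\<Sum>n<N. - 2 * (2 * real n + 1) * Im (?w n t * pair n t + W n t * pair_deriv n t)) = ?rem t" for t
    unfolding sum_negf[symmetric] sum.distrib[symmetric]
  proof (intro sum.cong refl)
    fix n
    have e: "Im (?w n t * pair n t) = - v t * current k (a t) t n"
      by (simp add: current_def pair_def algebra_simps)
    show "- ((2 * real n + 1) * (2 * v t * current k (a t) t n)) +
         - 2 * (2 * real n + 1) * Im (?w n t * pair n t + W n t * pair_deriv n t) =
         - 2 * (2 * real n + 1) * Im (W n t * pair_deriv n t)"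
      by (simp only: plus_complex.sel e) (simp add: algebra_simps)
  qed
  ultimately have Z: "primitive (\<lambda>t. energy N t + ?bd t) ?rem" by (simp only:)
  have abs_coeff: "\<bar>- 2 * (2 * real n + 1) * x\<bar> = 2 * (2 * real n + 1) * \<bar>x\<bar>" for n x
    by (simp add: abs_mult)
  have lb: "locally_bounded (\<lambda>s. 24 * H * (\<bar>v s\<bar> * tail_size v N T k s))"
    by (intro locally_bounded_mult locally_bounded_const locally_bounded_abs_v locally_bounded_tail_size v)
  have "(energy N t + ?bd t) - (energy N T0 + ?bd T0) = integral {T0..t} ?rem"
    using T by (intro primitive_diff[OF Z]) auto
  also have "\<dots> \<le> norm (integral {T0..t} ?rem)" by simp
  also have "\<dots> \<le> integral {T0..t} (\<lambda>s. 24 * H * (\<bar>v s\<bar> * tail_size v N T k s))"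
  proof (rule integral_norm_bound_integral)
    show "?rem integrable_on {T0..t}" using T by (intro locally_bounded_integrable_on[OF primitive_locally_bounded[OF Z]]) auto
    show "(\<lambda>s. 24 * H * (\<bar>v s\<bar> * tail_size v N T k s)) integrable_on {T0..t}"
      using T by (intro locally_bounded_integrable_on lb) auto
    fix s assume s: "s \<in> {T0..t}"
    have "\<bar>?rem s\<bar> \<le> (\<Sum>n<N. \<bar>- 2 * (2 * real n + 1) * Im (W n s * pair_deriv n s)\<bar>)" by (rule sum_abs)
    also have "\<dots> \<le> (\<Sum>n<N. 2 * tail_size v N T k s * ((2 * real n + 1) * cmod (pair_deriv n s)))"
    proof (rule sum_mono)
      fix n assume n: "n \<in> {..<N}"
      have "\<bar>Im (W n s * pair_deriv n s)\<bar> \<le> cmod (W n s) * cmod (pair_deriv n s)"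
        by (rule order.trans[OF abs_Im_le_cmod]) (simp add: norm_mult)
      also have "\<dots> \<le> tail_size v N T k s * cmod (pair_deriv n s)"
        using n tail_le_tail_size[of n N v T k s] unfolding W_def by (intro mult_right_mono) auto
      finally have "2 * (2 * real n + 1) * \<bar>Im (W n s * pair_deriv n s)\<bar>
         \<le> 2 * (2 * real n + 1) * (tail_size v N T k s * cmod (pair_deriv n s))" by (intro mult_left_mono) auto
      then show "\<bar>- 2 * (2 * real n + 1) * Im (W n s * pair_deriv n s)\<bar>
         \<le> 2 * tail_size v N T k s * ((2 * real n + 1) * cmod (pair_deriv n s))"
        unfolding abs_coeff by (simp only: mult.assoc mult.left_commute mult.commute)
    qed
    also have "\<dots> = 2 * tail_size v N T k s * (\<Sum>n<N. (2 * real n + 1) * cmod (pair_deriv n s))" by (rule sum_distrib_left[symmetric])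
    also have "\<dots> \<le> 2 * tail_size v N T k s * (\<bar>v s\<bar> * (12 * sqrt (1 + energy N s)))"
      using s T by (intro mult_left_mono sum_pair_deriv_le) auto
    also have "\<dots> \<le> 2 * tail_size v N T k s * (\<bar>v s\<bar> * (12 * H))"
      using s H[of s] by (intro mult_left_mono) auto
    finally show "norm (?rem s) \<le> 24 * H * (\<bar>v s\<bar> * tail_size v N T k s)" by (simp add: algebra_simps)
  qed
  also have "\<dots> \<le> integral {T0..T} (\<lambda>s. 24 * H * (\<bar>v s\<bar> * tail_size v N T k s))"
    using T H0 by (intro integral_subset_le locally_bounded_integrable_on lb) auto
  also have "\<dots> = 24 * H * A" unfolding A by simp
  finally have main: "(energy N t + ?bd t) - (energy N T0 + ?bd T0) \<le> 24 * H * A" .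
  have bd: "\<bar>?bd s\<bar> \<le> 6 * sqrt (2 * A) * H" if s: "T0 \<le> s" "s \<le> t" for s
  proof -
    have "\<bar>?bd s\<bar> \<le> (\<Sum>n<N. \<bar>- 2 * (2 * real n + 1) * Im (W n s * pair n s)\<bar>)" by (rule sum_abs)
    also have "\<dots> \<le> (\<Sum>n<N. 2 * sqrt (2 * A) * ((2 * real n + 1) * cmod (pair n s)))"
    proof (rule sum_mono)
      fix n assume n: "n \<in> {..<N}"
      have "cmod (W n s) \<le> sqrt (2 * A)"
        using n s T tail_power2_le[OF v, of T0 s T n N k] unfolding A W_def
        by (intro real_le_rsqrt) auto
      then have "cmod (W n s) * cmod (pair n s) \<le> sqrt (2 * A) * cmod (pair n s)"
        by (intro mult_right_mono) auto
      moreover have "\<bar>Im (W n s * pair n s)\<bar> \<le> cmod (W n s) * cmod (pair n s)"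
        by (rule order.trans[OF abs_Im_le_cmod]) (simp add: norm_mult)
      ultimately have "2 * (2 * real n + 1) * \<bar>Im (W n s * pair n s)\<bar>
         \<le> 2 * (2 * real n + 1) * (sqrt (2 * A) * cmod (pair n s))" by (intro mult_left_mono) auto
      then show "\<bar>- 2 * (2 * real n + 1) * Im (W n s * pair n s)\<bar>
         \<le> 2 * sqrt (2 * A) * ((2 * real n + 1) * cmod (pair n s))"
        unfolding abs_coeff by (simp only: mult.assoc mult.left_commute mult.commute)
    qed
    also have "\<dots> = 2 * sqrt (2 * A) * (\<Sum>n<N. (2 * real n + 1) * cmod (pair n s))" by (rule sum_distrib_left[symmetric])
    also have "\<dots> \<le> 2 * sqrt (2 * A) * (3 * H)"
    proof (rule mult_left_mono)
      show "(\<Sum>n<N. (2 * real n + 1) * cmod (pair n s)) \<le> 3 * H"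
        using s T sum_pair_le[of s N] H[of s] by auto
      have "0 \<le> A" unfolding A by (intro integral_nonneg locally_bounded_integrable_on locally_bounded_mult locally_bounded_abs_v locally_bounded_tail_size v T(1)) auto
      then show "0 \<le> 2 * sqrt (2 * A)" by simp
    qed
    finally show ?thesis by (simp add: mult.assoc mult.left_commute)
  qed
  have "energy N t \<le> energy N T0 + 24 * H * A + 6 * sqrt (2 * A) * H + 6 * sqrt (2 * A) * H"
    using main bd[of t] bd[of T0] T by linarith
  then show ?thesis by (simp add: algebra_simps)
qed

text \<open>At a maximum \<open>m\<close> of the energy on \<open>[0,T]\<close> both estimates hold with \<open>H\<^sup>2 = 1 + energy N m\<close>,
which gives \<open>H\<^sup>2 \<le> 1 + H B\<close> and hence \<open>H \<le> 1 + B\<close>.\<close>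

lemma energy_bound:
  assumes T: "0 \<le> T0" "T0 \<le> T" and t: "0 \<le> t" "t \<le> T"
    and V: "V = integral {0..T0} (\<lambda>s. \<bar>v s\<bar>)"
    and A: "A = integral {T0..T} (\<lambda>s. \<bar>v s\<bar> * tail_size v N T k s)"
  shows "energy N t \<le> (1 + (6 * V + 12 * sqrt (2 * A) + 24 * A))\<^sup>2"
proof -
  let ?B = "6 * V + 12 * sqrt (2 * A) + 24 * A"
  have A0: "0 \<le> A" unfolding A by (intro integral_nonneg locally_bounded_integrable_on locally_bounded_mult locally_bounded_abs_v locally_bounded_tail_size v T(1)) auto
  have "\<exists>m\<in>{0..T}. \<forall>s\<in>{0..T}. energy N s \<le> energy N m"
    using T by (intro continuous_attains_sup continuous_on_subset[OF primitive_continuous[OF primitive_energy]]) auto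
  then obtain m where m: "0 \<le> m" "m \<le> T" "\<And>s. 0 \<le> s \<Longrightarrow> s \<le> T \<Longrightarrow> energy N s \<le> energy N m" by auto
  define H where "H = sqrt (1 + energy N m)"
  have H1: "1 \<le> H" using energy_nonneg[OF m(1)] by (simp add: H_def)
  have H2: "H\<^sup>2 = 1 + energy N m" using energy_nonneg[OF m(1), of N] by (simp add: H_def)
  have H: "sqrt (1 + energy N s) \<le> H" if "0 \<le> s" "s \<le> T" for s
    unfolding H_def using m(3)[OF that] by simp
  have "energy N m \<le> H * ?B"
  proof (cases "m \<le> T0")
    case True
    have "energy N m \<le> H * (6 * V)" unfolding V
      using m True by (intro energy_near H) auto
    also have "\<dots> \<le> H * ?B" using H1 A0 by (intro mult_left_mono) auto
    finally show ?thesis .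
  next
    case False
    have "energy N T0 \<le> H * (6 * V)" unfolding V
      using T by (intro energy_near H) auto
    moreover have "energy N m \<le> energy N T0 + H * (12 * sqrt (2 * A) + 24 * A)"
      using m T False by (intro energy_far[OF _ _ _ _ A] H) auto
    ultimately show ?thesis by (simp add: algebra_simps)
  qed
  then have "H * H \<le> 1 + H * ?B" using H2 by (simp add: power2_eq_square)
  also have "\<dots> \<le> H * (1 + ?B)" using H1 by (simp add: algebra_simps)
  finally have "H \<le> 1 + ?B" using H1 by simp
  then have "H\<^sup>2 \<le> (1 + ?B)\<^sup>2" using H1 by (intro power_mono) auto
  then show ?thesis using m(3)[OF t] H2 by linarith
qed

end

section \<open>Continuous dependence on the parameter\<close>

lemma norm_cis_diff_le: "cmod (cis x - cis y) \<le> \<bar>x - y\<bar>"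
proof -
  have "cis x - cis y = cis y * (cis (x - y) - 1)"
    by (simp add: right_diff_distrib cis_mult)
  then have "cmod (cis x - cis y) = cmod (cis (x - y) - 1)" by (simp add: norm_mult)
  then show ?thesis using iexp_approx1[of "x - y" 0] by (simp add: cis_conv_exp)
qed

lemma norm_link_diff_le:
  assumes "0 \<le> t" shows "cmod (link k n t - link k' n t) \<le> \<bar>k - k'\<bar> * t * (2 * real n + 1)"
proof -
  have "cmod (link k n t - link k' n t) \<le> \<bar>- (k * (2 * real n + 1) * t) - - (k' * (2 * real n + 1) * t)\<bar>"
    unfolding link_def by (rule norm_cis_diff_le)
  also have "- (k * (2 * real n + 1) * t) - - (k' * (2 * real n + 1) * t) = - ((k - k') * t * (2 * real n + 1))"
    by (simp add: algebra_simps)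
  finally show ?thesis using assms by (simp add: abs_mult)
qed

context unit_flow begin

lemma weighted_mass_bounded:
  assumes "0 \<le> t" "t \<le> T"
  shows "(\<Sum>n<L. (real n)\<^sup>2 * (cmod (a t n))\<^sup>2) \<le> (1 + 6 * integral {0..T} (\<lambda>s. \<bar>v s\<bar>))\<^sup>2"
proof -
  have "(\<Sum>n<L. (real n)\<^sup>2 * (cmod (a t n))\<^sup>2) = (\<Sum>n<L. (real (min n L))\<^sup>2 * (cmod (a t n))\<^sup>2)"
    by (intro sum.cong) auto
  also have "\<dots> \<le> energy L t" by (rule weighted_mass_le_energy[OF assms(1)])
  also have "\<dots> \<le> (1 + (6 * integral {0..T} (\<lambda>s. \<bar>v s\<bar>) + 12 * sqrt (2 * 0) + 24 * 0))\<^sup>2"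
    using assms by (intro energy_bound[of T T]) auto
  finally show ?thesis by simp
qed

end

text \<open>The difference \<open>d\<close> of the two solutions is forced by the difference of the phases, which
is at most \<open>|k - k'| t (2n + 1)\<close> on the bond \<open>n\<close>. The factor \<open>2n + 1\<close> is absorbed by the second
moments of \<open>b\<close>, which are bounded by the energy estimate with \<open>T0 = T\<close>, that is, with absolute
values throughout. For \<open>k = k'\<close> this is uniqueness; for \<open>k' \<rightarrow> k\<close> it gives the continuity in \<open>k\<close>
from which measurability of the supremum follows.\<close>

lemma unit_flow_difference:
  assumes a: "unit_flow v k a" and b: "unit_flow v k' b" and T: "0 \<le> T"
    and C: "0 \<le> C" "\<And>t. 0 \<le> t \<Longrightarrow> t \<le> T \<Longrightarrow> \<bar>v t\<bar> \<le> C"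
    and K: "K = (1 + 6 * integral {0..T} (\<lambda>s. \<bar>v s\<bar>))\<^sup>2"
  shows "(cmod (a T n - b T n))\<^sup>2 \<le> \<bar>k - k'\<bar> * (C * T * (8 + 24 * K) * T)"
proof -
  interpret a: unit_flow v k a by fact
  interpret b: unit_flow v k' b by fact
  define d where "d t n = a t n - b t n" for t n
  define g where "g t n = \<i> * complex_of_real (v t) * (coupling k (b t) t n - coupling k' (b t) t n)" for t n
  define h where "h t n = (2 * real n - 1) * cmod (b.predecessor t n) + (2 * real n + 1) * cmod (b t (n + 1))" for t n
  have fl: "flow v k d g"
    unfolding flow_def
  proof
    fix n
    have P: "primitive (\<lambda>t. a t n + - b t n) (\<lambda>t. \<i> * complex_of_real (v t) * coupling k (a t) t n + - (\<i> * complex_of_real (v t) * coupling k' (b t) t n))"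
      using a.flow b.flow unfolding flow_def
      by (intro primitive_add primitive_linear[OF bounded_linear_minus[OF bounded_linear_ident]]) auto
    have cd: "coupling k (d t) t n = coupling k (a t) t n - coupling k (b t) t n" for t
      by (simp add: coupling_def d_def algebra_simps split: nat.split)
    have e: "\<i> * complex_of_real (v t) * coupling k (d t) t n + g t n
        = \<i> * complex_of_real (v t) * coupling k (a t) t n + - (\<i> * complex_of_real (v t) * coupling k' (b t) t n)" for t
      unfolding g_def cd by (simp add: algebra_simps)
    from P show "primitive (\<lambda>t. d t n) (\<lambda>t. \<i> * complex_of_real (v t) * coupling k (d t) t n + g t n)"
      unfolding e by (simp add: d_def)
  qed
  have dmass: "(\<Sum>n\<le>M. (cmod (d t n))\<^sup>2) \<le> 4" if t: "0 \<le> t" for t M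
  proof -
    have "(\<Sum>n\<le>M. (cmod (d t n))\<^sup>2) \<le> (\<Sum>n\<le>M. 2 * (cmod (a t n))\<^sup>2 + 2 * (cmod (b t n))\<^sup>2)"
    proof (rule sum_mono)
      show "(cmod (d t n))\<^sup>2 \<le> 2 * (cmod (a t n))\<^sup>2 + 2 * (cmod (b t n))\<^sup>2" for n
        using power2_norm_add_le[of "a t n" "- b t n"] by (simp add: d_def)
    qed
    also have "\<dots> = 2 * (\<Sum>n\<le>M. (cmod (a t n))\<^sup>2) + 2 * (\<Sum>n\<le>M. (cmod (b t n))\<^sup>2)"
      by (simp only: sum.distrib sum_distrib_left)
    also have "\<dots> \<le> 2 * 1 + 2 * 1" by (intro add_mono mult_left_mono a.mass b.mass t) auto
    finally show ?thesis by simp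
  qed
  have hmass: "(\<Sum>n\<le>M. (h t n)\<^sup>2) \<le> 4 + 24 * K" if t: "0 \<le> t" "t \<le> T" for t M
  proof -
    let ?b = "\<lambda>n. (cmod (b t n))\<^sup>2"
    let ?f = "\<lambda>n. (real n)\<^sup>2 * ?b n"
    let ?p = "\<lambda>n. (2 * real n - 1)\<^sup>2 * (cmod (b.predecessor t n))\<^sup>2"
    have "(h t n)\<^sup>2 \<le> 2 * ?p n + 8 * ?f (n + 1)" for n
    proof -
      have sq: "(x + y)\<^sup>2 \<le> 2 * x\<^sup>2 + 2 * y\<^sup>2" for x y :: real
        using sum_squares_bound[of x y] by (simp add: power2_sum)
      have "(h t n)\<^sup>2 \<le> 2 * ?p n + 2 * ((2 * real n + 1)\<^sup>2 * ?b (n + 1))"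
        using sq[of "(2 * real n - 1) * cmod (b.predecessor t n)" "(2 * real n + 1) * cmod (b t (n + 1))"]
        by (simp only: h_def power_mult_distrib)
      moreover have "(2 * real n + 1)\<^sup>2 * ?b (n + 1) \<le> 4 * ?f (n + 1)"
      proof -
        have "(2 * real n + 1)\<^sup>2 \<le> (2 * real (n + 1))\<^sup>2" by (intro power_mono) auto
        also have "\<dots> = 4 * (real (n + 1))\<^sup>2" by (simp only: power_mult_distrib) simp
        finally show ?thesis by (simp only: mult.assoc[symmetric]) (intro mult_right_mono, auto)
      qed
      ultimately show ?thesis by linarith
    qed
    then have "(\<Sum>n\<le>M. (h t n)\<^sup>2) \<le> (\<Sum>n\<le>M. 2 * ?p n + 8 * ?f (n + 1))" by (rule sum_mono)
    also have "\<dots> = 2 * (\<Sum>n<Suc M. ?p n) + 8 * (\<Sum>n<Suc M. ?f (n + 1))"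
      by (simp only: sum.distrib sum_distrib_left lessThan_Suc_atMost)
    also have "\<dots> \<le> 2 * (2 + 8 * K) + 8 * K"
    proof (intro add_mono mult_left_mono)
      have "(\<Sum>n<Suc M. ?f (n + 1)) \<le> (\<Sum>n<Suc M + 1. ?f n)" by (rule b.sum_shift_le[where f = ?f]) simp
      also have "\<dots> \<le> K" unfolding K by (rule b.weighted_mass_bounded[OF t])
      finally show "(\<Sum>n<Suc M. ?f (n + 1)) \<le> K" .
      have "(\<Sum>n<Suc M. ?p n) = (\<Sum>n<M. (2 * real n + 1)\<^sup>2 * ?b n)"
        by (simp add: sum.lessThan_Suc_shift b.predecessor_def add.commute del: sum.lessThan_Suc)
      also have "\<dots> \<le> (\<Sum>n<M. 2 * ?b n + 8 * ?f n)"
      proof (rule sum_mono)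
        fix n
        have "(2 * real n + 1)\<^sup>2 \<le> 2 + 8 * (real n)\<^sup>2"
        proof -
          have "2 + 8 * (real n)\<^sup>2 - (2 * real n + 1)\<^sup>2 = (2 * real n - 1)\<^sup>2"
            by (simp add: power2_eq_square algebra_simps)
          then show ?thesis using zero_le_power2[of "2 * real n - 1"] by linarith
        qed
        from mult_right_mono[OF this, of "?b n"]
        show "(2 * real n + 1)\<^sup>2 * ?b n \<le> 2 * ?b n + 8 * ?f n" by (simp add: distrib_right mult.assoc)
      qed
      also have "\<dots> = 2 * (\<Sum>n<M. ?b n) + 8 * (\<Sum>n<M. ?f n)" by (simp only: sum.distrib sum_distrib_left)
      also have "\<dots> \<le> 2 * 1 + 8 * K" unfolding K
        by (intro add_mono mult_left_mono b.mass_lessThan b.weighted_mass_bounded t) auto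
      finally show "(\<Sum>n<Suc M. ?p n) \<le> 2 + 8 * K" by simp
    qed auto
    finally show ?thesis by simp
  qed
  have g: "cmod (g t n) \<le> C * (\<bar>k - k'\<bar> * T) * h t n" if t: "0 \<le> t" "t \<le> T" for t n
  proof -
    have l: "cmod (link k m t - link k' m t) \<le> \<bar>k - k'\<bar> * T * (2 * real m + 1)" for m
      by (rule order.trans[OF norm_link_diff_le[OF t(1)]]) (use t in \<open>auto intro!: mult_right_mono mult_left_mono\<close>)
    have "coupling k (b t) t n - coupling k' (b t) t n =
        (case n of 0 \<Rightarrow> 0 | Suc m \<Rightarrow> (link k m t - link k' m t) * b t m) + cnj (link k n t - link k' n t) * b t (n + 1)"
      by (simp add: coupling_def algebra_simps split: nat.split)
    also have "cmod \<dots> \<le> \<bar>k - k'\<bar> * T * ((2 * real n - 1) * cmod (b.predecessor t n)) + \<bar>k - k'\<bar> * T * ((2 * real n + 1) * cmod (b t (n + 1)))"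
    proof (intro order.trans[OF norm_triangle_ineq] add_mono)
      show "cmod (case n of 0 \<Rightarrow> 0 | Suc m \<Rightarrow> (link k m t - link k' m t) * b t m) \<le> \<bar>k - k'\<bar> * T * ((2 * real n - 1) * cmod (b.predecessor t n))"
      proof (cases n)
        case (Suc m)
        from mult_right_mono[OF l[of m], of "cmod (b t m)"] show ?thesis
          by (simp add: Suc norm_mult b.predecessor_def mult.assoc add.commute)
      qed (simp add: b.predecessor_def)
      have "cmod (link k n t - link k' n t) * cmod (b t (n + 1)) \<le> \<bar>k - k'\<bar> * T * (2 * real n + 1) * cmod (b t (n + 1))"
        by (rule mult_right_mono[OF l]) simp
      then show "cmod (cnj (link k n t - link k' n t) * b t (n + 1)) \<le> \<bar>k - k'\<bar> * T * ((2 * real n + 1) * cmod (b t (n + 1)))"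
        by (simp only: norm_mult complex_mod_cnj mult.assoc)
    qed
    also have "\<dots> = \<bar>k - k'\<bar> * T * h t n" by (simp only: h_def distrib_left)
    finally have "\<bar>v t\<bar> * cmod (coupling k (b t) t n - coupling k' (b t) t n) \<le> C * (\<bar>k - k'\<bar> * T * h t n)"
      using C t by (intro mult_mono) auto
    then show ?thesis by (simp add: g_def norm_mult mult.assoc)
  qed
  have "(\<Sum>n\<le>M. 2 * Re (cnj (d t n) * g t n)) \<le> C * (\<bar>k - k'\<bar> * T) * (8 + 24 * K)" if t: "0 \<le> t" "t \<le> T" for t M
  proof -
    let ?c = "C * (\<bar>k - k'\<bar> * T)"
    have c: "0 \<le> ?c" using C(1) T by simp
    have "(\<Sum>n\<le>M. 2 * Re (cnj (d t n) * g t n)) \<le> (\<Sum>n\<le>M. ?c * ((cmod (d t n))\<^sup>2 + (h t n)\<^sup>2))"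
    proof (rule sum_mono)
      fix n
      have "2 * Re (cnj (d t n) * g t n) \<le> 2 * (cmod (d t n) * cmod (g t n))"
        using complex_Re_le_cmod[of "cnj (d t n) * g t n"] by (simp only: norm_mult complex_mod_cnj)
      also have "\<dots> \<le> 2 * (cmod (d t n) * (?c * h t n))"
        using g[OF t, of n] by (intro mult_left_mono) auto
      also have "\<dots> = ?c * (2 * cmod (d t n) * h t n)" by (simp only: mult.assoc mult.left_commute mult.commute)
      also have "\<dots> \<le> ?c * ((cmod (d t n))\<^sup>2 + (h t n)\<^sup>2)"
        by (intro mult_left_mono sum_squares_bound c)
      finally show "2 * Re (cnj (d t n) * g t n) \<le> ?c * ((cmod (d t n))\<^sup>2 + (h t n)\<^sup>2)" .
    qed
    also have "\<dots> = ?c * ((\<Sum>n\<le>M. (cmod (d t n))\<^sup>2) + (\<Sum>n\<le>M. (h t n)\<^sup>2))"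
      unfolding sum.distrib[symmetric] by (rule sum_distrib_left[symmetric])
    also have "\<dots> \<le> ?c * (8 + 24 * K)"
      using dmass[OF t(1), of M] hmass[OF t, of M] by (intro mult_left_mono[OF _ c]) linarith
    finally show ?thesis .
  qed
  note forcing = this
  have "(\<Sum>m\<le>M. (cmod (d T m))\<^sup>2) \<le> 0 + C * (\<bar>k - k'\<bar> * T) * (8 + 24 * K) * T" for M
    by (rule flow_mass_bound[OF a.v fl T dmass forcing]) (simp_all add: d_def a.init b.init)
  from sum_power2_norm_term_le[OF this, of n]
  show ?thesis by (simp add: d_def mult.assoc mult.left_commute)
qed

lemma unit_flow_continuous_parameter:
  assumes "\<And>k. unit_flow v k (a k)" and T: "0 \<le> T"
  shows "continuous_on UNIV (\<lambda>k. a k T n)"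
proof -
  have "locally_bounded v" using assms(1) unit_flow.v by blast
  then obtain C where C: "C \<ge> 0" "\<And>t. 0 \<le> t \<Longrightarrow> t \<le> T \<Longrightarrow> \<bar>v t\<bar> \<le> C" using locally_bounded_bound[of v T] by auto
  define c where "c = C * T * (8 + 24 * (1 + 6 * integral {0..T} (\<lambda>s. \<bar>v s\<bar>))\<^sup>2) * T"
  have bound: "cmod (a k T n - a k' T n) \<le> sqrt (\<bar>k - k'\<bar> * c)" for k k'
    using unit_flow_difference[OF assms(1)[of k] assms(1)[of k'] T C refl, of n]
    by (intro real_le_rsqrt) (simp add: c_def)
  have "((\<lambda>k. a k T n) \<longlongrightarrow> a k' T n) (at k')" for k'
  proof -
    have "((\<lambda>k. sqrt (\<bar>k - k'\<bar> * c)) \<longlongrightarrow> sqrt (\<bar>k' - k'\<bar> * c)) (at k')"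
      by (intro tendsto_intros)
    then have "((\<lambda>k. sqrt (\<bar>k - k'\<bar> * c)) \<longlongrightarrow> 0) (at k')" by simp
    moreover have "\<forall>\<^sub>F k in at k'. norm (a k T n - a k' T n) \<le> sqrt (\<bar>k - k'\<bar> * c)"
      by (rule always_eventually) (rule allI, rule bound)
    ultimately have "((\<lambda>k. a k T n - a k' T n) \<longlongrightarrow> 0) (at k')"
      by (rule Lim_null_comparison[rotated])
    then show ?thesis by (rule LIM_zero_cancel)
  qed
  then show ?thesis by (simp add: continuous_on_def)
qed

section \<open>Square integrability of Fourier transforms\<close>

definition fourier :: "(real \<Rightarrow> real) \<Rightarrow> real \<Rightarrow> complex" where
  "fourier f \<xi> = (LINT s|lborel. complex_of_real (f s) * cis (- (\<xi> * s)))"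

lemma (in pair_sigma_finite) integral_tensor:
  fixes u :: "'a \<Rightarrow> real" and w :: "'b \<Rightarrow> real"
  assumes u: "integrable M1 u" and w: "integrable M2 w"
  shows "integrable (M1 \<Otimes>\<^sub>M M2) (\<lambda>p. u (fst p) * w (snd p))"
    and "(LINT p|(M1 \<Otimes>\<^sub>M M2). u (fst p) * w (snd p)) = (LINT x|M1. u x) * (LINT y|M2. w y)"
proof -
  have [measurable]: "u \<in> borel_measurable M1" "w \<in> borel_measurable M2" using u w by auto
  show int: "integrable (M1 \<Otimes>\<^sub>M M2) (\<lambda>p. u (fst p) * w (snd p))"
    by (rule Fubini_integrable) (use u w in \<open>auto simp: abs_mult\<close>)
  from integral_fst'[OF int]
  show "(LINT p|(M1 \<Otimes>\<^sub>M M2). u (fst p) * w (snd p)) = (LINT x|M1. u x) * (LINT y|M2. w y)"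
    by simp
qed

text \<open>The square of the transform as a double integral, so that an average over \<open>\<xi>\<close> can be taken
under the integral sign.\<close>

lemma norm_fourier_power2:
  assumes f: "integrable lborel f"
  shows "(cmod (fourier f \<xi>))\<^sup>2 =
    (LINT p|(lborel \<Otimes>\<^sub>M lborel). f (fst p) * f (snd p) * cos (\<xi> * (fst p - snd p)))"
proof -
  have [measurable]: "f \<in> borel_measurable borel" using f by simp
  have c: "integrable lborel (\<lambda>s. f s * cos (\<xi> * s))"
    by (rule Bochner_Integration.integrable_bound[OF f]) (auto simp: abs_mult intro!: mult_left_le)
  have s: "integrable lborel (\<lambda>s. f s * sin (\<xi> * s))"
    by (rule Bochner_Integration.integrable_bound[OF f]) (auto simp: abs_mult intro!: mult_left_le)
  have F: "integrable lborel (\<lambda>s. complex_of_real (f s) * cis (- (\<xi> * s)))"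
    by (rule Bochner_Integration.integrable_bound[OF f]) (auto simp: norm_mult cis_conv_exp)
  have "Re (fourier f \<xi>) = (LINT s|lborel. f s * cos (\<xi> * s))"
    using integral_Re[OF F] by (simp add: fourier_def)
  moreover have "Im (fourier f \<xi>) = - (LINT s|lborel. f s * sin (\<xi> * s))"
    using integral_Im[OF F] by (simp add: fourier_def)
  ultimately have "(cmod (fourier f \<xi>))\<^sup>2 =
      (LINT p|(lborel \<Otimes>\<^sub>M lborel). f (fst p) * cos (\<xi> * fst p) * (f (snd p) * cos (\<xi> * snd p)))
    + (LINT p|(lborel \<Otimes>\<^sub>M lborel). f (fst p) * sin (\<xi> * fst p) * (f (snd p) * sin (\<xi> * snd p)))"
    unfolding cmod_power2 lborel_pair.integral_tensor(2)[OF c c] lborel_pair.integral_tensor(2)[OF s s]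
    by (simp add: power2_eq_square)
  also have "\<dots> = (LINT p|(lborel \<Otimes>\<^sub>M lborel). f (fst p) * cos (\<xi> * fst p) * (f (snd p) * cos (\<xi> * snd p))
       + f (fst p) * sin (\<xi> * fst p) * (f (snd p) * sin (\<xi> * snd p)))"
    by (rule Bochner_Integration.integral_add[symmetric]) (rule lborel_pair.integral_tensor(1)[OF c c] lborel_pair.integral_tensor(1)[OF s s])+
  also have "\<dots> = (LINT p|(lborel \<Otimes>\<^sub>M lborel). f (fst p) * f (snd p) * cos (\<xi> * (fst p - snd p)))"
    by (intro Bochner_Integration.integral_cong refl) (simp add: right_diff_distrib cos_diff algebra_simps)
  finally show ?thesis .
qed

lemma integral_cos_std_normal:
  "(LINT \<eta>|std_normal_distribution. cos (\<eta> * x)) = exp (- x\<^sup>2 / 2)"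
proof -
  interpret real_distribution std_normal_distribution by (rule real_dist_normal_dist)
  have "integrable std_normal_distribution (\<lambda>\<eta>. iexp (x * \<eta>))"
    by (rule integrable_const_bound[where B = 1]) auto
  then have "(LINT \<eta>|std_normal_distribution. Re (iexp (x * \<eta>))) = Re (char std_normal_distribution x)"
    unfolding char_def by (rule integral_Re)
  then show ?thesis
    by (simp add: char_std_normal_distribution cis_conv_exp[symmetric] mult.commute Re_exp)
qed

lemma nn_integral_gaussian:
  assumes R: "0 < R"
  shows "(\<integral>\<^sup>+r. ennreal (exp (- (R * (s - r))\<^sup>2 / 2)) \<partial>lborel) = ennreal (sqrt (2 * pi) / R)"
proof -
  interpret prob_space std_normal_distribution by (rule prob_space_normal_density) simp
  have 1: "(\<integral>\<^sup>+r. ennreal (std_normal_density r) \<partial>lborel) = 1"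
    using emeasure_space_1 by (simp add: emeasure_density)
  have "ennreal (sqrt (2 * pi)) = ennreal (sqrt (2 * pi)) * (\<integral>\<^sup>+r. ennreal (std_normal_density r) \<partial>lborel)"
    by (simp add: 1)
  also have "\<dots> = (\<integral>\<^sup>+r. ennreal (sqrt (2 * pi)) * ennreal (std_normal_density r) \<partial>lborel)"
    by (rule nn_integral_cmult[symmetric]) simp
  also have "\<dots> = (\<integral>\<^sup>+r. ennreal (exp (- r\<^sup>2 / 2)) \<partial>lborel)"
    by (intro nn_integral_cong) (simp add: ennreal_mult'[symmetric] std_normal_density_def)
  also have "\<dots> = ennreal \<bar>R\<bar> * (\<integral>\<^sup>+r. ennreal (exp (- (- (R * s) + R * r)\<^sup>2 / 2)) \<partial>lborel)"
    using R by (intro nn_integral_real_affine) auto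
  also have "(\<lambda>r. ennreal (exp (- (- (R * s) + R * r)\<^sup>2 / 2))) = (\<lambda>r. ennreal (exp (- (R * (s - r))\<^sup>2 / 2)))"
    by (intro ext) (simp add: power2_eq_square algebra_simps)
  finally have e: "ennreal (sqrt (2 * pi)) = ennreal R * (\<integral>\<^sup>+r. ennreal (exp (- (R * (s - r))\<^sup>2 / 2)) \<partial>lborel)"
    using R by simp
  have "ennreal (sqrt (2 * pi) / R) = ennreal (1 / R) * ennreal (sqrt (2 * pi))"
    using R by (simp add: ennreal_mult'[symmetric])
  also have "\<dots> = (ennreal (1 / R) * ennreal R) * (\<integral>\<^sup>+r. ennreal (exp (- (R * (s - r))\<^sup>2 / 2)) \<partial>lborel)"
    unfolding e by (rule mult.assoc[symmetric])
  also have "ennreal (1 / R) * ennreal R = 1" using R by (simp add: ennreal_mult'[symmetric])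
  finally show ?thesis by simp
qed

text \<open>Averaging over Gaussian frequencies turns the cosine into a positive integrable kernel of
\<open>s - r\<close>, to which the inequality \<open>2 |f(s) f(r)| \<le> f(s)\<^sup>2 + f(r)\<^sup>2\<close> applies.\<close>

lemma gaussian_average_fourier:
  assumes f: "integrable lborel f" and R: "0 < R"
  shows "(\<integral>\<^sup>+\<eta>. ennreal ((cmod (fourier f (R * \<eta>)))\<^sup>2) \<partial>std_normal_distribution)
     \<le> ennreal (sqrt (2 * pi) / R) * (\<integral>\<^sup>+s. ennreal ((f s)\<^sup>2) \<partial>lborel)"
proof -
  interpret N: real_distribution std_normal_distribution by (rule real_dist_normal_dist)
  interpret P: pair_sigma_finite std_normal_distribution "lborel \<Otimes>\<^sub>M lborel :: (real \<times> real) measure"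
    unfolding pair_sigma_finite_def lborel_prod
    using N.sigma_finite_measure_axioms lborel.sigma_finite_measure_axioms by simp
  let ?P = "lborel \<Otimes>\<^sub>M lborel :: (real \<times> real) measure"
  have [measurable]: "f \<in> borel_measurable borel" using f by simp
  let ?g = "\<lambda>p. f (fst p) * f (snd p)"
  let ?h = "\<lambda>\<eta> p. ?g p * cos (R * \<eta> * (fst p - snd p))"
  let ?K = "\<lambda>p::real\<times>real. exp (- (R * (fst p - snd p))\<^sup>2 / 2)"
  have g: "integrable ?P ?g" by (rule lborel_pair.integral_tensor(1)[OF f f])
  have "integrable (std_normal_distribution \<Otimes>\<^sub>M ?P) (\<lambda>q. 1 * ?g (snd q))"
    by (rule P.integral_tensor(1)[OF _ g]) simp
  then have h: "integrable (std_normal_distribution \<Otimes>\<^sub>M ?P) (case_prod ?h)"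
    by (rule Bochner_Integration.integrable_bound) (auto simp: abs_mult case_prod_unfold intro!: mult_left_le)
  have swap: "(LINT p|?P. LINT \<eta>|std_normal_distribution. ?h \<eta> p) = (LINT \<eta>|std_normal_distribution. LINT p|?P. ?h \<eta> p)"
    by (rule P.Fubini_integral[OF h])
  have inner: "(LINT \<eta>|std_normal_distribution. ?h \<eta> p) = ?g p * ?K p" for p
  proof -
    have "(LINT \<eta>|std_normal_distribution. ?h \<eta> p) = ?g p * (LINT \<eta>|std_normal_distribution. cos (\<eta> * (R * (fst p - snd p))))"
      by (subst integral_mult_right_zero[symmetric]) (simp add: mult.assoc mult.left_commute)
    then show ?thesis by (simp only: integral_cos_std_normal)
  qed
  have slice: "(\<integral>\<^sup>+r. ennreal ((f s)\<^sup>2 / 2) * ennreal (exp (- (R * (s - r))\<^sup>2 / 2)) \<partial>lborel)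
      = ennreal ((f s)\<^sup>2 / 2) * ennreal (sqrt (2 * pi) / R)" for s
    by (subst nn_integral_cmult) (simp_all only: nn_integral_gaussian[OF R], measurable)
  have int: "integrable std_normal_distribution (\<lambda>\<eta>. LINT p|?P. ?h \<eta> p)"
    by (rule P.integrable_fst[OF h])
  have "(\<integral>\<^sup>+\<eta>. ennreal ((cmod (fourier f (R * \<eta>)))\<^sup>2) \<partial>std_normal_distribution)
      = ennreal (LINT \<eta>|std_normal_distribution. LINT p|?P. ?h \<eta> p)"
    unfolding norm_fourier_power2[OF f]
    by (rule nn_integral_eq_integral[OF int]) (simp add: norm_fourier_power2[OF f, symmetric])
  also have "(LINT \<eta>|std_normal_distribution. LINT p|?P. ?h \<eta> p) = (LINT p|?P. ?g p * ?K p)"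
    unfolding swap[symmetric] inner ..
  also have "ennreal \<dots> \<le> ennreal (LINT p|?P. norm (?g p * ?K p))"
    by (intro ennreal_leI order.trans[OF _ integral_norm_bound]) simp
  also have "\<dots> = (\<integral>\<^sup>+p. ennreal (norm (?g p * ?K p)) \<partial>?P)"
  proof (rule nn_integral_eq_integral[symmetric])
    have "integrable ?P (\<lambda>p. ?g p * ?K p)"
      by (rule Bochner_Integration.integrable_bound[OF g]) (auto simp: abs_mult intro!: mult_left_le)
    then show "integrable ?P (\<lambda>p. norm (?g p * ?K p))" by (rule integrable_norm)
  qed simp
  also have "\<dots> \<le> (\<integral>\<^sup>+p. ennreal ((f (fst p))\<^sup>2 / 2) * ennreal (?K p) + ennreal ((f (snd p))\<^sup>2 / 2) * ennreal (?K p) \<partial>?P)"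
  proof (rule nn_integral_mono)
    fix p
    have "\<bar>?g p\<bar> \<le> (f (fst p))\<^sup>2 / 2 + (f (snd p))\<^sup>2 / 2"
      using sum_squares_bound[of "\<bar>f (fst p)\<bar>" "\<bar>f (snd p)\<bar>"] by (simp add: abs_mult)
    from mult_right_mono[OF this, of "?K p"]
    have "norm (?g p * ?K p) \<le> (f (fst p))\<^sup>2 / 2 * ?K p + (f (snd p))\<^sup>2 / 2 * ?K p"
      by (simp add: abs_mult distrib_right)
    then have "ennreal (norm (?g p * ?K p)) \<le> ennreal ((f (fst p))\<^sup>2 / 2 * ?K p + (f (snd p))\<^sup>2 / 2 * ?K p)"
      by (rule ennreal_leI)
    also have "\<dots> = ennreal ((f (fst p))\<^sup>2 / 2 * ?K p) + ennreal ((f (snd p))\<^sup>2 / 2 * ?K p)"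
      by (rule ennreal_plus) auto
    also have "ennreal ((f (fst p))\<^sup>2 / 2 * ?K p) = ennreal ((f (fst p))\<^sup>2 / 2) * ennreal (?K p)"
      by (rule ennreal_mult) auto
    also have "ennreal ((f (snd p))\<^sup>2 / 2 * ?K p) = ennreal ((f (snd p))\<^sup>2 / 2) * ennreal (?K p)"
      by (rule ennreal_mult) auto
    finally show "ennreal (norm (?g p * ?K p)) \<le> ennreal ((f (fst p))\<^sup>2 / 2) * ennreal (?K p) + ennreal ((f (snd p))\<^sup>2 / 2) * ennreal (?K p)" .
  qed
  also have "\<dots> = (\<integral>\<^sup>+p. ennreal ((f (fst p))\<^sup>2 / 2) * ennreal (?K p) \<partial>?P) + (\<integral>\<^sup>+p. ennreal ((f (snd p))\<^sup>2 / 2) * ennreal (?K p) \<partial>?P)"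
    by (rule nn_integral_add) auto
  also have "(\<integral>\<^sup>+p. ennreal ((f (fst p))\<^sup>2 / 2) * ennreal (?K p) \<partial>?P)
     = (\<integral>\<^sup>+s. \<integral>\<^sup>+r. ennreal ((f s)\<^sup>2 / 2) * ennreal (exp (- (R * (s - r))\<^sup>2 / 2)) \<partial>lborel \<partial>lborel)"
    by (subst lborel.nn_integral_fst[symmetric]) auto
  also have "\<dots> = (\<integral>\<^sup>+s. ennreal ((f s)\<^sup>2 / 2) * ennreal (sqrt (2 * pi) / R) \<partial>lborel)"
    by (simp only: slice)
  also have "(\<integral>\<^sup>+p. ennreal ((f (snd p))\<^sup>2 / 2) * ennreal (?K p) \<partial>?P)
     = (\<integral>\<^sup>+r. \<integral>\<^sup>+s. ennreal ((f r)\<^sup>2 / 2) * ennreal (exp (- (R * (s - r))\<^sup>2 / 2)) \<partial>lborel \<partial>lborel)"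
    by (subst lborel_pair.nn_integral_snd[symmetric]) (auto simp: case_prod_unfold)
  also have "(\<lambda>r s. ennreal ((f r)\<^sup>2 / 2) * ennreal (exp (- (R * (s - r))\<^sup>2 / 2)))
     = (\<lambda>r s. ennreal ((f r)\<^sup>2 / 2) * ennreal (exp (- (R * (r - s))\<^sup>2 / 2)))"
    by (simp add: power_mult_distrib power2_commute)
  also have "(\<integral>\<^sup>+r. \<integral>\<^sup>+s. ennreal ((f r)\<^sup>2 / 2) * ennreal (exp (- (R * (r - s))\<^sup>2 / 2)) \<partial>lborel \<partial>lborel)
     = (\<integral>\<^sup>+s. ennreal ((f s)\<^sup>2 / 2) * ennreal (sqrt (2 * pi) / R) \<partial>lborel)"
    by (simp only: slice)
  also have "(\<integral>\<^sup>+s. ennreal ((f s)\<^sup>2 / 2) * ennreal (sqrt (2 * pi) / R) \<partial>lborel)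
      + (\<integral>\<^sup>+s. ennreal ((f s)\<^sup>2 / 2) * ennreal (sqrt (2 * pi) / R) \<partial>lborel)
      = (\<integral>\<^sup>+s. ennreal ((f s)\<^sup>2 / 2) * ennreal (sqrt (2 * pi) / R) + ennreal ((f s)\<^sup>2 / 2) * ennreal (sqrt (2 * pi) / R) \<partial>lborel)"
    by (rule nn_integral_add[symmetric]) auto
  also have "\<dots> = (\<integral>\<^sup>+s. ennreal (sqrt (2 * pi) / R) * ennreal ((f s)\<^sup>2) \<partial>lborel)"
  proof (intro nn_integral_cong)
    fix s
    have "ennreal ((f s)\<^sup>2) = ennreal ((f s)\<^sup>2 / 2) + ennreal ((f s)\<^sup>2 / 2)"
      by (subst ennreal_plus[symmetric]) auto
    then show "ennreal ((f s)\<^sup>2 / 2) * ennreal (sqrt (2 * pi) / R) + ennreal ((f s)\<^sup>2 / 2) * ennreal (sqrt (2 * pi) / R)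
      = ennreal (sqrt (2 * pi) / R) * ennreal ((f s)\<^sup>2)"
      by (simp add: distrib_left distrib_right mult.commute)
  qed
  also have "\<dots> = ennreal (sqrt (2 * pi) / R) * (\<integral>\<^sup>+s. ennreal ((f s)\<^sup>2) \<partial>lborel)"
    by (rule nn_integral_cmult) auto
  finally show ?thesis .
qed

lemma fourier_measurable [measurable]:
  assumes "integrable lborel f" shows "fourier f \<in> borel_measurable borel"
proof -
  have [measurable]: "f \<in> borel_measurable borel" using assms by simp
  have "(\<lambda>\<xi>. LINT s|lborel. complex_of_real (f s) * exp (\<i> * complex_of_real (- (\<xi> * s)))) \<in> borel_measurable borel"
    by measurable
  then show ?thesis unfolding fourier_def[abs_def] cis_conv_exp .
qed

text \<open>Half of Plancherel's theorem, with a constant that is not optimal. On \<open>[-1,1]\<close> the normal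
density is at least \<open>e\<^bsup>-1/2\<^esup> / \<surd>(2\<pi>)\<close>, so that the Gaussian average at scale \<open>R\<close> dominates the
integral over \<open>[-R,R]\<close>.\<close>

lemma fourier_square_integral_le:
  assumes f: "integrable lborel f" and R: "0 < R"
  shows "(\<integral>\<^sup>+\<xi>\<in>{-R..R}. ennreal ((cmod (fourier f \<xi>))\<^sup>2) \<partial>lborel)
     \<le> ennreal (2 * pi * exp (1 / 2)) * (\<integral>\<^sup>+s. ennreal ((f s)\<^sup>2) \<partial>lborel)"
proof -
  have [measurable]: "fourier f \<in> borel_measurable borel" by (rule fourier_measurable[OF f])
  let ?F = "\<lambda>\<xi>. ennreal ((cmod (fourier f \<xi>))\<^sup>2)"
  let ?c = "sqrt (2 * pi) * exp (1 / 2)"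
  have "(\<integral>\<^sup>+\<xi>\<in>{-R..R}. ?F \<xi> \<partial>lborel) = ennreal \<bar>R\<bar> * (\<integral>\<^sup>+\<eta>. ?F (0 + R * \<eta>) * indicator {-R..R} (0 + R * \<eta>) \<partial>lborel)"
    using R by (intro nn_integral_real_affine) auto
  also have "\<dots> \<le> ennreal R * (\<integral>\<^sup>+\<eta>. ennreal ?c * (ennreal (std_normal_density \<eta>) * ?F (R * \<eta>)) \<partial>lborel)"
  proof -
    have "?F (0 + R * \<eta>) * indicator {-R..R} (0 + R * \<eta>) \<le> ennreal ?c * (ennreal (std_normal_density \<eta>) * ?F (R * \<eta>))" for \<eta>
    proof (cases "R * \<eta> \<in> {-R..R}")
      case True
      then have "\<bar>R * \<eta>\<bar> \<le> R" by auto
      then have "\<bar>\<eta>\<bar> \<le> 1" using R by (simp add: abs_mult)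
      then have "\<eta>\<^sup>2 \<le> 1" by (simp add: abs_square_le_1)
      then have "1 \<le> exp (1 / 2) * exp (- \<eta>\<^sup>2 / 2)" by (simp add: exp_add[symmetric])
      also have "\<dots> = ?c * std_normal_density \<eta>" by (simp add: std_normal_density_def)
      finally have "ennreal 1 \<le> ennreal (?c * std_normal_density \<eta>)" by (rule ennreal_leI)
      then have "1 \<le> ennreal ?c * ennreal (std_normal_density \<eta>)" by (simp add: ennreal_mult')
      from mult_right_mono[OF this, of "?F (R * \<eta>)"] True show ?thesis by (simp add: mult.assoc)
    qed simp
    then show ?thesis unfolding abs_of_pos[OF R] by (intro mult_left_mono nn_integral_mono) auto
  qed
  also have "\<dots> = ennreal R * (ennreal ?c * (\<integral>\<^sup>+\<eta>. ?F (R * \<eta>) \<partial>std_normal_distribution))"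
    by (simp add: nn_integral_cmult nn_integral_density)
  also have "\<dots> \<le> ennreal R * (ennreal ?c * (ennreal (sqrt (2 * pi) / R) * (\<integral>\<^sup>+s. ennreal ((f s)\<^sup>2) \<partial>lborel)))"
    by (intro mult_left_mono gaussian_average_fourier f R) auto
  also have "\<dots> = (ennreal R * ennreal ?c * ennreal (sqrt (2 * pi) / R)) * (\<integral>\<^sup>+s. ennreal ((f s)\<^sup>2) \<partial>lborel)"
    by (simp only: mult.assoc)
  also have "ennreal R * ennreal ?c * ennreal (sqrt (2 * pi) / R) = ennreal (R * ?c * (sqrt (2 * pi) / R))"
  proof -
    have "ennreal (R * ?c * (sqrt (2 * pi) / R)) = ennreal (R * ?c) * ennreal (sqrt (2 * pi) / R)"
      by (rule ennreal_mult) (use R in auto)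
    moreover have "ennreal (R * ?c) = ennreal R * ennreal ?c"
      by (rule ennreal_mult) (use R in auto)
    ultimately show ?thesis by simp
  qed
  also have "R * ?c * (sqrt (2 * pi) / R) = 2 * pi * exp (1 / 2)"
  proof -
    have "sqrt (2 * pi) * sqrt (2 * pi) = 2 * pi" by simp
    then show ?thesis using R by (simp add: field_simps)
  qed
  finally show ?thesis .
qed

section \<open>Averaging Fourier tails over the parameter\<close>

lemma tail_eq_fourier:
  assumes v: "locally_bounded v" and t: "0 \<le> t" "t \<le> T"
  shows "tail v T \<xi> t = fourier (\<lambda>s. if t \<le> s \<and> s \<le> T then v s else 0) \<xi>"
proof -
  let ?w = "\<lambda>s. complex_of_real (v s) * cis (- (\<xi> * s))"
  note w = locally_bounded_wave[OF v, of \<xi>]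
  have "tail v T \<xi> t = integral {t..T} ?w"
    using primitive_diff[OF primitive_integral[OF w, of 0] t] by (simp add: tail_def)
  also have "\<dots> = (LINT s:{t..T}|lborel. ?w s)"
    using set_borel_integral_eq_integral(2)[OF locally_bounded_set_integrable[OF w t(1)]] by simp
  also have "\<dots> = fourier (\<lambda>s. if t \<le> s \<and> s \<le> T then v s else 0) \<xi>"
    unfolding set_lebesgue_integral_def fourier_def
    by (intro Bochner_Integration.integral_cong) (auto simp: indicator_def)
  finally show ?thesis .
qed

lemma truncation_integrable:
  assumes v: "locally_bounded v" and t: "0 \<le> t"
  shows "integrable lborel (\<lambda>s. if t \<le> s \<and> s \<le> T then v s else 0)"
proof -
  have "(\<lambda>s. if t \<le> s \<and> s \<le> T then v s else 0) = (\<lambda>s. indicator {t..T} s *\<^sub>R v s)"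
    by (auto simp: indicator_def)
  then show ?thesis using locally_bounded_set_integrable[OF v t, of T] by (simp add: set_integrable_def)
qed

lemma tail_square_integral_le:
  assumes v: "locally_bounded v" and t: "0 \<le> t" "t \<le> T" and R: "0 < R"
  shows "(\<integral>\<^sup>+\<xi>\<in>{-R..R}. ennreal ((cmod (tail v T \<xi> t))\<^sup>2) \<partial>lborel)
     \<le> ennreal (2 * pi * exp (1 / 2)) * (\<integral>\<^sup>+s\<in>{t..T}. ennreal ((v s)\<^sup>2) \<partial>lborel)"
proof -
  have "(\<integral>\<^sup>+\<xi>\<in>{-R..R}. ennreal ((cmod (tail v T \<xi> t))\<^sup>2) \<partial>lborel)
     \<le> ennreal (2 * pi * exp (1 / 2)) * (\<integral>\<^sup>+s. ennreal ((if t \<le> s \<and> s \<le> T then v s else 0)\<^sup>2) \<partial>lborel)"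
    unfolding tail_eq_fourier[OF v t] by (rule fourier_square_integral_le[OF truncation_integrable[OF v t(1)] R])
  also have "(\<integral>\<^sup>+s. ennreal ((if t \<le> s \<and> s \<le> T then v s else 0)\<^sup>2) \<partial>lborel) = (\<integral>\<^sup>+s\<in>{t..T}. ennreal ((v s)\<^sup>2) \<partial>lborel)"
    by (intro nn_integral_cong) (auto simp: indicator_def)
  finally show ?thesis .
qed

text \<open>With step \<open>2\<close>, because only odd frequencies \<open>2n + 1\<close> occur.\<close>

lemma powr_telescope:
  fixes m :: real
  assumes m: "m \<ge> 1" and \<epsilon>: "\<epsilon> > 0"
  shows "(m + 2) powr (-1 - \<epsilon>) \<le> (m powr - \<epsilon> - (m + 2) powr - \<epsilon>) / \<epsilon>"
proof -
  have "1 + \<epsilon> * (1 / (m + 2)) \<le> 1 + \<epsilon> * (1 - m / (m + 2))"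
    using m \<epsilon> by (intro add_left_mono mult_left_mono) (auto simp: field_simps)
  also have "\<dots> \<le> 1 + - \<epsilon> * ln (m / (m + 2))"
  proof -
    have "ln (m / (m + 2)) \<le> m / (m + 2) - 1" using m by (intro ln_le_minus_one) auto
    then show ?thesis using mult_left_mono[of "ln (m / (m + 2))" "m / (m + 2) - 1" \<epsilon>] \<epsilon> by (simp add: algebra_simps)
  qed
  also have "\<dots> \<le> exp (- \<epsilon> * ln (m / (m + 2)))" by (rule exp_ge_add_one_self)
  also have "\<dots> = (m / (m + 2)) powr - \<epsilon>" using m by (simp add: powr_def)
  also have "\<dots> = m powr - \<epsilon> / (m + 2) powr - \<epsilon>" using m by (simp add: powr_divide)
  finally have "(1 + \<epsilon> * (1 / (m + 2))) * (m + 2) powr - \<epsilon> \<le> m powr - \<epsilon>"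
    using m by (simp add: pos_le_divide_eq)
  moreover have "(m + 2) powr (-1 - \<epsilon>) = (m + 2) powr - \<epsilon> * (1 / (m + 2))"
  proof -
    have "(m + 2) powr (-1 - \<epsilon>) = (m + 2) powr (- \<epsilon> + -1)" by (simp add: algebra_simps)
    also have "\<dots> = (m + 2) powr - \<epsilon> * (m + 2) powr -1" by (rule powr_add)
    also have "(m + 2) powr -1 = 1 / (m + 2)" using m by (simp add: powr_minus_divide)
    finally show ?thesis .
  qed
  ultimately have "\<epsilon> * (m + 2) powr (-1 - \<epsilon>) \<le> m powr - \<epsilon> - (m + 2) powr - \<epsilon>"
    by (simp add: algebra_simps)
  then show ?thesis using \<epsilon> by (simp add: pos_le_divide_eq mult.commute)
qed

lemma powr_ratio_le_1:
  fixes y m :: real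
  assumes "0 \<le> y" "y \<le> m" "0 < m" "0 < \<epsilon>" shows "y powr \<epsilon> * m powr - \<epsilon> \<le> 1"
proof -
  have "y powr \<epsilon> * m powr - \<epsilon> \<le> m powr \<epsilon> * m powr - \<epsilon>"
    using assms by (intro mult_right_mono powr_mono2) auto
  also have "\<dots> = 1" using assms by (simp add: powr_add[symmetric])
  finally show ?thesis .
qed

text \<open>The sum of \<open>m\<^bsup>-1-\<epsilon>\<^esup>\<close> over \<open>m \<ge> y\<close> is of order \<open>y\<^bsup>-\<epsilon>\<^esup>\<close>. In the induction, the telescoping bound
starts at the first odd number above \<open>y\<close>.\<close>

lemma sum_odd_powr_le:
  fixes y :: real
  assumes y: "0 \<le> y" and \<epsilon>: "0 < \<epsilon>"
  shows "(\<Sum>n<N. if y \<le> 2 * real n + 1 then y powr \<epsilon> * (2 * real n + 1) powr (-1 - \<epsilon>) else 0) \<le> 1 + 1 / \<epsilon>"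
proof -
  let ?t = "\<lambda>n::nat. if y \<le> 2 * real n + 1 then y powr \<epsilon> * (2 * real n + 1) powr (-1 - \<epsilon>) else 0"
  let ?b = "\<lambda>n::nat. if y \<le> 2 * real n + 1 then 1 + 1 / \<epsilon> - y powr \<epsilon> * (2 * real n + 1) powr - \<epsilon> / \<epsilon> else 0"
  have first: "y powr \<epsilon> * m powr (-1 - \<epsilon>) \<le> 1 + 1 / \<epsilon> - y powr \<epsilon> * m powr - \<epsilon> / \<epsilon>" if "y \<le> m" "1 \<le> m" for m
  proof -
    have "m powr (-1 - \<epsilon>) \<le> m powr - \<epsilon>" using that by (intro powr_mono) auto
    then have "y powr \<epsilon> * m powr (-1 - \<epsilon>) \<le> y powr \<epsilon> * m powr - \<epsilon>" by (intro mult_left_mono) auto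
    moreover have r: "y powr \<epsilon> * m powr - \<epsilon> \<le> 1" using that y \<epsilon> by (intro powr_ratio_le_1) auto
    moreover have "y powr \<epsilon> * m powr - \<epsilon> / \<epsilon> \<le> 1 / \<epsilon>" using r \<epsilon> by (intro divide_right_mono) auto
    ultimately show ?thesis by linarith
  qed
  have "(\<Sum>n<Suc N. ?t n) \<le> ?b N" for N
  proof (induction N)
    case 0
    show ?case using first[of 1] by auto
  next
    case (Suc N)
    let ?m = "2 * real N + 1"
    have m2: "2 * real (Suc N) + 1 = ?m + 2" by simp
    show ?case
    proof (cases "y \<le> ?m")
      case True
      have "y powr \<epsilon> * (?m + 2) powr (-1 - \<epsilon>) \<le> y powr \<epsilon> * ((?m powr - \<epsilon> - (?m + 2) powr - \<epsilon>) / \<epsilon>)"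
        using \<epsilon> by (intro mult_left_mono powr_telescope) auto
      then show ?thesis using Suc.IH True unfolding sum.lessThan_Suc[of _ "Suc N"] m2
        by (simp add: diff_divide_distrib right_diff_distrib)
    next
      case False
      then show ?thesis using Suc.IH first[of "?m + 2"] unfolding sum.lessThan_Suc[of _ "Suc N"] m2 by auto
    qed
  qed
  moreover have "?b N \<le> 1 + 1 / \<epsilon>" for N using \<epsilon> by auto
  ultimately have "(\<Sum>n<Suc N. ?t n) \<le> 1 + 1 / \<epsilon>" by (rule order.trans)
  moreover have "(\<Sum>n<N. ?t n) \<le> (\<Sum>n<Suc N. ?t n)" by simp
  ultimately show ?thesis by linarith
qed

lemma tail_measurable:
  assumes v: "locally_bounded v" and t: "0 \<le> t" "t \<le> T" shows "(\<lambda>\<xi>. tail v T \<xi> t) \<in> borel_measurable borel"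
  unfolding tail_eq_fourier[OF v t] by (intro fourier_measurable truncation_integrable v t)

text \<open>Substituting \<open>\<xi> = (2n + 1) k\<close> in the \<open>n\<close>-th summand turns all of them into integrals of
the same function \<open>|W(\<xi>)|\<^sup>2\<close>, where \<open>\<xi>\<close> receives the weights of those \<open>n\<close> with
\<open>2n + 1 \<ge> |\<xi>| / R\<close>. Without the factor \<open>|k|\<^sup>\<epsilon>\<close> these weights would be \<open>1 / (2n + 1)\<close>, and their
sum would diverge logarithmically with \<open>N\<close>.\<close>

lemma tail_size_weighted_integral_le:
  assumes v: "locally_bounded v" and t: "0 \<le> t" "t \<le> T" and R: "0 < R" and \<epsilon>: "0 < \<epsilon>"
  shows "(\<integral>\<^sup>+k\<in>{-R..R}. ennreal (\<bar>k\<bar> powr \<epsilon> * (tail_size v N T k t)\<^sup>2) \<partial>lborel)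
     \<le> ennreal (R powr \<epsilon> * (1 + 1 / \<epsilon>) * (2 * pi * exp (1 / 2))) * (\<integral>\<^sup>+s\<in>{t..T}. ennreal ((v s)\<^sup>2) \<partial>lborel)"
proof -
  let ?F = "\<lambda>\<xi>. (cmod (tail v T \<xi> t))\<^sup>2"
  let ?m = "\<lambda>n::nat. 2 * real n + 1"
  let ?R = "(2 * real N + 1) * R"
  let ?w = "\<lambda>n \<xi>. if \<bar>\<xi>\<bar> \<le> ?m n * R then ?m n powr (-1 - \<epsilon>) * \<bar>\<xi>\<bar> powr \<epsilon> else 0"
  note [measurable] = tail_measurable[OF v t]
  have one: "(\<integral>\<^sup>+k. ennreal (\<bar>k\<bar> powr \<epsilon> * ?F (k * ?m n)) * indicator {-R..R} k \<partial>lborel)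
      = (\<integral>\<^sup>+\<xi>. ennreal (?w n \<xi> * ?F \<xi>) \<partial>lborel)" for n
  proof -
    let ?c = "1 / ?m n"
    have m: "0 < ?m n" by simp
    have "(\<integral>\<^sup>+k. ennreal (\<bar>k\<bar> powr \<epsilon> * ?F (k * ?m n)) * indicator {-R..R} k \<partial>lborel)
       = ennreal \<bar>?c\<bar> * (\<integral>\<^sup>+\<xi>. ennreal (\<bar>0 + ?c * \<xi>\<bar> powr \<epsilon> * ?F ((0 + ?c * \<xi>) * ?m n)) * indicator {-R..R} (0 + ?c * \<xi>) \<partial>lborel)"
      using m by (intro nn_integral_real_affine) auto
    also have "\<dots> = (\<integral>\<^sup>+\<xi>. ennreal \<bar>?c\<bar> * (ennreal (\<bar>0 + ?c * \<xi>\<bar> powr \<epsilon> * ?F ((0 + ?c * \<xi>) * ?m n)) * indicator {-R..R} (0 + ?c * \<xi>)) \<partial>lborel)"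
      by (rule nn_integral_cmult[symmetric]) measurable
    also have "\<dots> = (\<integral>\<^sup>+\<xi>. ennreal (?w n \<xi> * ?F \<xi>) \<partial>lborel)"
    proof (intro nn_integral_cong)
      fix \<xi> :: real
      have x: "(0 + ?c * \<xi>) * ?m n = \<xi>" using m by simp
      have in_iff: "0 + ?c * \<xi> \<in> {-R..R} \<longleftrightarrow> \<bar>\<xi>\<bar> \<le> ?m n * R"
        using m by (auto simp: abs_le_iff divide_le_eq minus_divide_left le_divide_eq mult.commute)
      have "?c * \<bar>0 + ?c * \<xi>\<bar> powr \<epsilon> = ?m n powr (-1 - \<epsilon>) * \<bar>\<xi>\<bar> powr \<epsilon>"
      proof -
        have "\<bar>0 + ?c * \<xi>\<bar> = \<bar>\<xi>\<bar> / ?m n" using m by (simp add: abs_mult)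
        then have "\<bar>0 + ?c * \<xi>\<bar> powr \<epsilon> = \<bar>\<xi>\<bar> powr \<epsilon> / ?m n powr \<epsilon>" using m by (simp add: powr_divide)
        moreover have "?m n powr (-1 - \<epsilon>) = ?c / ?m n powr \<epsilon>"
          using m by (simp add: powr_diff powr_minus_divide)
        ultimately show ?thesis by simp
      qed
      then have "?c * (\<bar>0 + ?c * \<xi>\<bar> powr \<epsilon> * ?F \<xi>) = ?m n powr (-1 - \<epsilon>) * \<bar>\<xi>\<bar> powr \<epsilon> * ?F \<xi>"
        by (simp only: mult.assoc[symmetric])
      moreover have "ennreal \<bar>?c\<bar> * ennreal (\<bar>0 + ?c * \<xi>\<bar> powr \<epsilon> * ?F \<xi>) = ennreal (?c * (\<bar>0 + ?c * \<xi>\<bar> powr \<epsilon> * ?F \<xi>))"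
        using m by (subst ennreal_mult) auto
      ultimately show "ennreal \<bar>?c\<bar> * (ennreal (\<bar>0 + ?c * \<xi>\<bar> powr \<epsilon> * ?F ((0 + ?c * \<xi>) * ?m n)) * indicator {-R..R} (0 + ?c * \<xi>))
          = ennreal (?w n \<xi> * ?F \<xi>)"
        unfolding x indicator_def in_iff by simp
    qed
    finally show ?thesis .
  qed
  have "(\<integral>\<^sup>+k\<in>{-R..R}. ennreal (\<bar>k\<bar> powr \<epsilon> * (tail_size v N T k t)\<^sup>2) \<partial>lborel)
     = (\<integral>\<^sup>+k. (\<Sum>n<N. ennreal (\<bar>k\<bar> powr \<epsilon> * ?F (k * ?m n)) * indicator {-R..R} k) \<partial>lborel)"
  proof (intro nn_integral_cong)
    fix k
    have "(tail_size v N T k t)\<^sup>2 = (\<Sum>n<N. ?F (k * ?m n))"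
      unfolding tail_size_def by (simp add: sum_nonneg)
    then show "ennreal (\<bar>k\<bar> powr \<epsilon> * (tail_size v N T k t)\<^sup>2) * indicator {-R..R} k
        = (\<Sum>n<N. ennreal (\<bar>k\<bar> powr \<epsilon> * ?F (k * ?m n)) * indicator {-R..R} k)"
      by (simp add: sum_distrib_left sum_distrib_right[symmetric] sum_ennreal)
  qed
  also have "\<dots> = (\<Sum>n<N. \<integral>\<^sup>+k. ennreal (\<bar>k\<bar> powr \<epsilon> * ?F (k * ?m n)) * indicator {-R..R} k \<partial>lborel)"
    by (rule nn_integral_sum) measurable
  also have "\<dots> = (\<Sum>n<N. \<integral>\<^sup>+\<xi>. ennreal (?w n \<xi> * ?F \<xi>) \<partial>lborel)"
    by (simp only: one)
  also have "\<dots> = (\<integral>\<^sup>+\<xi>. (\<Sum>n<N. ennreal (?w n \<xi> * ?F \<xi>)) \<partial>lborel)"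
    by (rule nn_integral_sum[symmetric]) measurable
  also have "\<dots> \<le> (\<integral>\<^sup>+\<xi>. ennreal (R powr \<epsilon> * (1 + 1 / \<epsilon>)) * (ennreal (?F \<xi>) * indicator {-?R..?R} \<xi>) \<partial>lborel)"
  proof (rule nn_integral_mono)
    fix \<xi> :: real
    have eq: "(\<Sum>n<N. ennreal (?w n \<xi> * ?F \<xi>)) = ennreal ((\<Sum>n<N. ?w n \<xi>) * ?F \<xi>)"
      by (subst sum_ennreal) (auto simp: sum_distrib_right)
    show "(\<Sum>n<N. ennreal (?w n \<xi> * ?F \<xi>)) \<le> ennreal (R powr \<epsilon> * (1 + 1 / \<epsilon>)) * (ennreal (?F \<xi>) * indicator {-?R..?R} \<xi>)"
    proof (cases "\<xi> \<in> {-?R..?R}")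
      case True
      have "(\<Sum>n<N. ?w n \<xi>) = R powr \<epsilon> * (\<Sum>n<N. if \<bar>\<xi>\<bar> / R \<le> ?m n then (\<bar>\<xi>\<bar> / R) powr \<epsilon> * ?m n powr (-1 - \<epsilon>) else 0)"
        unfolding sum_distrib_left
        using R by (intro sum.cong refl) (auto simp: pos_divide_le_eq powr_divide)
      also have "\<dots> \<le> R powr \<epsilon> * (1 + 1 / \<epsilon>)"
        using R \<epsilon> by (intro mult_left_mono sum_odd_powr_le) auto
      finally have "(\<Sum>n<N. ?w n \<xi>) * ?F \<xi> \<le> R powr \<epsilon> * (1 + 1 / \<epsilon>) * ?F \<xi>" by (intro mult_right_mono) auto
      then have "ennreal ((\<Sum>n<N. ?w n \<xi>) * ?F \<xi>) \<le> ennreal (R powr \<epsilon> * (1 + 1 / \<epsilon>) * ?F \<xi>)" by (rule ennreal_leI)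
      also have "\<dots> = ennreal (R powr \<epsilon> * (1 + 1 / \<epsilon>)) * ennreal (?F \<xi>)" using \<epsilon> by (intro ennreal_mult) auto
      finally show ?thesis unfolding eq using True by simp
    next
      case False
      have "?w n \<xi> = 0" if "n < N" for n
      proof -
        have "?m n * R \<le> ?R" using that R by (intro mult_right_mono) auto
        moreover have "?R < \<bar>\<xi>\<bar>" using False by auto
        ultimately show ?thesis by auto
      qed
      then show ?thesis by simp
    qed
  qed
  also have "\<dots> = ennreal (R powr \<epsilon> * (1 + 1 / \<epsilon>)) * (\<integral>\<^sup>+\<xi>\<in>{-?R..?R}. ennreal (?F \<xi>) \<partial>lborel)"
    by (rule nn_integral_cmult) measurable
  also have "\<dots> \<le> ennreal (R powr \<epsilon> * (1 + 1 / \<epsilon>)) * (ennreal (2 * pi * exp (1 / 2)) * (\<integral>\<^sup>+s\<in>{t..T}. ennreal ((v s)\<^sup>2) \<partial>lborel))"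
    using R by (intro mult_left_mono tail_square_integral_le v t) auto
  also have "\<dots> = ennreal (R powr \<epsilon> * (1 + 1 / \<epsilon>) * (2 * pi * exp (1 / 2))) * (\<integral>\<^sup>+s\<in>{t..T}. ennreal ((v s)\<^sup>2) \<partial>lborel)"
    using \<epsilon> by (subst ennreal_mult) (auto simp: mult.assoc)
  finally show ?thesis .
qed

lemma nn_integral_powr_tail:
  fixes a e :: real
  assumes "e < -1" "0 < a"
  shows "(\<integral>\<^sup>+s\<in>{a..}. ennreal (s powr e) \<partial>lborel) = ennreal (a powr (e + 1) / - (e + 1))"
proof -
  have "(\<integral>\<^sup>+s\<in>{a..}. ennreal (s powr e) \<partial>lborel) = ennreal (- (a powr (e + 1)) / (e + 1))"
    by (rule nn_integral_has_integral_lebesgue'[OF _ has_integral_powr_to_inf[OF assms]]) auto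
  moreover have "- (a powr (e + 1)) / (e + 1) = a powr (e + 1) / - (e + 1)"
    by (metis minus_divide_left minus_divide_right)
  ultimately show ?thesis by simp
qed

text \<open>The second decay condition follows from the first one for large \<open>t\<close>; it adds that \<open>v\<close> is
less singular than \<open>t\<^bsup>-3/4\<^esup>\<close> near \<open>0\<close>. At \<open>t = 0\<close> both force \<open>v(0) = 0\<close>, as \<open>0\<close> to a negative
power is \<open>0\<close>.\<close>

locale decaying_potential =
  fixes v :: "real \<Rightarrow> real" and C \<epsilon> :: real
  assumes v: "locally_bounded v" and C: "0 \<le> C" and \<epsilon>: "0 < \<epsilon>"
    and decay: "0 \<le> t \<Longrightarrow> \<bar>v t\<bar> \<le> C * t powr (- (3 / 4 + \<epsilon>))"
    and decay': "0 \<le> t \<Longrightarrow> \<bar>v t\<bar> \<le> C * t powr (- (3 / 4))"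
begin

text \<open>The quantity through which the tails enter the final bound. It is measurable in \<open>k\<close>, and
its integral is bounded independently of \<open>N\<close> and \<open>T\<close>.\<close>

definition far_mass :: "real \<Rightarrow> nat \<Rightarrow> real \<Rightarrow> real \<Rightarrow> ennreal" where
  "far_mass R N T k = (\<integral>\<^sup>+t\<in>{1 / R..T}. ennreal (t powr (- (1 / 2)) * (\<bar>k\<bar> powr \<epsilon> * (tail_size v N T k t)\<^sup>2)) \<partial>lborel)"

lemma square_tail_le:
  assumes "0 < t"
  shows "(\<integral>\<^sup>+s\<in>{t..T}. ennreal ((v s)\<^sup>2) \<partial>lborel) \<le> ennreal (2 * C\<^sup>2 * t powr (- (1 / 2) - 2 * \<epsilon>))"
proof -
  have "(\<integral>\<^sup>+s\<in>{t..T}. ennreal ((v s)\<^sup>2) \<partial>lborel)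
      \<le> (\<integral>\<^sup>+s. ennreal (C\<^sup>2) * (ennreal (s powr (- (3 / 2) - 2 * \<epsilon>)) * indicator {t..} s) \<partial>lborel)"
  proof (rule nn_integral_mono)
    fix s
    show "ennreal ((v s)\<^sup>2) * indicator {t..T} s \<le> ennreal (C\<^sup>2) * (ennreal (s powr (- (3 / 2) - 2 * \<epsilon>)) * indicator {t..} s)"
    proof (cases "s \<in> {t..T}")
      case True
      then have s: "0 < s" using assms by auto
      have "\<bar>v s\<bar>\<^sup>2 \<le> (C * s powr (- (3 / 4 + \<epsilon>)))\<^sup>2"
        using s decay[of s] by (intro power_mono) auto
      also have "\<dots> = C\<^sup>2 * (s powr (- (3 / 4 + \<epsilon>)) * s powr (- (3 / 4 + \<epsilon>)))"
        by (simp add: power_mult_distrib power2_eq_square)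
      also have "s powr (- (3 / 4 + \<epsilon>)) * s powr (- (3 / 4 + \<epsilon>)) = s powr (- (3 / 2) - 2 * \<epsilon>)"
        by (simp add: powr_add[symmetric])
      finally have "ennreal ((v s)\<^sup>2) \<le> ennreal (C\<^sup>2 * s powr (- (3 / 2) - 2 * \<epsilon>))"
        by (intro ennreal_leI) simp
      also have "\<dots> = ennreal (C\<^sup>2) * ennreal (s powr (- (3 / 2) - 2 * \<epsilon>))" by (intro ennreal_mult) auto
      finally show ?thesis using True by simp
    qed simp
  qed
  also have "\<dots> = ennreal (C\<^sup>2) * (\<integral>\<^sup>+s\<in>{t..}. ennreal (s powr (- (3 / 2) - 2 * \<epsilon>)) \<partial>lborel)"
    by (rule nn_integral_cmult) measurable
  also have "\<dots> = ennreal (C\<^sup>2) * ennreal (t powr (- (3 / 2) - 2 * \<epsilon> + 1) / - (- (3 / 2) - 2 * \<epsilon> + 1))"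
    by (subst nn_integral_powr_tail) (use \<epsilon> assms in auto)
  also have "\<dots> = ennreal (C\<^sup>2 * (t powr (- (1 / 2) - 2 * \<epsilon>) / (1 / 2 + 2 * \<epsilon>)))"
    by (subst ennreal_mult[symmetric]) (use \<epsilon> in \<open>auto simp: algebra_simps\<close>)
  also have "\<dots> \<le> ennreal (C\<^sup>2 * (t powr (- (1 / 2) - 2 * \<epsilon>) * 2))"
  proof (intro ennreal_leI mult_left_mono)
    have "t powr (- (1 / 2) - 2 * \<epsilon>) / (1 / 2 + 2 * \<epsilon>) \<le> t powr (- (1 / 2) - 2 * \<epsilon>) / (1 / 2)"
      using \<epsilon> by (intro divide_left_mono) auto
    then show "t powr (- (1 / 2) - 2 * \<epsilon>) / (1 / 2 + 2 * \<epsilon>) \<le> t powr (- (1 / 2) - 2 * \<epsilon>) * 2" by simp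
  qed auto
  finally show ?thesis by (simp add: mult.assoc mult.left_commute mult.commute)
qed

text \<open>Tonelli's theorem requires joint measurability, which is visible when the tails are
written as Lebesgue integrals of functions of all variables.\<close>

lemma joint_measurable:
  "(\<lambda>p. \<Sum>n<N. (cmod (fourier (\<lambda>s. if snd p \<le> s \<and> s \<le> T then v s else 0) (fst p * (2 * real n + 1))))\<^sup>2)
     \<in> borel_measurable (borel \<Otimes>\<^sub>M borel)"
proof -
  have [measurable]: "v \<in> borel_measurable borel" by (rule locally_bounded_measurable[OF v])
  show ?thesis unfolding fourier_def cis_conv_exp by measurable
qed

lemma far_mass_joint:
  assumes R: "0 < R"
  obtains h where "h \<in> borel_measurable (borel \<Otimes>\<^sub>M borel)"
    "\<And>k t. h (k, t) = ennreal (t powr (- (1 / 2)) * (\<bar>k\<bar> powr \<epsilon> * (tail_size v N T k t)\<^sup>2)) * indicator {1 / R..T} t"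
proof
  let ?G = "\<lambda>p. \<Sum>n<N. (cmod (fourier (\<lambda>s. if snd p \<le> s \<and> s \<le> T then v s else 0) (fst p * (2 * real n + 1))))\<^sup>2"
  let ?h = "\<lambda>p. ennreal (snd p powr (- (1 / 2)) * (\<bar>fst p\<bar> powr \<epsilon> * ?G p)) * indicator {1 / R..T} (snd p)"
  note [measurable] = joint_measurable
  show "?h \<in> borel_measurable (borel \<Otimes>\<^sub>M borel)" by measurable
  show "?h (k, t) = ennreal (t powr (- (1 / 2)) * (\<bar>k\<bar> powr \<epsilon> * (tail_size v N T k t)\<^sup>2)) * indicator {1 / R..T} t" for k t
  proof (cases "t \<in> {1 / R..T}")
    case True
    then have t: "0 \<le> t" "t \<le> T" using R by (auto intro: order.trans[rotated])
    then show ?thesis by (simp add: tail_size_def tail_eq_fourier[OF v t] sum_nonneg)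
  qed simp
qed

lemma far_mass_measurable:
  assumes R: "0 < R" shows "far_mass R N T \<in> borel_measurable borel"
proof -
  obtain h where h [measurable]: "h \<in> borel_measurable (borel \<Otimes>\<^sub>M borel)"
    and eq: "\<And>k t. h (k, t) = ennreal (t powr (- (1 / 2)) * (\<bar>k\<bar> powr \<epsilon> * (tail_size v N T k t)\<^sup>2)) * indicator {1 / R..T} t"
    using far_mass_joint[OF R] by metis
  have "(\<lambda>k. \<integral>\<^sup>+t. h (k, t) \<partial>lborel) \<in> borel_measurable borel" by measurable
  then show ?thesis unfolding far_mass_def[abs_def] eq .
qed

definition far_const :: "real \<Rightarrow> real" where
  "far_const R = R powr \<epsilon> * (1 + 1 / \<epsilon>) * (2 * pi * exp (1 / 2)) * (2 * C\<^sup>2) * ((1 / R) powr (- 2 * \<epsilon>) / (2 * \<epsilon>))"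

text \<open>After exchanging the integrals, the inner one is at most a constant times \<open>t\<^bsup>-1/2-2\<epsilon>\<^esup>\<close>, the
size of the integral of \<open>v\<^sup>2\<close> over \<open>[t,\<infinity>)\<close>. Together with \<open>t\<^bsup>-1/2\<^esup>\<close> this is integrable at infinity;
here the exponent \<open>3/4\<close> is critical.\<close>

lemma far_mass_integral_le:
  assumes R: "0 < R"
  shows "(\<integral>\<^sup>+k\<in>{-R..R}. far_mass R N T k \<partial>lborel) \<le> ennreal (far_const R)"
proof -
  obtain h where h [measurable]: "h \<in> borel_measurable (borel \<Otimes>\<^sub>M borel)"
    and eq: "\<And>k t. h (k, t) = ennreal (t powr (- (1 / 2)) * (\<bar>k\<bar> powr \<epsilon> * (tail_size v N T k t)\<^sup>2)) * indicator {1 / R..T} t"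
    using far_mass_joint[OF R] by metis
  define c where "c = R powr \<epsilon> * (1 + 1 / \<epsilon>) * (2 * pi * exp (1 / 2))"
  have c: "0 \<le> c" using \<epsilon> by (simp add: c_def)
  have "(\<integral>\<^sup>+k\<in>{-R..R}. far_mass R N T k \<partial>lborel) = (\<integral>\<^sup>+k. \<integral>\<^sup>+t. h (k, t) * indicator {-R..R} k \<partial>lborel \<partial>lborel)"
    unfolding far_mass_def eq[symmetric] by (subst nn_integral_multc) auto
  also have "\<dots> = (\<integral>\<^sup>+t. \<integral>\<^sup>+k. h (k, t) * indicator {-R..R} k \<partial>lborel \<partial>lborel)"
    by (rule lborel_pair.Fubini') measurable
  also have "\<dots> \<le> (\<integral>\<^sup>+t. ennreal (c * (2 * C\<^sup>2)) * (ennreal (t powr (-1 - 2 * \<epsilon>)) * indicator {1 / R..} t) \<partial>lborel)"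
  proof (rule nn_integral_mono)
    fix t :: real
    show "(\<integral>\<^sup>+k. h (k, t) * indicator {-R..R} k \<partial>lborel) \<le> ennreal (c * (2 * C\<^sup>2)) * (ennreal (t powr (-1 - 2 * \<epsilon>)) * indicator {1 / R..} t)"
    proof (cases "t \<in> {1 / R..T}")
      case True
      have "0 < 1 / R" "1 / R \<le> t" "t \<le> T" using R True by auto
      then have t: "0 < t" "0 \<le> t" "t \<le> T" by linarith+
      note [measurable] = tail_measurable[OF v t(2,3)]
      have "(\<integral>\<^sup>+k. h (k, t) * indicator {-R..R} k \<partial>lborel)
          = (\<integral>\<^sup>+k. ennreal (t powr (- (1 / 2))) * (ennreal (\<bar>k\<bar> powr \<epsilon> * (tail_size v N T k t)\<^sup>2) * indicator {-R..R} k) \<partial>lborel)"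
      proof (rule nn_integral_cong)
        fix k
        have "ennreal (t powr (- (1 / 2)) * (\<bar>k\<bar> powr \<epsilon> * (tail_size v N T k t)\<^sup>2))
          = ennreal (t powr (- (1 / 2))) * ennreal (\<bar>k\<bar> powr \<epsilon> * (tail_size v N T k t)\<^sup>2)" by (rule ennreal_mult) auto
        moreover have "(indicator {1 / R..T} t :: ennreal) = 1" using True by simp
        ultimately show "h (k, t) * indicator {-R..R} k = ennreal (t powr (- (1 / 2))) * (ennreal (\<bar>k\<bar> powr \<epsilon> * (tail_size v N T k t)\<^sup>2) * indicator {-R..R} k)"
          unfolding eq by (simp only: mult.assoc mult_1_right)
      qed
      also have "\<dots> = ennreal (t powr (- (1 / 2))) * (\<integral>\<^sup>+k\<in>{-R..R}. ennreal (\<bar>k\<bar> powr \<epsilon> * (tail_size v N T k t)\<^sup>2) \<partial>lborel)"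
        unfolding tail_size_def by (rule nn_integral_cmult) measurable
      also have "\<dots> \<le> ennreal (t powr (- (1 / 2))) * (ennreal c * ennreal (2 * C\<^sup>2 * t powr (- (1 / 2) - 2 * \<epsilon>)))"
      proof (rule mult_left_mono)
        have "(\<integral>\<^sup>+k\<in>{-R..R}. ennreal (\<bar>k\<bar> powr \<epsilon> * (tail_size v N T k t)\<^sup>2) \<partial>lborel)
            \<le> ennreal c * (\<integral>\<^sup>+s\<in>{t..T}. ennreal ((v s)\<^sup>2) \<partial>lborel)"
          unfolding c_def by (rule tail_size_weighted_integral_le[OF v t(2,3) R \<epsilon>])
        also have "\<dots> \<le> ennreal c * ennreal (2 * C\<^sup>2 * t powr (- (1 / 2) - 2 * \<epsilon>))"
          by (rule mult_left_mono[OF square_tail_le[OF t(1)]]) simp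
        finally show "(\<integral>\<^sup>+k\<in>{-R..R}. ennreal (\<bar>k\<bar> powr \<epsilon> * (tail_size v N T k t)\<^sup>2) \<partial>lborel)
            \<le> ennreal c * ennreal (2 * C\<^sup>2 * t powr (- (1 / 2) - 2 * \<epsilon>))" .
      qed simp
      also have "\<dots> = ennreal (t powr (- (1 / 2)) * (c * (2 * C\<^sup>2 * t powr (- (1 / 2) - 2 * \<epsilon>))))"
      proof -
        have "ennreal c * ennreal (2 * C\<^sup>2 * t powr (- (1 / 2) - 2 * \<epsilon>)) = ennreal (c * (2 * C\<^sup>2 * t powr (- (1 / 2) - 2 * \<epsilon>)))"
          by (rule ennreal_mult[symmetric, OF c]) simp
        moreover have "ennreal (t powr (- (1 / 2))) * ennreal (c * (2 * C\<^sup>2 * t powr (- (1 / 2) - 2 * \<epsilon>)))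
           = ennreal (t powr (- (1 / 2)) * (c * (2 * C\<^sup>2 * t powr (- (1 / 2) - 2 * \<epsilon>))))"
          by (rule ennreal_mult[symmetric]) (use c in \<open>auto intro!: mult_nonneg_nonneg\<close>)
        ultimately show ?thesis by simp
      qed
      also have "t powr (- (1 / 2)) * (c * (2 * C\<^sup>2 * t powr (- (1 / 2) - 2 * \<epsilon>)))
          = c * (2 * C\<^sup>2) * (t powr (- (1 / 2)) * t powr (- (1 / 2) - 2 * \<epsilon>))" by (simp only: mult.assoc mult.left_commute mult.commute)
      also have "t powr (- (1 / 2)) * t powr (- (1 / 2) - 2 * \<epsilon>) = t powr (-1 - 2 * \<epsilon>)"
        by (simp add: powr_add[symmetric])
      also have "ennreal (c * (2 * C\<^sup>2) * t powr (-1 - 2 * \<epsilon>)) = ennreal (c * (2 * C\<^sup>2)) * ennreal (t powr (-1 - 2 * \<epsilon>))"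
        by (rule ennreal_mult) (use c in auto)
      finally show ?thesis using True by simp
    next
      case False
      then have "h (k, t) = 0" for k by (simp add: eq)
      then show ?thesis by simp
    qed
  qed
  also have "\<dots> = ennreal (c * (2 * C\<^sup>2)) * (\<integral>\<^sup>+t\<in>{1 / R..}. ennreal (t powr (-1 - 2 * \<epsilon>)) \<partial>lborel)"
    by (rule nn_integral_cmult) measurable
  also have "\<dots> = ennreal (c * (2 * C\<^sup>2)) * ennreal ((1 / R) powr (-1 - 2 * \<epsilon> + 1) / - (-1 - 2 * \<epsilon> + 1))"
    by (subst nn_integral_powr_tail) (use \<epsilon> R in auto)
  also have "\<dots> = ennreal (far_const R)"
  proof -
    have "(1 / R) powr (-1 - 2 * \<epsilon> + 1) / - (-1 - 2 * \<epsilon> + 1) = (1 / R) powr (- 2 * \<epsilon>) / (2 * \<epsilon>)" by simp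
    moreover have "ennreal (c * (2 * C\<^sup>2)) * ennreal ((1 / R) powr (- 2 * \<epsilon>) / (2 * \<epsilon>)) = ennreal (c * (2 * C\<^sup>2) * ((1 / R) powr (- 2 * \<epsilon>) / (2 * \<epsilon>)))"
      by (rule ennreal_mult[symmetric]) (use c \<epsilon> in auto)
    ultimately show ?thesis unfolding far_const_def c_def by simp
  qed
  finally show ?thesis .
qed

text \<open>Cauchy--Schwarz, with \<open>t\<^bsup>-3/4-\<epsilon>\<^esup>\<close> split into \<open>t\<^bsup>-1/2-\<epsilon>/2\<^esup>\<close>, whose square is integrable, and
\<open>t\<^bsup>-1/4-\<epsilon>/2\<^esup>\<close>. Since \<open>t \<ge> 1 / |k|\<close>, a factor \<open>t\<^bsup>-\<epsilon>\<^esup>\<close> may be exchanged for the weight \<open>|k|\<^sup>\<epsilon>\<close>.\<close>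

lemma far_integral_power2_le:
  assumes R: "0 < R" and k: "k \<noteq> 0" "\<bar>k\<bar> \<le> R" and T: "0 \<le> T"
    and A: "A = integral {min (1 / \<bar>k\<bar>) T..T} (\<lambda>s. \<bar>v s\<bar> * tail_size v N T k s)"
  shows "ennreal (A\<^sup>2) \<le> ennreal ((1 / R) powr (- \<epsilon>) / \<epsilon> * C\<^sup>2) * far_mass R N T k"
proof (cases "1 / \<bar>k\<bar> \<le> T")
  case False
  then have "A = 0" by (simp add: A min_def)
  then show ?thesis by simp
next
  case True
  let ?t0 = "1 / \<bar>k\<bar>"
  have t0: "0 < ?t0" "1 / R \<le> ?t0" using k R by (auto simp: frac_le)
  have ts [measurable]: "tail_size v N T k \<in> borel_measurable borel" and vm [measurable]: "v \<in> borel_measurable borel"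
    using v by (auto intro: locally_bounded_measurable locally_bounded_tail_size)
  let ?f1 = "\<lambda>t. ennreal (t powr (- (1 / 2) - \<epsilon> / 2)) * indicator {1 / R..} t"
  let ?f2 = "\<lambda>t. ennreal (C * t powr (- (1 / 4) - \<epsilon> / 2) * tail_size v N T k t) * indicator {?t0..T} t"
  have A0: "0 \<le> A" unfolding A using t0 T True
    by (intro integral_nonneg locally_bounded_integrable_on locally_bounded_mult locally_bounded_tail_size v) (use locally_bounded_norm[OF v] in auto)
  have "ennreal A = (\<integral>\<^sup>+t. ennreal (\<bar>v t\<bar> * tail_size v N T k t) * indicator {?t0..T} t \<partial>lborel)"
  proof (rule nn_integral_has_integral_lebesgue'[symmetric])
    show "((\<lambda>s. \<bar>v s\<bar> * tail_size v N T k s) has_integral A) {?t0..T}"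
      unfolding A using True t0 locally_bounded_norm[OF v]
      by (simp add: min_def) (intro integrable_integral locally_bounded_integrable_on locally_bounded_mult locally_bounded_tail_size v, auto)
  qed auto
  also have "\<dots> \<le> (\<integral>\<^sup>+t. ?f1 t * ?f2 t \<partial>lborel)"
  proof (rule nn_integral_mono)
    fix t
    show "ennreal (\<bar>v t\<bar> * tail_size v N T k t) * indicator {?t0..T} t \<le> ?f1 t * ?f2 t"
    proof (cases "t \<in> {?t0..T}")
      case True
      then have "?t0 \<le> t" by simp
      then have t: "0 < t" "1 / R \<le> t" using t0 by linarith+
      have "\<bar>v t\<bar> * tail_size v N T k t \<le> C * t powr (- (3 / 4 + \<epsilon>)) * tail_size v N T k t"
        using decay[of t] t by (intro mult_right_mono) auto
      also have "t powr (- (3 / 4 + \<epsilon>)) = t powr (- (1 / 2) - \<epsilon> / 2) * t powr (- (1 / 4) - \<epsilon> / 2)"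
        by (simp add: powr_add[symmetric])
      also have "C * (t powr (- (1 / 2) - \<epsilon> / 2) * t powr (- (1 / 4) - \<epsilon> / 2)) * tail_size v N T k t
         = t powr (- (1 / 2) - \<epsilon> / 2) * (C * t powr (- (1 / 4) - \<epsilon> / 2) * tail_size v N T k t)"
        by (simp only: mult.assoc mult.left_commute mult.commute)
      finally have "ennreal (\<bar>v t\<bar> * tail_size v N T k t) \<le> ennreal (t powr (- (1 / 2) - \<epsilon> / 2) * (C * t powr (- (1 / 4) - \<epsilon> / 2) * tail_size v N T k t))"
        by (rule ennreal_leI)
      also have "\<dots> = ennreal (t powr (- (1 / 2) - \<epsilon> / 2)) * ennreal (C * t powr (- (1 / 4) - \<epsilon> / 2) * tail_size v N T k t)"
        using C by (intro ennreal_mult) auto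
      finally show ?thesis using True t by simp
    qed simp
  qed
  finally have "(ennreal A)\<^sup>2 \<le> (\<integral>\<^sup>+t. ?f1 t * ?f2 t \<partial>lborel)\<^sup>2" by (rule power_mono) simp
  also have "\<dots> \<le> (\<integral>\<^sup>+t. (?f1 t)\<^sup>2 \<partial>lborel) * (\<integral>\<^sup>+t. (?f2 t)\<^sup>2 \<partial>lborel)"
    by (rule Cauchy_Schwarz_nn_integral) measurable
  also have "(\<integral>\<^sup>+t. (?f1 t)\<^sup>2 \<partial>lborel) = (\<integral>\<^sup>+t\<in>{1 / R..}. ennreal (t powr (-1 - \<epsilon>)) \<partial>lborel)"
  proof (rule nn_integral_cong)
    fix t
    have "t powr (- (1 / 2) - \<epsilon> / 2) * t powr (- (1 / 2) - \<epsilon> / 2) = t powr (-1 - \<epsilon>)"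
      by (simp add: powr_add[symmetric])
    then show "(?f1 t)\<^sup>2 = ennreal (t powr (-1 - \<epsilon>)) * indicator {1 / R..} t"
      by (auto simp: power2_eq_square indicator_def ennreal_mult'[symmetric])
  qed
  also have "\<dots> = ennreal ((1 / R) powr (-1 - \<epsilon> + 1) / - (-1 - \<epsilon> + 1))"
    by (rule nn_integral_powr_tail) (use \<epsilon> R in auto)
  also have "(1 / R) powr (-1 - \<epsilon> + 1) / - (-1 - \<epsilon> + 1) = (1 / R) powr (- \<epsilon>) / \<epsilon>" by simp
  also have "(\<integral>\<^sup>+t. (?f2 t)\<^sup>2 \<partial>lborel)
      \<le> (\<integral>\<^sup>+t. ennreal (C\<^sup>2) * (ennreal (t powr (- (1 / 2)) * (\<bar>k\<bar> powr \<epsilon> * (tail_size v N T k t)\<^sup>2)) * indicator {1 / R..T} t) \<partial>lborel)"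
  proof (rule nn_integral_mono)
    fix t
    show "(?f2 t)\<^sup>2 \<le> ennreal (C\<^sup>2) * (ennreal (t powr (- (1 / 2)) * (\<bar>k\<bar> powr \<epsilon> * (tail_size v N T k t)\<^sup>2)) * indicator {1 / R..T} t)"
    proof (cases "t \<in> {?t0..T}")
      case True
      then have "?t0 \<le> t" by simp
      then have t: "0 < t" "1 / R \<le> t" using t0 by linarith+
      have "t powr - \<epsilon> \<le> ?t0 powr - \<epsilon>" using True t0 \<epsilon> by (intro powr_mono2') auto
      also have "\<dots> = \<bar>k\<bar> powr \<epsilon>" using k by (simp add: powr_minus powr_divide)
      finally have te: "t powr - \<epsilon> \<le> \<bar>k\<bar> powr \<epsilon>" .
      have "(C * t powr (- (1 / 4) - \<epsilon> / 2) * tail_size v N T k t)\<^sup>2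
          = C\<^sup>2 * ((t powr (- (1 / 4) - \<epsilon> / 2) * t powr (- (1 / 4) - \<epsilon> / 2)) * (tail_size v N T k t)\<^sup>2)"
        by (simp add: power2_eq_square)
      also have "t powr (- (1 / 4) - \<epsilon> / 2) * t powr (- (1 / 4) - \<epsilon> / 2) = t powr (- (1 / 2)) * t powr - \<epsilon>"
        by (simp add: powr_add[symmetric])
      also have "C\<^sup>2 * (t powr (- (1 / 2)) * t powr - \<epsilon> * (tail_size v N T k t)\<^sup>2)
          \<le> C\<^sup>2 * (t powr (- (1 / 2)) * \<bar>k\<bar> powr \<epsilon> * (tail_size v N T k t)\<^sup>2)"
        using te by (intro mult_left_mono mult_right_mono) auto
      finally have "ennreal ((C * t powr (- (1 / 4) - \<epsilon> / 2) * tail_size v N T k t)\<^sup>2)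
          \<le> ennreal (C\<^sup>2 * (t powr (- (1 / 2)) * (\<bar>k\<bar> powr \<epsilon> * (tail_size v N T k t)\<^sup>2)))"
        by (intro ennreal_leI) (simp only: mult.assoc)
      also have "\<dots> = ennreal (C\<^sup>2) * ennreal (t powr (- (1 / 2)) * (\<bar>k\<bar> powr \<epsilon> * (tail_size v N T k t)\<^sup>2))"
        by (rule ennreal_mult) auto
      finally show ?thesis using True t C by (simp add: ennreal_power)
    qed simp
  qed
  also have "\<dots> = ennreal (C\<^sup>2) * far_mass R N T k"
    unfolding far_mass_def by (rule nn_integral_cmult) measurable
  finally have "ennreal (A\<^sup>2) \<le> ennreal ((1 / R) powr (- \<epsilon>) / \<epsilon>) * (ennreal (C\<^sup>2) * far_mass R N T k)"
    using A0 by (simp add: ennreal_power mult_left_mono)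
  also have "\<dots> = ennreal ((1 / R) powr (- \<epsilon>) / \<epsilon> * C\<^sup>2) * far_mass R N T k"
    using \<epsilon> by (subst ennreal_mult) (auto simp: mult.assoc)
  finally show ?thesis .
qed

text \<open>The square of the integral of \<open>t\<^bsup>-3/4\<^esup>\<close> up to \<open>1 / |k|\<close>; it is locally integrable in \<open>k\<close>.\<close>

lemma near_integral_power2_le:
  assumes k: "k \<noteq> 0" and T: "0 \<le> T"
    and V: "V = integral {0..min (1 / \<bar>k\<bar>) T} (\<lambda>s. \<bar>v s\<bar>)"
  shows "V\<^sup>2 \<le> 16 * C\<^sup>2 * \<bar>k\<bar> powr (- (1 / 2))"
proof -
  let ?t0 = "min (1 / \<bar>k\<bar>) T"
  have t0: "0 \<le> ?t0" using T by simp
  have hi: "((\<lambda>s. C * s powr (- (3 / 4))) has_integral C * (?t0 powr (- (3 / 4) + 1) / (- (3 / 4) + 1))) {0..?t0}"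
    by (intro has_integral_mult_right has_integral_powr_from_0 t0) auto
  have lb: "locally_bounded (\<lambda>s. \<bar>v s\<bar>)" using locally_bounded_norm[OF v] by simp
  have "V \<le> C * (?t0 powr (- (3 / 4) + 1) / (- (3 / 4) + 1))"
    unfolding V by (rule has_integral_le[OF integrable_integral[OF locally_bounded_integrable_on[OF lb]] hi]) (auto intro: decay')
  also have "\<dots> = 4 * C * ?t0 powr (1 / 4)" by simp
  also have "\<dots> \<le> 4 * C * (1 / \<bar>k\<bar>) powr (1 / 4)"
    using t0 C by (intro mult_left_mono powr_mono2) auto
  also have "(1 / \<bar>k\<bar>) powr (1 / 4) = \<bar>k\<bar> powr (- (1 / 4))" using k by (simp add: powr_minus powr_divide inverse_eq_divide)
  finally have "V \<le> 4 * C * \<bar>k\<bar> powr (- (1 / 4))" .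
  moreover have "0 \<le> V" unfolding V by (intro integral_nonneg locally_bounded_integrable_on lb) auto
  ultimately have "V\<^sup>2 \<le> (4 * C * \<bar>k\<bar> powr (- (1 / 4)))\<^sup>2" by (intro power_mono) auto
  also have "\<dots> = 16 * C\<^sup>2 * (\<bar>k\<bar> powr (- (1 / 4)) * \<bar>k\<bar> powr (- (1 / 4)))" by (simp add: power2_eq_square)
  also have "\<bar>k\<bar> powr (- (1 / 4)) * \<bar>k\<bar> powr (- (1 / 4)) = \<bar>k\<bar> powr (- (1 / 2))" by (simp add: powr_add[symmetric])
  finally show ?thesis .
qed

end

lemma nn_integral_inverse_sqrt:
  assumes R: "0 < R"
  shows "(\<integral>\<^sup>+k\<in>{-R..R}. ennreal (\<bar>k\<bar> powr (- (1 / 2))) \<partial>lborel) \<le> ennreal (4 * R powr (1 / 2))"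
proof -
  let ?f = "\<lambda>k::real. ennreal (\<bar>k\<bar> powr (- (1 / 2)))"
  have "(\<integral>\<^sup>+k\<in>{0..R}. ennreal (k powr (- (1 / 2))) \<partial>lborel) = ennreal (R powr (- (1 / 2) + 1) / (- (1 / 2) + 1))"
    by (rule nn_integral_has_integral_lebesgue'[OF _ has_integral_powr_from_0]) (use R in auto)
  moreover have "(\<integral>\<^sup>+k\<in>{0..R}. ennreal (k powr (- (1 / 2))) \<partial>lborel) = (\<integral>\<^sup>+k\<in>{0..R}. ?f k \<partial>lborel)"
    by (intro nn_integral_cong) (auto simp: indicator_def)
  ultimately have half: "(\<integral>\<^sup>+k\<in>{0..R}. ?f k \<partial>lborel) = ennreal (2 * R powr (1 / 2))" by simp
  have "(\<integral>\<^sup>+k\<in>{0..R}. ?f k \<partial>lborel) = ennreal \<bar>-1\<bar> * (\<integral>\<^sup>+k. ?f (0 + -1 * k) * indicator {0..R} (0 + -1 * k) \<partial>lborel)"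
    by (rule nn_integral_real_affine) auto
  also have "\<dots> = (\<integral>\<^sup>+k\<in>{-R..0}. ?f k \<partial>lborel)"
    by (simp) (intro nn_integral_cong, auto simp: indicator_def)
  finally have half': "(\<integral>\<^sup>+k\<in>{-R..0}. ?f k \<partial>lborel) = ennreal (2 * R powr (1 / 2))" using half by simp
  have "(\<integral>\<^sup>+k\<in>{-R..R}. ?f k \<partial>lborel) \<le> (\<integral>\<^sup>+k. ?f k * indicator {-R..0} k + ?f k * indicator {0..R} k \<partial>lborel)"
    by (intro nn_integral_mono) (auto simp: indicator_def)
  also have "\<dots> = (\<integral>\<^sup>+k\<in>{-R..0}. ?f k \<partial>lborel) + (\<integral>\<^sup>+k\<in>{0..R}. ?f k \<partial>lborel)"
    by (rule nn_integral_add) auto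
  also have "\<dots> = ennreal (4 * R powr (1 / 2))" unfolding half half' by (subst ennreal_plus[symmetric]) auto
  finally show ?thesis .
qed

text \<open>Choosing \<open>T0 = 1 / |k|\<close>, the time at which the slowest phase has turned by one radian,
balances the near and the far part.\<close>

lemma (in decaying_potential) energy_pointwise_le:
  assumes a: "unit_flow v k a" and R: "0 < R" and k: "k \<noteq> 0" "\<bar>k\<bar> \<le> R" and t: "0 \<le> t" "t \<le> T"
  shows "ennreal (unit_flow.energy a N t) \<le> ennreal 1156 + ennreal (2304 * C\<^sup>2) * ennreal (\<bar>k\<bar> powr (- (1 / 2)))
      + ennreal (3456 * ((1 / R) powr (- \<epsilon>) / \<epsilon> * C\<^sup>2)) * far_mass R N T k"
proof -
  interpret unit_flow v k a by fact
  have T: "0 \<le> T" using t by simp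
  let ?t0 = "min (1 / \<bar>k\<bar>) T"
  define V where "V = integral {0..?t0} (\<lambda>s. \<bar>v s\<bar>)"
  define A where "A = integral {?t0..T} (\<lambda>s. \<bar>v s\<bar> * tail_size v N T k s)"
  have A0: "0 \<le> A" unfolding A_def using T
    by (intro integral_nonneg locally_bounded_integrable_on locally_bounded_mult locally_bounded_abs_v locally_bounded_tail_size v) auto
  have "energy N t \<le> (1 + (6 * V + 12 * sqrt (2 * A) + 24 * A))\<^sup>2"
    using T t by (intro energy_bound[OF _ _ _ _ V_def A_def]) auto
  also have "\<dots> \<le> 1156 + 144 * V\<^sup>2 + 3456 * A\<^sup>2"
  proof -
    define q where "q = sqrt (2 * A)"
    have q: "q\<^sup>2 = 2 * A" using A0 by (simp add: q_def)
    have four: "(a + b + c + d)\<^sup>2 \<le> 4 * (a\<^sup>2 + b\<^sup>2 + c\<^sup>2 + d\<^sup>2)" for a b c d :: real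
      using sum_squares_bound[of a b] sum_squares_bound[of a c] sum_squares_bound[of a d]
        sum_squares_bound[of b c] sum_squares_bound[of b d] sum_squares_bound[of c d]
      by (simp add: power2_eq_square algebra_simps)
    have "(1 + (6 * V + 12 * q + 24 * A))\<^sup>2 \<le> 4 * (1 + 36 * V\<^sup>2 + 144 * q\<^sup>2 + 576 * A\<^sup>2)"
      using four[of 1 "6 * V" "12 * q" "24 * A"] by (simp add: power_mult_distrib add.assoc)
    moreover have "2 * A \<le> 1 + A\<^sup>2" using sum_squares_bound[of 1 A] by simp
    then have "4 * (1 + 36 * V\<^sup>2 + 144 * q\<^sup>2 + 576 * A\<^sup>2) \<le> 1156 + 144 * V\<^sup>2 + 3456 * A\<^sup>2"
      unfolding q by (simp add: algebra_simps) (smt (verit) zero_le_power2)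
    ultimately show ?thesis unfolding q_def[symmetric] by (rule order.trans)
  qed
  also have "\<dots> \<le> 1156 + 2304 * C\<^sup>2 * \<bar>k\<bar> powr (- (1 / 2)) + 3456 * A\<^sup>2"
    using near_integral_power2_le[OF k(1) T V_def] by simp
  finally have "ennreal (energy N t) \<le> ennreal (1156 + 2304 * C\<^sup>2 * \<bar>k\<bar> powr (- (1 / 2)) + 3456 * A\<^sup>2)"
    by (rule ennreal_leI)
  also have "\<dots> = ennreal 1156 + ennreal (2304 * C\<^sup>2) * ennreal (\<bar>k\<bar> powr (- (1 / 2))) + ennreal 3456 * ennreal (A\<^sup>2)"
  proof -
    have "ennreal (1156 + 2304 * C\<^sup>2 * \<bar>k\<bar> powr (- (1 / 2)) + 3456 * A\<^sup>2)
        = ennreal (1156 + 2304 * C\<^sup>2 * \<bar>k\<bar> powr (- (1 / 2))) + ennreal (3456 * A\<^sup>2)" by (rule ennreal_plus) auto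
    also have "ennreal (1156 + 2304 * C\<^sup>2 * \<bar>k\<bar> powr (- (1 / 2))) = ennreal 1156 + ennreal (2304 * C\<^sup>2 * \<bar>k\<bar> powr (- (1 / 2)))"
      by (rule ennreal_plus) auto
    also have "ennreal (2304 * C\<^sup>2 * \<bar>k\<bar> powr (- (1 / 2))) = ennreal (2304 * C\<^sup>2) * ennreal (\<bar>k\<bar> powr (- (1 / 2)))"
      by (rule ennreal_mult) auto
    also have "ennreal (3456 * A\<^sup>2) = ennreal 3456 * ennreal (A\<^sup>2)" by (rule ennreal_mult) auto
    finally show ?thesis .
  qed
  also have "ennreal 3456 * ennreal (A\<^sup>2) \<le> ennreal 3456 * (ennreal ((1 / R) powr (- \<epsilon>) / \<epsilon> * C\<^sup>2) * far_mass R N T k)"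
    by (intro mult_left_mono far_integral_power2_le[OF R k T A_def]) auto
  also have "\<dots> = ennreal (3456 * ((1 / R) powr (- \<epsilon>) / \<epsilon> * C\<^sup>2)) * far_mass R N T k"
    using \<epsilon> by (subst ennreal_mult) (auto simp: mult.assoc)
  finally show ?thesis by (simp add: add_left_mono)
qed

lemma (in decaying_potential) sup_energy_integral_le:
  assumes a: "\<And>k. unit_flow v k (a k)" and R: "0 < R"
  shows "(\<integral>\<^sup>+k\<in>{-R..R}. (SUP t\<in>{0<..T}. ennreal (unit_flow.energy (a k) N t)) \<partial>lborel)
     \<le> ennreal (1156 * (2 * R) + 2304 * C\<^sup>2 * (4 * R powr (1 / 2)) + 3456 * ((1 / R) powr (- \<epsilon>) / \<epsilon> * C\<^sup>2) * far_const R)"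
proof -
  let ?c = "3456 * ((1 / R) powr (- \<epsilon>) / \<epsilon> * C\<^sup>2)"
  let ?I = "indicator {-R..R} :: real \<Rightarrow> ennreal"
  have c: "0 \<le> ?c" using \<epsilon> by simp
  have fc: "0 \<le> far_const R" unfolding far_const_def using \<epsilon> by simp
  note [measurable] = far_mass_measurable[OF R]
  \<comment> \<open>At \<open>k = 0\<close> nothing oscillates and the energy may be unbounded in time.\<close>
  have "AE k in lborel. k \<noteq> (0::real)" by (rule AE_lborel_singleton)
  then have "(\<integral>\<^sup>+k\<in>{-R..R}. (SUP t\<in>{0<..T}. ennreal (unit_flow.energy (a k) N t)) \<partial>lborel)
    \<le> (\<integral>\<^sup>+k. (ennreal 1156 * ?I k + ennreal (2304 * C\<^sup>2) * (ennreal (\<bar>k\<bar> powr (- (1 / 2))) * ?I k))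
          + ennreal ?c * (far_mass R N T k * ?I k) \<partial>lborel)"
  proof (intro nn_integral_mono_AE, eventually_elim)
    fix k :: real assume k: "k \<noteq> 0"
    show "(SUP t\<in>{0<..T}. ennreal (unit_flow.energy (a k) N t)) * ?I k
      \<le> (ennreal 1156 * ?I k + ennreal (2304 * C\<^sup>2) * (ennreal (\<bar>k\<bar> powr (- (1 / 2))) * ?I k)) + ennreal ?c * (far_mass R N T k * ?I k)"
    proof (cases "k \<in> {-R..R}")
      case True
      then have "\<bar>k\<bar> \<le> R" by auto
      then have "(SUP t\<in>{0<..T}. ennreal (unit_flow.energy (a k) N t))
        \<le> ennreal 1156 + ennreal (2304 * C\<^sup>2) * ennreal (\<bar>k\<bar> powr (- (1 / 2))) + ennreal ?c * far_mass R N T k"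
        by (intro SUP_least energy_pointwise_le[OF a R k]) auto
      then show ?thesis using True by simp
    qed simp
  qed
  also have "\<dots> = ennreal 1156 * (\<integral>\<^sup>+k. ?I k \<partial>lborel)
      + ennreal (2304 * C\<^sup>2) * (\<integral>\<^sup>+k\<in>{-R..R}. ennreal (\<bar>k\<bar> powr (- (1 / 2))) \<partial>lborel)
      + ennreal ?c * (\<integral>\<^sup>+k\<in>{-R..R}. far_mass R N T k \<partial>lborel)"
    by (subst nn_integral_add, measurable)+ (simp add: nn_integral_cmult)
  also have "\<dots> \<le> ennreal 1156 * ennreal (2 * R) + ennreal (2304 * C\<^sup>2) * ennreal (4 * R powr (1 / 2)) + ennreal ?c * ennreal (far_const R)"
    using R by (intro add_mono mult_left_mono nn_integral_inverse_sqrt far_mass_integral_le) auto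
  also have "\<dots> = ennreal (1156 * (2 * R) + 2304 * C\<^sup>2 * (4 * R powr (1 / 2)) + ?c * far_const R)"
  proof -
    have "ennreal 1156 * ennreal (2 * R) = ennreal (1156 * (2 * R))" by (rule ennreal_mult[symmetric]) (use R in auto)
    moreover have "ennreal (2304 * C\<^sup>2) * ennreal (4 * R powr (1 / 2)) = ennreal (2304 * C\<^sup>2 * (4 * R powr (1 / 2)))"
      by (rule ennreal_mult[symmetric]) auto
    moreover have "ennreal ?c * ennreal (far_const R) = ennreal (?c * far_const R)"
      by (rule ennreal_mult[symmetric, OF c fc])
    moreover have "ennreal (1156 * (2 * R)) + ennreal (2304 * C\<^sup>2 * (4 * R powr (1 / 2))) = ennreal (1156 * (2 * R) + 2304 * C\<^sup>2 * (4 * R powr (1 / 2)))"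
      by (rule ennreal_plus[symmetric]) (use R in auto)
    moreover have "ennreal (1156 * (2 * R) + 2304 * C\<^sup>2 * (4 * R powr (1 / 2))) + ennreal (?c * far_const R)
       = ennreal (1156 * (2 * R) + 2304 * C\<^sup>2 * (4 * R powr (1 / 2)) + ?c * far_const R)"
      by (rule ennreal_plus[symmetric]) (use R mult_nonneg_nonneg[OF c fc] in auto)
    ultimately show ?thesis by simp
  qed
  finally show ?thesis .
qed

section \<open>Local integrability of the supremum\<close>

lemma japanese_bracket_ge: "1 \<le> japanese_bracket t" "t \<le> japanese_bracket t"
proof -
  have "japanese_bracket t = sqrt (1 + t\<^sup>2)" by (simp add: japanese_bracket_def powr_half_sqrt)
  moreover have "\<bar>t\<bar> \<le> sqrt (1 + t\<^sup>2)" by (intro real_le_rsqrt) simp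
  ultimately show "1 \<le> japanese_bracket t" "t \<le> japanese_bracket t" by auto
qed

text \<open>A Lebesgue measurable potential agrees almost everywhere with a Borel function, which can
be truncated so that the decay holds at every time. Measurability on product spaces then refers
to Borel sets only.\<close>

lemma borel_decaying_version:
  fixes v :: "real \<Rightarrow> real"
  assumes v: "v \<in> borel_measurable (lebesgue_on {0..})" and \<gamma>: "\<gamma> > 3 / 4"
    and C: "\<forall>t\<ge>0. \<bar>v t\<bar> \<le> C * japanese_bracket t powr (- \<gamma>)"
  obtains v' N where "decaying_potential v' C (\<gamma> - 3 / 4)" "negligible N"
    "\<And>t. 0 \<le> t \<Longrightarrow> t \<notin> N \<Longrightarrow> v' t = v t"
proof -
  have C0: "0 \<le> C" using C[rule_format, of 0] by (simp add: japanese_bracket_def)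
  have "(\<lambda>t. if t \<in> {0..} then v t else 0) \<in> borel_measurable lebesgue"
    using v by (subst borel_measurable_if) auto
  then obtain w where w [measurable]: "w \<in> borel_measurable lborel"
    and eq: "AE t in lborel. (if t \<in> {0..} then v t else 0) = w t"
    using completion_ex_borel_measurable_real by blast
  obtain N where N: "{t \<in> space lborel. \<not> (if t \<in> {0..} then v t else 0) = w t} \<subseteq> N" "emeasure lborel N = 0" "N \<in> sets lborel"
    using AE_E[OF eq] by blast
  then have "N \<in> null_sets lborel" by auto
  then have "negligible N" by (simp add: negligible_iff_null_sets null_sets_completionI)
  have wb [measurable]: "w \<in> borel_measurable borel" using w by simp
  define v' where "v' t = (if 0 < t \<and> \<bar>w t\<bar> \<le> C * japanese_bracket t powr (- \<gamma>) then w t else 0)" for t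
  have bound: "\<bar>v' t\<bar> \<le> C * japanese_bracket t powr (- \<gamma>)" for t
    using C0 by (simp add: v'_def)
  have [measurable]: "japanese_bracket \<in> borel_measurable borel"
    unfolding japanese_bracket_def[abs_def] by measurable
  have v'm: "v' \<in> borel_measurable borel" unfolding v'_def[abs_def] by measurable
  show thesis
  proof (rule that[of v' "N \<union> {0}"])
    show "negligible (N \<union> {0})" using \<open>negligible N\<close> by simp
    show "v' t = v t" if "0 \<le> t" "t \<notin> N \<union> {0}" for t
    proof -
      have "t \<notin> {t \<in> space lborel. \<not> (if t \<in> {0..} then v t else 0) = w t}" using N(1) that(2) by blast
      then have "w t = v t" using that(1) by simp
      then show ?thesis using that C by (simp add: v'_def)
    qed
    show "decaying_potential v' C (\<gamma> - 3 / 4)"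
    proof
      show "locally_bounded v'" unfolding locally_bounded_def
      proof (intro conjI allI exI ballI v'm)
        fix t
        have "japanese_bracket t powr (- \<gamma>) \<le> 1 powr (- \<gamma>)"
          using japanese_bracket_ge(1)[of t] \<gamma> by (intro powr_mono2') auto
        then have "C * japanese_bracket t powr (- \<gamma>) \<le> C * 1" using C0 by (intro mult_left_mono) auto
        then show "norm (v' t) \<le> C" using bound[of t] by simp
      qed
      show "0 \<le> C" by (rule C0)
      show "0 < \<gamma> - 3 / 4" using \<gamma> by simp
      fix t :: real assume t: "0 \<le> t"
      have *: "\<bar>v' t\<bar> \<le> C * t powr (- \<beta>)" if "0 < \<beta>" "\<beta> \<le> \<gamma>" for \<beta>
      proof (cases "t = 0")
        case False
        have "\<bar>v' t\<bar> \<le> C * japanese_bracket t powr (- \<gamma>)" by (rule bound)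
        also have "\<dots> \<le> C * japanese_bracket t powr (- \<beta>)"
          using that japanese_bracket_ge(1)[of t] C0 by (intro mult_left_mono powr_mono) auto
        also have "\<dots> \<le> C * t powr (- \<beta>)"
          using that False t japanese_bracket_ge(2)[of t] C0 by (intro mult_left_mono powr_mono2') auto
        finally show ?thesis .
      qed (simp add: v'_def)
      show "\<bar>v' t\<bar> \<le> C * t powr (- (3 / 4 + (\<gamma> - 3 / 4)))" using *[of \<gamma>] \<gamma> by simp
      show "\<bar>v' t\<bar> \<le> C * t powr (- (3 / 4))" using *[of "3 / 4"] \<gamma> by simp
    qed
  qed
qed

text \<open>The supremum may range over an uncountable set: it is lower semicontinuous.\<close>

lemma borel_measurable_SUP_continuous:
  fixes f :: "'i \<Rightarrow> real \<Rightarrow> real"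
  assumes "\<And>i. i \<in> I \<Longrightarrow> continuous_on UNIV (f i)"
  shows "(\<lambda>k. SUP i\<in>I. ennreal (f i k)) \<in> borel_measurable borel"
proof (rule borel_measurableI_greater)
  fix y
  have "{k \<in> space borel. y < (SUP i\<in>I. ennreal (f i k))} = (\<Union>i\<in>I. {k. y < ennreal (f i k)})"
    by (auto simp: less_SUP_iff)
  also have "open \<dots>"
    by (intro open_UN ballI open_Collect_less continuous_on_const continuous_on_ennreal assms)
  finally show "{k \<in> space borel. y < (SUP i\<in>I. ennreal (f i k))} \<in> sets borel" by (rule borel_open)
qed

theorem theorem5p2:
  fixes \<gamma> :: real and v :: "real \<Rightarrow> real"
    and x :: "real \<Rightarrow> real \<Rightarrow> nat \<Rightarrow> complex"
  assumes "\<gamma> > 3 / 4"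
    and "v \<in> borel_measurable (lebesgue_on {0..})"
    and "\<exists>C. \<forall>t\<ge>0. \<bar>v t\<bar> \<le> C * japanese_bracket t powr (- \<gamma>)"
    and "\<And>k. weak_solution v k (\<lambda>t. x t k)"
  shows "L1_loc (\<lambda>k. SUP t\<in>{0<..}. \<Sum>n. ennreal ((real (Suc n))\<^sup>2 * (cmod (x t k (Suc n)))\<^sup>2))"
proof -
  obtain C where C: "\<forall>t\<ge>0. \<bar>v t\<bar> \<le> C * japanese_bracket t powr (- \<gamma>)" using assms(3) by blast
  obtain v' N where dp: "decaying_potential v' C (\<gamma> - 3 / 4)" and N: "negligible N"
    "\<And>t. 0 \<le> t \<Longrightarrow> t \<notin> N \<Longrightarrow> v' t = v t"
    using borel_decaying_version[OF assms(2,1) C] by metis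
  interpret decaying_potential v' C "\<gamma> - 3 / 4" by fact
  define a where "a k = interaction k (\<lambda>t. x t k)" for k
  have uf: "unit_flow v' k (a k)" for k
    unfolding a_def unit_flow_def
    using v interaction_flow[OF v N assms(4)] interaction_mass_le_1[OF v N assms(4)] by blast
  have na: "cmod (a k t n) = cmod (x t k n)" if "0 \<le> t" for k t n
    unfolding a_def by (rule norm_interaction[OF that])
  define E where "E j t k = (\<Sum>n<j. (real (Suc n))\<^sup>2 * (cmod (x t k (Suc n)))\<^sup>2)" for j :: nat and t k
  define F where "F j k = (SUP t\<in>{0<..real j}. ennreal (E j t k))" for j k
  let ?f = "\<lambda>k. SUP t\<in>{0<..}. \<Sum>n. ennreal ((real (Suc n))\<^sup>2 * (cmod (x t k (Suc n)))\<^sup>2)"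
  have E_cont: "continuous_on UNIV (E j t)" if "0 \<le> t" for j t
    unfolding E_def[abs_def] na[OF that, symmetric]
    by (intro continuous_intros unit_flow_continuous_parameter[OF uf that])
  have F_meas [measurable]: "F j \<in> borel_measurable borel" for j
    unfolding F_def[abs_def] by (rule borel_measurable_SUP_continuous) (auto intro: E_cont)
  have E_nonneg: "0 \<le> E j t k" for j t k unfolding E_def by (intro sum_nonneg) auto
  have E_mono: "E i t k \<le> E j t k" if "i \<le> j" for i j t k
    unfolding E_def using that by (intro sum_mono2) auto
  have F_inc: "incseq F"
    unfolding incseq_def le_fun_def F_def
    by (intro allI impI SUP_mono) (meson E_mono ennreal_leI greaterThanAtMost_iff of_nat_mono order.trans)
  have series: "(\<Sum>n. ennreal ((real (Suc n))\<^sup>2 * (cmod (x t k (Suc n)))\<^sup>2)) = (SUP j. ennreal (E j t k))" for t k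
    unfolding suminf_eq_SUP E_def by (simp add: sum_ennreal)
  have f_eq: "?f = (\<lambda>k. SUP j. F j k)"
  proof (intro ext antisym)
    fix k
    show "?f k \<le> (SUP j. F j k)"
      unfolding series
    proof (intro SUP_least)
      fix t :: real and i :: nat assume t: "t \<in> {0<..}"
      \<comment> \<open>One index bounds both the length of the partial sum and the range of times.\<close>
      define j where "j = max i (nat \<lceil>t\<rceil>)"
      have "t \<le> real j" unfolding j_def by linarith
      have "ennreal (E i t k) \<le> ennreal (E j t k)"
        by (intro ennreal_leI E_mono) (simp add: j_def)
      also have "\<dots> \<le> F j k"
        unfolding F_def using t \<open>t \<le> real j\<close> by (intro SUP_upper) auto
      also have "\<dots> \<le> (SUP j. F j k)" by (rule SUP_upper) simp
      finally show "ennreal (E i t k) \<le> (SUP j. F j k)" .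
    qed
    show "(SUP j. F j k) \<le> ?f k"
      unfolding series F_def
    proof (intro SUP_least)
      fix j t assume t: "t \<in> {0<..real j}"
      have "ennreal (E j t k) \<le> (SUP j. ennreal (E j t k))" by (rule SUP_upper) simp
      also have "\<dots> \<le> (SUP t\<in>{0<..}. SUP j. ennreal (E j t k))" using t by (intro SUP_upper) auto
      finally show "ennreal (E j t k) \<le> (SUP t\<in>{0<..}. SUP j. ennreal (E j t k))" .
    qed
  qed
  have f_meas: "?f \<in> borel_measurable borel"
    unfolding f_eq by measurable
  have main: "(\<integral>\<^sup>+k\<in>{-R..R}. ?f k \<partial>lborel) < \<infinity>" if R: "0 < R" for R
  proof -
    define B where "B = 1156 * (2 * R) + 2304 * C\<^sup>2 * (4 * R powr (1 / 2)) + 3456 * ((1 / R) powr (- (\<gamma> - 3 / 4)) / (\<gamma> - 3 / 4) * C\<^sup>2) * far_const R"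
    have "(\<integral>\<^sup>+k\<in>{-R..R}. F j k \<partial>lborel) \<le> ennreal B" for j
    proof -
      have "F j k \<le> (SUP t\<in>{0<..real j}. ennreal (unit_flow.energy (a k) (Suc j) t))" for k
        unfolding F_def
      proof (intro SUP_mono bexI ennreal_leI)
        \<comment> \<open>Truncating at \<open>Suc j\<close> leaves the weights \<open>n\<^sup>2\<close> unchanged for \<open>n \<le> j\<close>.\<close>
        interpret unit_flow v' k "a k" by (rule uf)
        fix t assume t: "t \<in> {0<..real j}"
        then have t0: "0 \<le> t" by simp
        have "E j t k = (\<Sum>n<Suc j. (real (min n (Suc j)))\<^sup>2 * (cmod (a k t n))\<^sup>2)"
          unfolding E_def na[OF t0] sum.lessThan_Suc_shift by (auto intro!: sum.cong)
        also have "\<dots> \<le> energy (Suc j) t" by (rule weighted_mass_le_energy[OF t0])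
        finally show "E j t k \<le> energy (Suc j) t" .
      qed
      then have "(\<integral>\<^sup>+k\<in>{-R..R}. F j k \<partial>lborel)
          \<le> (\<integral>\<^sup>+k\<in>{-R..R}. (SUP t\<in>{0<..real j}. ennreal (unit_flow.energy (a k) (Suc j) t)) \<partial>lborel)"
        by (intro nn_integral_mono mult_right_mono) auto
      also have "\<dots> \<le> ennreal B" unfolding B_def by (rule sup_energy_integral_le[OF uf R])
      finally show ?thesis .
    qed
    moreover have "(\<integral>\<^sup>+k\<in>{-R..R}. ?f k \<partial>lborel) = (SUP j. \<integral>\<^sup>+k\<in>{-R..R}. F j k \<partial>lborel)"
    proof -
      have "(\<integral>\<^sup>+k\<in>{-R..R}. ?f k \<partial>lborel) = (\<integral>\<^sup>+k. (SUP j. F j k * indicator {-R..R} k) \<partial>lborel)"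
        by (simp only: fun_cong[OF f_eq] SUP_mult_right_ennreal)
      also have "\<dots> = (SUP j. \<integral>\<^sup>+k\<in>{-R..R}. F j k \<partial>lborel)"
        using F_inc by (intro nn_integral_monotone_convergence_SUP)
          (auto simp: incseq_def le_fun_def intro!: mult_right_mono)
      finally show ?thesis .
    qed
    ultimately have "(\<integral>\<^sup>+k\<in>{-R..R}. ?f k \<partial>lborel) \<le> ennreal B" by (simp add: SUP_least)
    then show ?thesis by (simp add: le_less_trans)
  qed
  show ?thesis
    unfolding L1_loc_def
  proof (intro conjI allI impI)
    show "?f \<in> borel_measurable lebesgue" using f_meas by (intro measurable_completion) simp
    fix K :: "real set" assume K: "compact K"
    then have "bounded K" by (rule compact_imp_bounded)
    then obtain R where R: "0 < R" "\<And>k. k \<in> K \<Longrightarrow> norm k \<le> R"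
      unfolding bounded_pos by blast
    have KR: "K \<subseteq> {-R..R}"
    proof
      fix k assume "k \<in> K"
      then have "\<bar>k\<bar> \<le> R" using R(2)[of k] by simp
      then show "k \<in> {-R..R}" by auto
    qed
    have ind: "indicator K k \<le> (indicator {-R..R} k :: ennreal)" for k
      using KR by (auto simp: indicator_def)
    have "(\<integral>\<^sup>+k\<in>K. ?f k \<partial>lebesgue) \<le> (\<integral>\<^sup>+k\<in>{-R..R}. ?f k \<partial>lebesgue)"
      by (intro nn_integral_mono mult_left_mono ind zero_le)
    also have "\<dots> = (\<integral>\<^sup>+k\<in>{-R..R}. ?f k \<partial>lborel)"
      by (rule nn_integral_completion)
    also have "\<dots> < \<infinity>" by (rule main[OF R(1)])
    finally show "(\<integral>\<^sup>+k\<in>K. ?f k \<partial>lebesgue) < \<infinity>" .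
  qed
qed

end
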